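(* Suppose LTE transmits continuously, so that the medium access indicator of a Wi-Fi AP $x_i\in\Phi_W$ is $$e_i^W=\prod_{y_k\in\Phi_L}\mathbf 1_{\{G^{LW}_{k,i}/l(\|y_k-x_i\|)\le \Gamma_{ed}/P_L\}}\ \prod_{x_j\in\Phi_W\setminus\{x_i\}}\Bigl(\mathbf 1_{\{t_j^W\ge t_i^W\}}+\mathbf 1_{\{t_j^W<t_i^W\}}\mathbf 1_{\{G^W_{j,i}/l(\|x_j-x_i\|)\le \Gamma_{cs}/P_W\}}\Bigr).$$ Let $x_0$ be the tagged AP, i.e. the point of $\Phi_W$ closest to the origin. Then its medium access probability $\hat p^W_{0,\mathrm{MAP}}(\lambda_W,\lambda_L)=\mathbb P(e_0^W=1)$ is $$\hat p^W_{0,\mathrm{MAP}}(\lambda_W,\lambda_L)=\int_0^\infty \frac{1-\exp(-N_2^W(r_0))}{N_2^W(r_0)}\exp(-N^L)\,f_W(r_0)\,dr_0 .$$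
   Context: Wi-Fi access points (APs) form a homogeneous Poisson point process $\Phi_W=\{x_i\}$ on $\mathbb R^2$ with intensity $\lambda_W>0$; LTE base stations (eNBs) form an independent homogeneous Poisson point process $\Phi_L=\{y_k\}$ on $\mathbb R^2$ with intensity $\lambda_L>0$. Transmit powers are $P_W,P_L>0$. The path loss is $l(d)=(4\pi/\lambda_c)^2 d^{\alpha}$ with wavelength $\lambda_c>0$ and path loss exponent $\alpha>0$. $\Gamma_{cs},\Gamma_{ed}>0$ are the carrier sensing and energy detection thresholds. Each AP $x_i$ carries a back-off timer $t_i^W$ uniform on $[0,1]$. $G^W_{j,i}$ is the fading from AP $x_j$ to AP $x_i$ and $G^{LW}_{k,i}$ the fading from eNB $y_k$ to AP $x_i$; all fading variables are i.i.d. exponential with $\mathbb P(G>s)=e^{-\mu s}$, $\mu>0$. The point processes, the timers and the fading variables are all mutually independent. $B(0,r)$ is the closed ball of radius $r$ centred at the origin. Define $$N^L=\lambda_L\int_{\mathbb R^2}\exp\Bigl(-\mu\tfrac{\Gamma_{ed}}{P_L}l(\|x\|)\Bigr)dx,\qquad N_2^W(r)=\lambda_W\int_{\mathbb R^2\setminus B(0,r)}\exp\Bigl(-\mu\tfrac{\Gamma_{cs}}{P_W}l(\|x-(r,0)\|)\Bigr)dx,$$ and $f_W(r)=2\pi\lambda_W r\exp(-\lambda_W\pi r^2)$, the density of the distance from the origin to the closest AP. *)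

theory Defs
  imports "HOL-Probability.Probability"
begin

(* A point process with infinitely many points is given by an enumeration X 0, X 1, ... of its
   points, without repetition and locally finite.  Almost sure finiteness of the counts matters:
   card of an infinite set is 0. *)
definition poisson_point_process ::
  "'w measure \<Rightarrow> real \<Rightarrow> (nat \<Rightarrow> 'w \<Rightarrow> 'a::euclidean_space) \<Rightarrow> bool" where
  "poisson_point_process M lam X \<longleftrightarrow>
     (\<forall>i. X i \<in> borel_measurable M) \<and>
     (AE \<omega> in M. inj (\<lambda>i. X i \<omega>) \<and> (\<forall>B. bounded B \<longrightarrow> finite {i. X i \<omega> \<in> B})) \<and>
     (\<forall>B\<in>sets borel. bounded B \<longrightarrow>
        (\<forall>n. measure M {\<omega>\<in>space M. card {i. X i \<omega> \<in> B} = n} =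
             (lam * measure lborel B) ^ n / fact n * exp (- (lam * measure lborel B)))) \<and>
     (\<forall>(B :: nat \<Rightarrow> 'a set) m.
        (\<forall>k<m. B k \<in> sets borel \<and> bounded (B k)) \<and> disjoint_family_on B {..<m} \<longrightarrow>
        prob_space.indep_vars M (\<lambda>_. count_space UNIV)
          (\<lambda>k \<omega>. card {i. X i \<omega> \<in> B k}) {..<m})"

(* GW j i is the fading from AP j to AP i, GLW k i the fading from eNB k to AP i. *)
datatype source = APs | ENBs | Timer nat | Fading_W nat nat | Fading_LW nat nat

(* The timers and fading variables are marks: they are independent of the enumerated point
   processes (as random sequences), not only of the underlying point sets. *)
definition mutually_independent ::
  "'w measure \<Rightarrow> (nat \<Rightarrow> 'w \<Rightarrow> real^2) \<Rightarrow> (nat \<Rightarrow> 'w \<Rightarrow> real^2) \<Rightarrow> (nat \<Rightarrow> 'w \<Rightarrow> real) \<Rightarrow>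
   (nat \<Rightarrow> nat \<Rightarrow> 'w \<Rightarrow> real) \<Rightarrow> (nat \<Rightarrow> nat \<Rightarrow> 'w \<Rightarrow> real) \<Rightarrow> bool" where
  "mutually_independent M X Y T GW GLW \<longleftrightarrow>
     prob_space.indep_sets M
       (\<lambda>s. case s of
          APs \<Rightarrow> sets (vimage_algebra (space M) (\<lambda>\<omega> i. X i \<omega>) (\<Pi>\<^sub>M i\<in>UNIV. borel))
        | ENBs \<Rightarrow> sets (vimage_algebra (space M) (\<lambda>\<omega> k. Y k \<omega>) (\<Pi>\<^sub>M k\<in>UNIV. borel))
        | Timer i \<Rightarrow> sets (vimage_algebra (space M) (T i) borel)
        | Fading_W j i \<Rightarrow> sets (vimage_algebra (space M) (GW j i) borel)
        | Fading_LW k i \<Rightarrow> sets (vimage_algebra (space M) (GLW k i) borel))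
       UNIV"

definition path_loss :: "real \<Rightarrow> real \<Rightarrow> real \<Rightarrow> real" where
  "path_loss lamc \<alpha> d = (4 * pi / lamc)^2 * d powr \<alpha>"

(* The infinite products are limits of partial products; the factors are 0 or 1, so the limits
   always exist, whereas prodinf is unspecified if infinitely many factors vanish. *)
definition medium_access ::
  "(real \<Rightarrow> real) \<Rightarrow> real \<Rightarrow> real \<Rightarrow> real \<Rightarrow> real \<Rightarrow>
   (nat \<Rightarrow> 'w \<Rightarrow> real^2) \<Rightarrow> (nat \<Rightarrow> 'w \<Rightarrow> real^2) \<Rightarrow> (nat \<Rightarrow> 'w \<Rightarrow> real) \<Rightarrow>
   (nat \<Rightarrow> nat \<Rightarrow> 'w \<Rightarrow> real) \<Rightarrow> (nat \<Rightarrow> nat \<Rightarrow> 'w \<Rightarrow> real) \<Rightarrow> nat \<Rightarrow> 'w \<Rightarrow> real" where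
  "medium_access l PW PL \<Gamma>cs \<Gamma>ed X Y T GW GLW i \<omega> =
     lim (\<lambda>n. \<Prod>k<n. of_bool (GLW k i \<omega> / l (norm (Y k \<omega> - X i \<omega>)) \<le> \<Gamma>ed / PL)) *
     lim (\<lambda>n. \<Prod>j\<in>{..<n} - {i}.
            of_bool (T j \<omega> \<ge> T i \<omega>) +
            of_bool (T j \<omega> < T i \<omega>) *
            of_bool (GW j i \<omega> / l (norm (X j \<omega> - X i \<omega>)) \<le> \<Gamma>cs / PW))"

(* Ties have probability 0; LEAST breaks them measurably. *)
definition tagged :: "(nat \<Rightarrow> 'w \<Rightarrow> 'a::real_normed_vector) \<Rightarrow> 'w \<Rightarrow> nat" where
  "tagged X \<omega> = (LEAST i. \<forall>j. norm (X i \<omega>) \<le> norm (X j \<omega>))"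

definition tagged_MAP ::
  "'w measure \<Rightarrow> (real \<Rightarrow> real) \<Rightarrow> real \<Rightarrow> real \<Rightarrow> real \<Rightarrow> real \<Rightarrow>
   (nat \<Rightarrow> 'w \<Rightarrow> real^2) \<Rightarrow> (nat \<Rightarrow> 'w \<Rightarrow> real^2) \<Rightarrow> (nat \<Rightarrow> 'w \<Rightarrow> real) \<Rightarrow>
   (nat \<Rightarrow> nat \<Rightarrow> 'w \<Rightarrow> real) \<Rightarrow> (nat \<Rightarrow> nat \<Rightarrow> 'w \<Rightarrow> real) \<Rightarrow> real" where
  "tagged_MAP M l PW PL \<Gamma>cs \<Gamma>ed X Y T GW GLW =
     measure M {\<omega>\<in>space M.
       medium_access l PW PL \<Gamma>cs \<Gamma>ed X Y T GW GLW (tagged X \<omega>) \<omega> = 1}"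

definition N_L :: "(real \<Rightarrow> real) \<Rightarrow> real \<Rightarrow> real \<Rightarrow> real \<Rightarrow> real \<Rightarrow> real" where
  "N_L l lamL PL \<Gamma>ed \<mu> =
     lamL * (LINT x::real^2|lborel. exp (- \<mu> * (\<Gamma>ed / PL) * l (norm x)))"

definition N2_W :: "(real \<Rightarrow> real) \<Rightarrow> real \<Rightarrow> real \<Rightarrow> real \<Rightarrow> real \<Rightarrow> real \<Rightarrow> real" where
  "N2_W l lamW PW \<Gamma>cs \<mu> r =
     lamW * (LINT x : - cball (0::real^2) r|lborel.
       exp (- \<mu> * (\<Gamma>cs / PW) * l (norm (x - vector [r, 0]))))"

definition f_W :: "real \<Rightarrow> real \<Rightarrow> real" where
  "f_W lamW r = 2 * pi * lamW * r * exp (- lamW * pi * r^2)"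

end

theory Submission
  imports Defs
begin

text \<open>Given all positions, the timers and fadings are independent, so the conditional access probability
  of the tagged point \<open>x\<^sub>0\<close> is the integral over its timer \<open>t\<close> of
  \<open>\<Prod>\<^sub>j (1 - t h(x\<^sub>0, x\<^sub>j))\<close>, times \<open>\<Prod>\<^sub>k (1 - q(x\<^sub>0, y\<^sub>k))\<close>. The Laplace functional of the
  eNB process turns the second factor into \<open>exp (- N\<^sup>L)\<close>, whatever \<open>x\<^sub>0\<close> is.
  Being the closest point is again a product condition: with \<open>u\<^sub>x(z) = 1\<close> for \<open>|z| \<le> |x|\<close> and
  \<open>u\<^sub>x(z) = t h(x, z)\<close> elsewhere, the first product is
  \<open>\<Sum>\<^sub>i \<Prod>\<^sub>j\<^sub>\<noteq>\<^sub>i (1 - u\<^bsub>x\<^sub>i\<^esub>(x\<^sub>j))\<close>, whose expectation is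
  \<open>\<lambda> \<integral> exp (- \<lambda> \<integral> u\<^sub>x) dx\<close> by a Mecke formula. Integrating over \<open>t\<close> and passing to polar
  coordinates gives the claim.\<close>

subsection \<open>Infinite products\<close>

text \<open>The process is known only through its counts on bounded Borel sets. The Laplace
  functional can be computed from these directly, and the Mecke formula follows from it by
  differentiation, but only for a weight that stays fixed while the candidate point ranges over one
  bounded cell. The obstacle is that the actual weight moves with the candidate point. A weight
  depending on the point through its cell alone is treated exactly; refining the partition, and then
  removing the assumption of bounded support, gives the weight centred at the point itself.
  Uniqueness of the closest point comes out of the same formula: with weight 0 outside the ball it
  computes the probability that a strictly closest point exists, and the value is 1. The timer of
  the tagged AP enters every contention condition at once, so these conditions are independent only
  for a fixed value \<open>t\<close>. The Mecke formula is therefore applied for each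
  \<open>t\<close> separately, and the average over \<open>t\<close> is postponed to the
  end.\<close>

definition iprod :: "(nat \<Rightarrow> real) \<Rightarrow> ennreal" where
  "iprod f = (INF n. ennreal (\<Prod>j<n. f j))"

lemma decseq_partial_prod:
  assumes "\<And>j. 0 \<le> f j" "\<And>j. f j \<le> (1::real)"
  shows "decseq (\<lambda>n. ennreal (\<Prod>j<n. f j))"
proof (rule decseq_SucI)
  fix n
  have "(\<Prod>j<n. f j) * f n \<le> (\<Prod>j<n. f j) * 1"
    by (intro mult_left_mono prod_nonneg) (auto simp: assms)
  then show "ennreal (\<Prod>j<Suc n. f j) \<le> ennreal (\<Prod>j<n. f j)"
    by (intro ennreal_leI) simp
qed

lemma iprod_LIMSEQ:
  assumes "\<And>j. 0 \<le> f j" "\<And>j. f j \<le> 1"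
  shows "(\<lambda>n. ennreal (\<Prod>j<n. f j)) \<longlonglongrightarrow> iprod f"
  unfolding iprod_def by (rule LIMSEQ_INF[OF decseq_partial_prod[OF assms]])

text \<open>Being a countable infimum, \<open>iprod\<close> inherits measurability from its factors
  alone; no convergence of the product has to be known.\<close>

lemma borel_measurable_iprod [measurable]:
  assumes [measurable]: "\<And>j. (\<lambda>x. f x j) \<in> borel_measurable M"
  shows "(\<lambda>x. iprod (f x)) \<in> borel_measurable M"
  unfolding iprod_def by measurable

lemma iprod_le_1: "iprod f \<le> 1"
  unfolding iprod_def by (rule INF_lower2[of 0]) auto

lemma iprod_finite_support:
  assumes f: "\<And>j. 0 \<le> f j" "\<And>j. f j \<le> 1" and J: "finite J" "\<And>j. j \<notin> J \<Longrightarrow> f j = 1"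
  shows "iprod f = ennreal (\<Prod>j\<in>J. f j)"
proof -
  obtain N where N: "J \<subseteq> {..<N}"
    using finite_nat_bounded[OF J(1)] by auto
  have "eventually (\<lambda>n. ennreal (\<Prod>j<n. f j) = ennreal (\<Prod>j\<in>J. f j)) sequentially"
  proof (rule eventually_sequentiallyI[of N])
    fix n assume "N \<le> n"
    with N J have "(\<Prod>j<n. f j) = (\<Prod>j\<in>J. f j)"
      by (intro prod.mono_neutral_right) auto
    then show "ennreal (\<Prod>j<n. f j) = ennreal (\<Prod>j\<in>J. f j)" by simp
  qed
  then have "(\<lambda>n. ennreal (\<Prod>j<n. f j)) \<longlonglongrightarrow> ennreal (\<Prod>j\<in>J. f j)"
    by (rule tendsto_eventually)
  with iprod_LIMSEQ[of f, OF f] show ?thesis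
    by (rule LIMSEQ_unique)
qed

text \<open>For a fixed number of factors the product is continuous, and the two infima commute.
  Without monotonicity the interchange fails: if the \<open>n\<close>-th sequence is 0 at
  \<open>j = n\<close> and 1 elsewhere, every product is 0 although each factor tends to 1.\<close>

lemma iprod_INF:
  assumes f: "\<And>n j. 0 \<le> f n j" "\<And>n j. f n j \<le> 1"
    and dec: "\<And>j. decseq (\<lambda>n. f n j)" and lim: "\<And>j. (\<lambda>n. f n j) \<longlonglongrightarrow> g j"
  shows "(INF n. iprod (f n)) = iprod g"
proof -
  have "(INF n. ennreal (\<Prod>j<m. f n j)) = ennreal (\<Prod>j<m. g j)" for m
  proof (rule LIMSEQ_unique)
    show "(\<lambda>n. ennreal (\<Prod>j<m. f n j)) \<longlonglongrightarrow> (INF n. ennreal (\<Prod>j<m. f n j))"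
      using dec by (intro LIMSEQ_INF) (auto intro!: ennreal_leI prod_mono f simp: decseq_def)
    show "(\<lambda>n. ennreal (\<Prod>j<m. f n j)) \<longlonglongrightarrow> ennreal (\<Prod>j<m. g j)"
      by (intro tendsto_intros lim)
  qed
  then show ?thesis
    unfolding iprod_def by (subst INF_commute) simp
qed

lemma iprod_LIMSEQ_decseq:
  assumes f: "\<And>n j. 0 \<le> f n j" "\<And>n j. f n j \<le> 1"
    and dec: "\<And>j. decseq (\<lambda>n. f n j)" and lim: "\<And>j. (\<lambda>n. f n j) \<longlonglongrightarrow> g j"
  shows "(\<lambda>n. iprod (f n)) \<longlonglongrightarrow> iprod g"
proof -
  have "decseq (\<lambda>n. iprod (f n))"
    unfolding iprod_def decseq_def using dec
    by (auto intro!: INF_mono' ennreal_leI prod_mono f simp: decseq_def)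
  from LIMSEQ_INF[OF this] show ?thesis
    using iprod_INF[of f, OF assms] by simp
qed

lemma iprod_eq_0:
  assumes "\<And>j. 0 \<le> f j" "\<And>j. f j \<le> 1" "f k = 0"
  shows "iprod f = 0"
proof -
  have "iprod f \<le> ennreal (\<Prod>j<Suc k. f j)"
    unfolding iprod_def by (rule INF_lower) simp
  also have "\<dots> = 0" using assms(3) by simp
  finally show ?thesis by simp
qed

text \<open>The factors with index in \<open>K\<close> are replaced by 1 instead of being removed,
  so the remaining product still runs over all indices.\<close>

lemma iprod_split:
  assumes f: "\<And>j. 0 \<le> f j" "\<And>j. f j \<le> 1" and K: "finite K"
  shows "iprod f = ennreal (\<Prod>j\<in>K. f j) * iprod (\<lambda>j. if j \<in> K then 1 else f j)"
proof -
  let ?g = "\<lambda>j. if j \<in> K then 1 else f j"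
  obtain N where N: "K \<subseteq> {..<N}"
    using finite_nat_bounded[OF K] by auto
  have "(\<Prod>j<n. f j) = (\<Prod>j\<in>K. f j) * (\<Prod>j<n. ?g j)" if "N \<le> n" for n
  proof -
    have "(\<Prod>j<n. f j) = (\<Prod>j<n. (if j \<in> K then f j else 1) * ?g j)"
      by (rule prod.cong) auto
    also have "\<dots> = (\<Prod>j<n. if j \<in> K then f j else 1) * (\<Prod>j<n. ?g j)"
      by (rule prod.distrib)
    also have "(\<Prod>j<n. if j \<in> K then f j else 1) = (\<Prod>j\<in>K. f j)"
      using N that by (subst prod.If_cases) (auto intro!: prod.cong)
    finally show ?thesis .
  qed
  then have ev: "eventually (\<lambda>n. ennreal (\<Prod>j\<in>K. f j) * ennreal (\<Prod>j<n. ?g j) = ennreal (\<Prod>j<n. f j)) sequentially"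
    by (intro eventually_sequentiallyI[of N])
      (auto simp: ennreal_mult[symmetric] prod_nonneg f)
  have "(\<lambda>n. ennreal (\<Prod>j\<in>K. f j) * ennreal (\<Prod>j<n. ?g j)) \<longlonglongrightarrow> ennreal (\<Prod>j\<in>K. f j) * iprod ?g"
    by (intro ennreal_tendsto_cmult iprod_LIMSEQ) (auto simp: f)
  with ev have "(\<lambda>n. ennreal (\<Prod>j<n. f j)) \<longlonglongrightarrow> ennreal (\<Prod>j\<in>K. f j) * iprod ?g"
    by (rule Lim_transform_eventually[rotated])
  with iprod_LIMSEQ[of f, OF f] show ?thesis
    by (rule LIMSEQ_unique)
qed

subsection \<open>The Laplace functional and a Mecke formula\<close>

locale poisson_process = prob_space M for M :: "'w measure" +
  fixes lam :: real and X :: "nat \<Rightarrow> 'w \<Rightarrow> 'a::euclidean_space"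
  assumes lam_pos: "0 < lam" and poisson: "poisson_point_process M lam X"
begin

lemma points_measurable [measurable]: "X i \<in> borel_measurable M"
  using poisson unfolding poisson_point_process_def by auto

lemma AE_locally_finite: "AE \<omega> in M. \<forall>B. bounded B \<longrightarrow> finite {i. X i \<omega> \<in> B}"
  using poisson unfolding poisson_point_process_def by auto

definition count :: "'a set \<Rightarrow> 'w \<Rightarrow> nat" where
  "count B \<omega> = card {i. X i \<omega> \<in> B}"

lemma prob_count:
  assumes "B \<in> sets borel" "bounded B"
  shows "prob {\<omega>\<in>space M. count B \<omega> = n} =
      (lam * measure lborel B) ^ n / fact n * exp (- (lam * measure lborel B))"
  using poisson assms unfolding poisson_point_process_def count_def by auto

lemma indep_counts:
  assumes "\<And>k. k < m \<Longrightarrow> B k \<in> sets borel" "\<And>k. k < m \<Longrightarrow> bounded (B k)" "disjoint_family_on B {..<m}"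
  shows "indep_vars (\<lambda>_. count_space UNIV) (\<lambda>k \<omega>. count (B k) \<omega>) {..<m::nat}"
proof -
  have "\<forall>(B :: nat \<Rightarrow> 'a set) m.
      (\<forall>k<m. B k \<in> sets borel \<and> bounded (B k)) \<and> disjoint_family_on B {..<m} \<longrightarrow>
      indep_vars (\<lambda>_. count_space UNIV) (\<lambda>k \<omega>. card {i. X i \<omega> \<in> B k}) {..<m}"
    using poisson unfolding poisson_point_process_def by (elim conjE)
  from this[rule_format, of m B] assms show ?thesis
    unfolding count_def by simp
qed

text \<open>\<open>indep_vars\<close> includes the measurability of its members, so the independence
  clause for a family with a single set is enough.\<close>

lemma measurable_count [measurable]:
  assumes "B \<in> sets borel" "bounded B"
  shows "count B \<in> M \<rightarrow>\<^sub>M count_space UNIV"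
  using indep_vars_def[of "\<lambda>_. count_space UNIV" "\<lambda>k::nat. count B" "{..<1}"] indep_counts[of 1 "\<lambda>_. B"] assms
  by (auto simp: disjoint_family_on_def)

text \<open>The probability generating function of the Poisson law. At \<open>a = 0\<close> it is
  the void probability, since \<open>0 ^ 0\<close> is 1.\<close>

lemma nn_integral_power_count:
  assumes B: "B \<in> sets borel" "bounded B" and a: "0 \<le> a"
  shows "(\<integral>\<^sup>+\<omega>. ennreal (a ^ count B \<omega>) \<partial>M) = ennreal (exp (- (lam * measure lborel B * (1 - a))))"
proof -
  note [measurable] = measurable_count[OF B]
  let ?p = "lam * measure lborel B"
  have p: "0 \<le> ?p" using lam_pos by simp
  have "(\<integral>\<^sup>+\<omega>. ennreal (a ^ count B \<omega>) \<partial>M) =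
      (\<integral>\<^sup>+\<omega>. (\<Sum>n. ennreal (a ^ n) * indicator {\<omega>\<in>space M. count B \<omega> = n} \<omega>) \<partial>M)"
  proof (rule nn_integral_cong)
    fix \<omega> assume "\<omega> \<in> space M"
    then have "(\<lambda>n. ennreal (a ^ n) * indicator {\<omega>\<in>space M. count B \<omega> = n} \<omega>) =
        (\<lambda>n. if n = count B \<omega> then ennreal (a ^ n) else 0)"
      by (auto simp: fun_eq_iff indicator_def)
    then show "ennreal (a ^ count B \<omega>) = (\<Sum>n. ennreal (a ^ n) * indicator {\<omega>\<in>space M. count B \<omega> = n} \<omega>)"
      by (simp add: sums_unique[OF sums_single, symmetric])
  qed
  also have "\<dots> = (\<Sum>n. ennreal (a ^ n) * ennreal (prob {\<omega>\<in>space M. count B \<omega> = n}))"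
    by (subst nn_integral_suminf) (auto simp: nn_integral_cmult_indicator emeasure_eq_measure)
  also have "\<dots> = (\<Sum>n. ennreal (exp (- ?p) * ((a * ?p) ^ n /\<^sub>R fact n)))"
    using a p by (intro suminf_cong, subst ennreal_mult[symmetric])
      (use lam_pos in \<open>auto simp: prob_count[OF B] power_mult_distrib field_simps intro!: mult_nonneg_nonneg\<close>)
  also have "\<dots> = ennreal (exp (- ?p) * exp (a * ?p))"
    using a p sums_mult[OF exp_converges[of "a * ?p"], of "exp (- ?p)"]
    by (intro suminf_ennreal_eq) auto
  also have "exp (- ?p) * exp (a * ?p) = exp (- (?p * (1 - a)))"
    by (simp add: exp_add[symmetric] field_simps)
  finally show ?thesis .
qed

lemma nn_integral_prod_count:
  assumes B: "\<And>k. k < m \<Longrightarrow> B k \<in> sets borel" "\<And>k. k < m \<Longrightarrow> bounded (B k)" "disjoint_family_on B {..<m}"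
    and a: "\<And>k. k < m \<Longrightarrow> 0 \<le> a k"
  shows "(\<integral>\<^sup>+\<omega>. ennreal (\<Prod>k<m. a k ^ count (B k) \<omega>) \<partial>M) =
    ennreal (exp (- (lam * (\<Sum>k<m::nat. measure lborel (B k) * (1 - a k)))))"
proof -
  have "(\<integral>\<^sup>+\<omega>. ennreal (\<Prod>k<m. a k ^ count (B k) \<omega>) \<partial>M) =
      (\<integral>\<^sup>+\<omega>. (\<Prod>k<m. ennreal (a k ^ count (B k) \<omega>)) \<partial>M)"
    using a by (subst prod_ennreal) auto
  also have "\<dots> = (\<Prod>k<m. \<integral>\<^sup>+\<omega>. ennreal (a k ^ count (B k) \<omega>) \<partial>M)"
    by (intro indep_vars_nn_integral indep_vars_compose2[OF indep_counts[OF B]]) auto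
  also have "\<dots> = (\<Prod>k<m. ennreal (exp (- (lam * measure lborel (B k) * (1 - a k)))))"
    by (intro prod.cong refl nn_integral_power_count B a) auto
  also have "\<dots> = ennreal (exp (\<Sum>k<m. - (lam * measure lborel (B k) * (1 - a k))))"
    by (simp add: prod_ennreal exp_sum)
  finally show ?thesis
    by (simp add: sum_negf sum_distrib_left mult.assoc)
qed

text \<open>For a simple function the infinite product is a product over the finitely many level sets.\<close>

lemma laplace_functional_simple:
  fixes g :: "'a \<Rightarrow> real"
  assumes g: "simple_function borel g" and g01: "\<And>x. 0 \<le> g x" "\<And>x. g x \<le> 1"
    and bd: "bounded {x. g x \<noteq> 0}"
  shows "(\<integral>\<^sup>+\<omega>. iprod (\<lambda>j. 1 - g (X j \<omega>)) \<partial>M) = ennreal (exp (- (lam * (\<integral>x. g x \<partial>lborel))))"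
proof -
  \<comment> \<open>The value 0 is left out: its level set is unbounded and contributes only factors
    1.\<close>
  have fin: "finite (range g - {0})"
    using simple_functionD(1)[OF g] by simp
  then obtain h where h: "bij_betw h {..<card (range g - {0})} (range g - {0})"
    using ex_bij_betw_nat_finite[OF fin] by (auto simp: atLeast0LessThan)
  define m where "m = card (range g - {0})"
  define B where "B k = {x. g x = h k}" for k
  have hm: "bij_betw h {..<m} (range g - {0})"
    using h by (simp add: m_def)
  have h_ne: "h k \<noteq> 0" "h k \<in> range g" if "k < m" for k
    using hm that by (auto simp: bij_betw_def)
  have h01: "0 \<le> h k" "h k \<le> 1" if "k < m" for k
    using h_ne[OF that] g01 by auto
  have gm [measurable]: "g \<in> borel_measurable borel"
    by (rule borel_measurable_simple_function[OF g])
  have B: "B k \<in> sets borel" "bounded (B k)" if "k < m" for k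
  proof -
    show "B k \<in> sets borel" unfolding B_def by measurable
    show "bounded (B k)"
      using h_ne(1)[OF that] by (intro bounded_subset[OF bd]) (simp add: B_def subset_iff)
  qed
  have disj: "disjoint_family_on B {..<m}"
    using bij_betw_imp_inj_on[OF hm] by (auto simp: disjoint_family_on_def B_def inj_on_def)
  have UB: "{x. g x \<noteq> 0} = (\<Union>k<m. B k)"
  proof (intro equalityI subsetI)
    fix x assume "x \<in> {x. g x \<noteq> 0}"
    then have "g x \<in> h ` {..<m}"
      using hm by (auto simp: bij_betw_def)
    then show "x \<in> (\<Union>k<m. B k)"
      by (auto simp: B_def)
  next
    fix x assume "x \<in> (\<Union>k<m. B k)"
    then show "x \<in> {x. g x \<noteq> 0}"
      using h_ne(1) by (auto simp: B_def)
  qed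
  have "(\<integral>\<^sup>+\<omega>. iprod (\<lambda>j. 1 - g (X j \<omega>)) \<partial>M) = (\<integral>\<^sup>+\<omega>. ennreal (\<Prod>k<m. (1 - h k) ^ count (B k) \<omega>) \<partial>M)"
  proof (rule nn_integral_cong_AE, use AE_locally_finite in eventually_elim)
    fix \<omega> assume lf: "\<forall>B. bounded B \<longrightarrow> finite {i. X i \<omega> \<in> B}"
    let ?J = "\<Union>k<m. {j. X j \<omega> \<in> B k}"
    have Jfin: "finite {j. X j \<omega> \<in> B k}" if "k < m" for k
      using lf B[OF that] by auto
    have "iprod (\<lambda>j. 1 - g (X j \<omega>)) = ennreal (\<Prod>j\<in>?J. 1 - g (X j \<omega>))"
    proof (rule iprod_finite_support)
      show "finite ?J" using Jfin by auto
      show "1 - g (X j \<omega>) = 1" if "j \<notin> ?J" for j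
        using that UB by auto
    qed (auto simp: g01)
    also have "(\<Prod>j\<in>?J. 1 - g (X j \<omega>)) = (\<Prod>k<m. \<Prod>j\<in>{j. X j \<omega> \<in> B k}. 1 - g (X j \<omega>))"
      using Jfin disj by (intro prod.UNION_disjoint) (auto simp: disjoint_family_on_def)
    also have "\<dots> = (\<Prod>k<m. (1 - h k) ^ count (B k) \<omega>)"
    proof (rule prod.cong[OF refl])
      fix k
      have "(\<Prod>j\<in>{j. X j \<omega> \<in> B k}. 1 - g (X j \<omega>)) = (\<Prod>j\<in>{j. X j \<omega> \<in> B k}. 1 - h k)"
        by (rule prod.cong) (auto simp: B_def)
      then show "(\<Prod>j\<in>{j. X j \<omega> \<in> B k}. 1 - g (X j \<omega>)) = (1 - h k) ^ count (B k) \<omega>"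
        by (simp add: count_def)
    qed
    finally show "iprod (\<lambda>j. 1 - g (X j \<omega>)) = ennreal (\<Prod>k<m. (1 - h k) ^ count (B k) \<omega>)" .
  qed
  also have "\<dots> = ennreal (exp (- (lam * (\<Sum>k<m. measure lborel (B k) * (1 - (1 - h k))))))"
    using h01 by (intro nn_integral_prod_count B disj) auto
  also have "(\<Sum>k<m. measure lborel (B k) * (1 - (1 - h k))) = (\<integral>x. (\<Sum>k<m. h k * indicator (B k) x) \<partial>lborel)"
  proof (subst Bochner_Integration.integral_sum)
    fix k assume "k \<in> {..<m}"
    then show "integrable lborel (\<lambda>x. h k * indicator (B k) x :: real)"
      using B[of k] emeasure_bounded_finite[of "B k"] by (intro integrable_mult_right integrable_real_indicator) auto
  qed (simp add: mult.commute)
  also have "(\<lambda>x. (\<Sum>k<m. h k * indicator (B k) x)) = g"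
  proof
    fix x
    have eq: "h k * indicator (B k) x = (if h k = g x then h k else 0)" for k
      by (auto simp: B_def)
    have "(\<Sum>k<m. h k * indicator (B k) x) = (\<Sum>a\<in>range g - {0}. if a = g x then a else 0)"
      unfolding eq by (rule sum.reindex_bij_betw[OF hm, of "\<lambda>a. if a = g x then a else 0"])
    also have "\<dots> = g x"
      using fin by (subst sum.delta) auto
    finally show "(\<Sum>k<m. h k * indicator (B k) x) = g x" .
  qed
  finally show ?thesis .
qed

text \<open>Simple functions with bounded support increase to \<open>g\<close>, so the products
  decrease. They are bounded by 1 on a probability space, which permits monotone convergence from
  above; for the exponents, \<open>g\<close> itself is the integrable majorant.\<close>

theorem laplace_functional:
  fixes g :: "'a \<Rightarrow> real"
  assumes g: "integrable lborel g" and g01: "\<And>x. 0 \<le> g x" "\<And>x. g x \<le> 1"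
  shows "(\<integral>\<^sup>+\<omega>. iprod (\<lambda>j. 1 - g (X j \<omega>)) \<partial>M) = ennreal (exp (- (lam * (\<integral>x. g x \<partial>lborel))))"
proof -
  have gm [measurable]: "g \<in> borel_measurable borel"
    using borel_measurable_integrable[OF g] by simp
  obtain s where s: "\<And>n. simple_function borel (s n)" "incseq s" "\<And>n x. 0 \<le> s n x"
      "\<And>x. bdd_above (range (\<lambda>n. s n x))" "g = (SUP n. s n)"
    using borel_measurable_implies_simple_function_sequence_real[OF gm g01(1)] by blast
  have s_lim: "(\<lambda>n. s n x) \<longlonglongrightarrow> g x" for x
    using LIMSEQ_incseq_SUP[of "\<lambda>n. s n x"] s(2,4,5) by (auto simp: incseq_def le_fun_def image_image)
  have s_le: "s n x \<le> g x" for n x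
    by (rule incseq_le[OF _ s_lim]) (use s(2) in \<open>auto simp: incseq_def le_fun_def\<close>)
  \<comment> \<open>The ball cut-off supplies the bounded support required in the simple case and
    keeps the sequence increasing in \<open>n\<close>.\<close>
  define f where "f n x = s n x * indicator (cball 0 (real n)) x" for n x
  have f_simple: "simple_function borel (f n)" for n
    unfolding f_def by (intro simple_function_mult s simple_function_indicator) auto
  have f_meas [measurable]: "f n \<in> borel_measurable borel" for n
    by (rule borel_measurable_simple_function[OF f_simple])
  have f01: "0 \<le> f n x" "f n x \<le> g x" "f n x \<le> 1" for n x
    using s(3)[of n x] s_le[of n x] g01[of x] by (auto simp: f_def indicator_def)
  have f_mono: "f n x \<le> f n' x" if "n \<le> n'" for n n' x
    using that s(2) s(3)[of n' x] by (auto simp: f_def indicator_def incseq_def le_fun_def)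
  have f_lim: "(\<lambda>n. f n x) \<longlonglongrightarrow> g x" for x
  proof -
    have "eventually (\<lambda>n. s n x = f n x) sequentially"
      by (rule eventually_sequentiallyI[of "nat \<lceil>norm x\<rceil>"]) (auto simp: f_def indicator_def; linarith)
    then show ?thesis
      using s_lim by (rule Lim_transform_eventually[rotated])
  qed
  have "(\<integral>\<^sup>+\<omega>. iprod (\<lambda>j. 1 - g (X j \<omega>)) \<partial>M) = (\<integral>\<^sup>+\<omega>. (INF n. iprod (\<lambda>j. 1 - f n (X j \<omega>))) \<partial>M)"
    by (intro nn_integral_cong iprod_INF[symmetric])
       (auto simp: f01 decseq_def intro!: f_mono tendsto_intros f_lim)
  also have "\<dots> = (INF n. \<integral>\<^sup>+\<omega>. iprod (\<lambda>j. 1 - f n (X j \<omega>)) \<partial>M)"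
  proof (rule nn_integral_monotone_convergence_INF_decseq)
    show "decseq (\<lambda>n \<omega>. iprod (\<lambda>j. 1 - f n (X j \<omega>)))"
    proof (rule monotoneI)
      fix n n' :: nat assume "n \<le> n'"
      then show "(\<lambda>\<omega>. iprod (\<lambda>j. 1 - f n' (X j \<omega>))) \<le> (\<lambda>\<omega>. iprod (\<lambda>j. 1 - f n (X j \<omega>)))"
        unfolding le_fun_def iprod_def by (auto intro!: INF_mono' ennreal_leI prod_mono f_mono simp: f01)
    qed
    show "(\<integral>\<^sup>+\<omega>. iprod (\<lambda>j. 1 - f 0 (X j \<omega>)) \<partial>M) < \<infinity>"
      using nn_integral_mono[of M "\<lambda>\<omega>. iprod (\<lambda>j. 1 - f 0 (X j \<omega>))" "\<lambda>_. 1"] iprod_le_1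
      by (auto simp: emeasure_space_1 intro: le_less_trans)
  qed measurable
  also have "\<dots> = (INF n. ennreal (exp (- (lam * (\<integral>x. f n x \<partial>lborel)))))"
  proof (intro INF_cong refl laplace_functional_simple f_simple f01)
    show "bounded {x. f n x \<noteq> 0}" for n
      by (rule bounded_subset[of "cball 0 (real n)"]) (auto simp: f_def indicator_def split: if_splits)
  qed
  also have "\<dots> = ennreal (exp (- (lam * (\<integral>x. g x \<partial>lborel))))"
  proof (rule LIMSEQ_unique)
    have int: "integrable lborel (f n)" for n
      by (rule Bochner_Integration.integrable_bound[OF g]) (auto simp: f01 g01)
    show "(\<lambda>n. ennreal (exp (- (lam * (\<integral>x. f n x \<partial>lborel))))) \<longlonglongrightarrow>
        (INF n. ennreal (exp (- (lam * (\<integral>x. f n x \<partial>lborel)))))"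
      using lam_pos by (intro LIMSEQ_INF) (auto simp: decseq_def intro!: ennreal_leI integral_mono int f_mono)
    have "(\<lambda>n. \<integral>x. f n x \<partial>lborel) \<longlonglongrightarrow> (\<integral>x. g x \<partial>lborel)"
      by (rule integral_dominated_convergence[where w=g]) (auto simp: g f_lim f01)
    then show "(\<lambda>n. ennreal (exp (- (lam * (\<integral>x. f n x \<partial>lborel))))) \<longlonglongrightarrow>
        ennreal (exp (- (lam * (\<integral>x. g x \<partial>lborel))))"
      by (intro tendsto_intros)
  qed
  finally show ?thesis .
qed

text \<open>Both sides are the derivative at \<open>s = 0\<close> of the Laplace functional of \<open>g - s * indicator C\<close>:
  the factor \<open>s ^ n\<close> contributed by \<open>n\<close> points in \<open>C\<close> has derivative \<open>0\<close> at \<open>0\<close> unless \<open>n = 1\<close>.\<close>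

lemma mecke_cell:
  fixes g :: "'a \<Rightarrow> real"
  assumes C: "C \<in> sets borel" "bounded C" and g: "integrable lborel g"
    and g01: "\<And>x. 0 \<le> g x" "\<And>x. g x \<le> 1" and g1: "\<And>x. x \<in> C \<Longrightarrow> g x = 1"
  shows "(\<integral>\<^sup>+\<omega>. (\<Sum>i. indicator C (X i \<omega>) * iprod (\<lambda>j. if j = i then 1 else 1 - g (X j \<omega>))) \<partial>M) =
    ennreal (lam * measure lborel C * exp (- (lam * (\<integral>x. g x \<partial>lborel))))"
proof -
  note [measurable] = C(1)
  have gm [measurable]: "g \<in> borel_measurable borel"
    using borel_measurable_integrable[OF g] by simp
  define s where "s n = 1 / real (Suc n)" for n
  have s: "0 < s n" "s n \<le> 1" "0 \<le> s n" for n by (auto simp: s_def)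
  have s0: "s \<longlonglongrightarrow> 0" unfolding s_def by (rule LIMSEQ_Suc[OF lim_1_over_n])
  \<comment> \<open>On \<open>C\<close>, where \<open>g\<close> is 1, this equals
    \<open>1 - t\<close>, so each point of \<open>C\<close> contributes the factor \<open>t\<close>;
    elsewhere nothing depends on \<open>t\<close>.\<close>
  define h where "h t x = g x - t * indicator C x" for t x
  have h01: "0 \<le> h t x" "h t x \<le> 1" if "0 \<le> t" "t \<le> 1" for t x
    using that g01[of x] g1[of x] by (auto simp: h_def indicator_def)
  have [measurable]: "h t \<in> borel_measurable borel" for t unfolding h_def by measurable
  have Cint: "integrable lborel (indicator C :: 'a \<Rightarrow> real)"
    using emeasure_bounded_finite[OF C(2)] by (intro integrable_real_indicator) auto
  have hint: "integrable lborel (h t)" for t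
    unfolding h_def by (intro Bochner_Integration.integrable_diff g integrable_mult_right Cint)
  define F where "F t \<omega> = iprod (\<lambda>j. 1 - h t (X j \<omega>))" for t \<omega>
  define I where "I = (\<integral>x. g x \<partial>lborel)"
  define c where "c = measure lborel C"
  have [measurable]: "F t \<in> borel_measurable M" for t unfolding F_def by measurable
  have F: "(\<integral>\<^sup>+\<omega>. F t \<omega> \<partial>M) = ennreal (exp (- (lam * (I - t * c))))" if "0 \<le> t" "t \<le> 1" for t
  proof -
    have "(\<integral>x. h t x \<partial>lborel) = I - t * c"
      using g Cint unfolding h_def I_def c_def by simp
    with laplace_functional[OF hint h01[OF that]] show ?thesis
      unfolding F_def by simp
  qed
  \<comment> \<open>Subtraction in \<open>ennreal\<close> is truncated at 0; this inequality makes
    the difference in \<open>G\<close> below a genuine one.\<close>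
  have F_mono: "F 0 \<omega> \<le> F t \<omega>" if "0 \<le> t" "t \<le> 1" for t \<omega>
  proof -
    have "1 - h 0 x \<le> 1 - h t x" for x using that by (auto simp: h_def indicator_def)
    then show ?thesis
      unfolding F_def iprod_def using h01[of 0] by (auto intro!: INF_mono' ennreal_leI prod_mono)
  qed
  define G where "G n \<omega> = ennreal (1 / s n) * (F (s n) \<omega> - F 0 \<omega>)" for n \<omega>
  have [measurable]: "G n \<in> borel_measurable M" for n unfolding G_def by measurable
  define S where "S \<omega> = (\<Sum>i. indicator C (X i \<omega>) * iprod (\<lambda>j. if j = i then 1 else 1 - g (X j \<omega>)))" for \<omega>
  have [measurable]: "S \<in> borel_measurable M" unfolding S_def by measurable
  have path: "(\<forall>n. G n \<omega> \<le> 1) \<and> (\<lambda>n. G n \<omega>) \<longlonglongrightarrow> S \<omega>"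
    if lf: "\<forall>B. bounded B \<longrightarrow> finite {i. X i \<omega> \<in> B}" for \<omega>
  proof -
    define K where "K = {i. X i \<omega> \<in> C}"
    define n where "n = card K"
    define P where "P = iprod (\<lambda>j. if j \<in> K then 1 else 1 - g (X j \<omega>))"
    have K: "finite K" using lf C(2) by (auto simp: K_def)
    have P1: "P \<le> 1" unfolding P_def by (rule iprod_le_1)
    have Ft: "F t \<omega> = ennreal (t ^ n) * P" if t: "0 \<le> t" "t \<le> 1" for t
    proof -
      have "F t \<omega> = ennreal (\<Prod>j\<in>K. 1 - h t (X j \<omega>)) * iprod (\<lambda>j. if j \<in> K then 1 else 1 - h t (X j \<omega>))"
        unfolding F_def using h01[OF t] by (intro iprod_split K) auto
      also have "(\<Prod>j\<in>K. 1 - h t (X j \<omega>)) = (\<Prod>j\<in>K. t)"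
        by (rule prod.cong) (auto simp: K_def h_def g1)
      also have "(\<lambda>j. if j \<in> K then 1 else 1 - h t (X j \<omega>)) = (\<lambda>j. if j \<in> K then 1 else 1 - g (X j \<omega>))"
        by (auto simp: fun_eq_iff K_def h_def)
      finally show ?thesis by (simp add: n_def P_def)
    qed
    \<comment> \<open>Once \<open>i\<close> is left out, each of the other \<open>n - 1\<close>
      points of \<open>C\<close> gives a factor 0. The value is thus \<open>P\<close> for
      \<open>n = 1\<close> and 0 for larger \<open>n\<close>.\<close>
    have excl: "iprod (\<lambda>j. if j = i then 1 else 1 - g (X j \<omega>)) = ennreal (0 ^ (n - 1)) * P" if i: "i \<in> K" for i
    proof -
      have "iprod (\<lambda>j. if j = i then 1 else 1 - g (X j \<omega>)) =
        ennreal (\<Prod>j\<in>K. if j = i then 1 else 1 - g (X j \<omega>)) *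
        iprod (\<lambda>j. if j \<in> K then 1 else if j = i then 1 else 1 - g (X j \<omega>))"
        using g01 by (intro iprod_split K) auto
      also have "(\<lambda>j. if j \<in> K then 1 else if j = i then 1 else 1 - g (X j \<omega>)) = (\<lambda>j. if j \<in> K then 1 else 1 - g (X j \<omega>))"
        using i by (auto simp: fun_eq_iff)
      also have "(\<Prod>j\<in>K. if j = i then 1 else 1 - g (X j \<omega>)) = (\<Prod>j\<in>K - {i}. if j = i then 1 else 1 - g (X j \<omega>))"
        using K i by (subst prod.remove[of K i]) auto
      also have "\<dots> = (\<Prod>j\<in>K - {i}. 0)"
        by (rule prod.cong) (auto simp: K_def g1)
      also have "\<dots> = 0 ^ (n - 1)"
        unfolding prod_constant n_def using K i by simp
      finally show ?thesis by (simp add: P_def)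
    qed
    have S_eq: "S \<omega> = of_nat n * (ennreal (0 ^ (n - 1)) * P)"
    proof -
      have "S \<omega> = (\<Sum>i\<in>K. indicator C (X i \<omega>) * iprod (\<lambda>j. if j = i then 1 else 1 - g (X j \<omega>)))"
        unfolding S_def using K by (intro suminf_finite) (auto simp: K_def)
      also have "\<dots> = (\<Sum>i\<in>K. ennreal (0 ^ (n - 1)) * P)"
        by (intro sum.cong refl) (auto simp: excl, auto simp: K_def)
      finally show ?thesis by (simp add: n_def)
    qed
    \<comment> \<open>The quotient \<open>(s ^ n - 0 ^ n) / s\<close> is 0 for \<open>n = 0\<close>,
      1 for \<open>n = 1\<close>, and \<open>s ^ (n - 1)\<close> for larger \<open>n\<close>, which
      tends to 0. This matches the number of terms of the sum that survive.\<close>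
    consider "n = 0" | "n = 1" | "n \<ge> 2" by linarith
    then show ?thesis
    proof cases
      case 1
      then have "G m \<omega> = 0" for m using s[of m] le_less_trans[OF P1 ennreal_one_less_top]
        by (simp add: G_def Ft diff_eq_0_ennreal)
      then show ?thesis using 1 S_eq by simp
    next
      case 2
      then have "G m \<omega> = P" for m using s[of m]
        by (simp add: G_def Ft mult.assoc[symmetric] ennreal_mult[symmetric])
      then show ?thesis using 2 S_eq P1 by simp
    next
      case 3
      then obtain p where p: "n = Suc (Suc p)" by (metis add_2_eq_Suc le_Suc_ex)
      have G: "G m \<omega> = ennreal (s m ^ Suc p) * P" for m
        using s[of m] p by (simp add: G_def Ft mult.assoc[symmetric] ennreal_mult[symmetric])
      have "(\<lambda>m. ennreal (s m ^ Suc p) * P) \<longlonglongrightarrow> ennreal (0 ^ Suc p) * P"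
        using P1 by (intro tendsto_mult_ennreal tendsto_intros s0) (auto simp: top_unique)
      moreover have "ennreal (s m ^ Suc p) * P \<le> 1 * 1" for m
        using s[of m] by (intro mult_mono P1) (auto simp del: power_Suc intro!: power_le_one)
      ultimately show ?thesis using p S_eq G by simp
    qed
  qed
  \<comment> \<open>All difference quotients are at most 1, so the limit passes through the
    expectation.\<close>
  have "(\<lambda>n. \<integral>\<^sup>+\<omega>. G n \<omega> \<partial>M) \<longlonglongrightarrow> (\<integral>\<^sup>+\<omega>. S \<omega> \<partial>M)"
  proof (rule nn_integral_dominated_convergence[where w="\<lambda>_. 1"])
    show "AE \<omega> in M. (\<lambda>n. G n \<omega>) \<longlonglongrightarrow> S \<omega>"
      using AE_locally_finite by eventually_elim (use path in blast)
    show "AE \<omega> in M. G n \<omega> \<le> 1" for n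
      using AE_locally_finite by eventually_elim (use path in blast)
  qed (auto simp: emeasure_space_1)
  moreover have "(\<integral>\<^sup>+\<omega>. G n \<omega> \<partial>M) = ennreal ((exp (- (lam * (I - s n * c))) - exp (- (lam * I))) / s n)" for n
  proof -
    have "(\<integral>\<^sup>+\<omega>. G n \<omega> \<partial>M) = ennreal (1 / s n) * (\<integral>\<^sup>+\<omega>. (F (s n) \<omega> - F 0 \<omega>) \<partial>M)"
      unfolding G_def by (rule nn_integral_cmult) measurable
    also have "(\<integral>\<^sup>+\<omega>. (F (s n) \<omega> - F 0 \<omega>) \<partial>M) = (\<integral>\<^sup>+\<omega>. F (s n) \<omega> \<partial>M) - (\<integral>\<^sup>+\<omega>. F 0 \<omega> \<partial>M)"
      using s[of n] by (intro nn_integral_diff) (auto simp: F F_mono)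
    also have "\<dots> = ennreal (exp (- (lam * (I - s n * c))) - exp (- (lam * I)))"
      using s[of n] by (simp add: F ennreal_minus)
    finally show ?thesis
      using s[of n] by (simp add: ennreal_mult'[symmetric])
  qed
  moreover have "(\<lambda>n. ennreal ((exp (- (lam * (I - s n * c))) - exp (- (lam * I))) / s n)) \<longlonglongrightarrow>
      ennreal (lam * c * exp (- (lam * I)))"
  proof (rule tendsto_ennrealI)
    have "((\<lambda>t. exp (- (lam * (I - t * c)))) has_field_derivative (lam * c * exp (- (lam * I)))) (at 0)"
      by (auto intro!: derivative_eq_intros)
    then have "((\<lambda>t. (exp (- (lam * (I - t * c))) - exp (- (lam * I))) / t) \<longlongrightarrow> lam * c * exp (- (lam * I))) (at 0)"
      by (simp add: has_field_derivative_iff)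
    then show "(\<lambda>n. (exp (- (lam * (I - s n * c))) - exp (- (lam * I))) / s n) \<longlonglongrightarrow> lam * c * exp (- (lam * I))"
    proof (rule filterlim_compose)
      show "filterlim s (at 0) sequentially"
        using s(1) s0 by (auto simp: filterlim_at less_imp_neq[THEN not_sym])
    qed
  qed
  ultimately show ?thesis
    unfolding S_def I_def c_def by (simp add: LIMSEQ_unique)
qed

end

section \<open>Sums over the points in which only the closest one contributes\<close>

lemma suminf_eq_single:
  fixes f :: "nat \<Rightarrow> ennreal"
  assumes "\<And>i. i \<noteq> k \<Longrightarrow> f i = 0"
  shows "(\<Sum>i. f i) = f k"
  using suminf_finite[of "{k}" f] assms by auto

lemma integrable_indicator_cball [simp]:
  "integrable lborel (indicator (cball a r) :: 'a::euclidean_space \<Rightarrow> real)"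
  using emeasure_bounded_finite[OF bounded_cball, of a r] by (intro integrable_real_indicator) auto

text \<open>The points at least as close to the origin as \<open>x\<close> get weight \<open>1\<close>, so that only the
  term of a strictly closest point survives in the sum below.\<close>

definition nearest_weight :: "('a::real_normed_vector \<Rightarrow> 'a \<Rightarrow> real) \<Rightarrow> 'a \<Rightarrow> 'a \<Rightarrow> real" where
  "nearest_weight w x z = (if norm z \<le> norm x then 1 else w x z)"

lemma measurable_nearest_weight [measurable]:
  fixes w :: "'a::euclidean_space \<Rightarrow> 'a \<Rightarrow> real"
  assumes [measurable]: "(\<lambda>(x, z). w x z) \<in> borel_measurable (borel \<Otimes>\<^sub>M borel)"
    "f \<in> borel_measurable N" "h \<in> borel_measurable N"
  shows "(\<lambda>x. nearest_weight w (f x) (h x)) \<in> borel_measurable N"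
proof -
  have "(\<lambda>x. (\<lambda>(x, z). w x z) (f x, h x)) \<in> borel_measurable N" by measurable
  then have [measurable]: "(\<lambda>x. w (f x) (h x)) \<in> borel_measurable N" by simp
  show ?thesis unfolding nearest_weight_def by measurable
qed

context poisson_process begin

text \<open>Within one cell the weight is fixed, so \<open>mecke_cell\<close> applies; summing cell
  volume times a constant over the cells gives the integral over space. Weight 1 on the cell itself
  means that a point sharing its cell with another point contributes 0. The identity is exact for
  every partition, not only in the limit of small cells.\<close>

lemma mecke_partition:
  fixes \<kappa> :: "'a \<Rightarrow> nat" and g :: "nat \<Rightarrow> 'a \<Rightarrow> real"
  assumes \<kappa> [measurable]: "\<kappa> \<in> borel \<rightarrow>\<^sub>M count_space UNIV" and bd: "\<And>k. bounded {x. \<kappa> x = k}"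
    and g: "\<And>k. integrable lborel (g k)" and g01: "\<And>k x. 0 \<le> g k x" "\<And>k x. g k x \<le> 1"
    and g1: "\<And>x. g (\<kappa> x) x = 1"
  shows "(\<integral>\<^sup>+\<omega>. (\<Sum>i. iprod (\<lambda>j. if j = i then 1 else 1 - g (\<kappa> (X i \<omega>)) (X j \<omega>))) \<partial>M) =
    ennreal lam * (\<integral>\<^sup>+x. ennreal (exp (- (lam * (\<integral>z. g (\<kappa> x) z \<partial>lborel)))) \<partial>lborel)"
proof -
  have [measurable]: "g k \<in> borel_measurable borel" for k
    using borel_measurable_integrable[OF g[of k]] by simp
  define C where "C k = {x. \<kappa> x = k}" for k
  have C [measurable]: "C k \<in> sets borel" for k unfolding C_def by measurable
  define e where "e k i \<omega> = iprod (\<lambda>j. if j = i then 1 else 1 - g k (X j \<omega>))" for k i \<omega>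
  have [measurable]: "e k i \<in> borel_measurable M" for k i unfolding e_def by measurable
  have "(\<Sum>i. iprod (\<lambda>j. if j = i then 1 else 1 - g (\<kappa> (X i \<omega>)) (X j \<omega>))) =
      (\<Sum>k. \<Sum>i. indicator (C k) (X i \<omega>) * e k i \<omega>)" for \<omega>
  proof -
    have "iprod (\<lambda>j. if j = i then 1 else 1 - g (\<kappa> (X i \<omega>)) (X j \<omega>)) =
        (\<Sum>k. indicator (C k) (X i \<omega>) * e k i \<omega>)" for i
      by (subst suminf_eq_single[where k="\<kappa> (X i \<omega>)"]) (auto simp: C_def e_def)
    \<comment> \<open>One sum is read as an integral over the counting measure, so that the two sums
      can be exchanged.\<close>
    then have "(\<Sum>i. iprod (\<lambda>j. if j = i then 1 else 1 - g (\<kappa> (X i \<omega>)) (X j \<omega>))) =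
        (\<integral>\<^sup>+i. (\<Sum>k. indicator (C k) (X i \<omega>) * e k i \<omega>) \<partial>count_space UNIV)"
      by (simp add: nn_integral_count_space_nat)
    also have "\<dots> = (\<Sum>k. \<Sum>i. indicator (C k) (X i \<omega>) * e k i \<omega>)"
      by (subst nn_integral_suminf) (simp_all add: nn_integral_count_space_nat)
    finally show ?thesis .
  qed
  then have "(\<integral>\<^sup>+\<omega>. (\<Sum>i. iprod (\<lambda>j. if j = i then 1 else 1 - g (\<kappa> (X i \<omega>)) (X j \<omega>))) \<partial>M) =
      (\<integral>\<^sup>+\<omega>. (\<Sum>k. \<Sum>i. indicator (C k) (X i \<omega>) * e k i \<omega>) \<partial>M)"
    by simp
  also have "\<dots> = (\<Sum>k. \<integral>\<^sup>+\<omega>. (\<Sum>i. indicator (C k) (X i \<omega>) * e k i \<omega>) \<partial>M)"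
    by (rule nn_integral_suminf) measurable
  also have "\<dots> = (\<Sum>k. ennreal (lam * measure lborel (C k) * exp (- (lam * (\<integral>z. g k z \<partial>lborel)))))"
    unfolding e_def using g1
    by (intro suminf_cong mecke_cell C g g01) (auto simp: C_def bd)
  also have "\<dots> = (\<Sum>k. ennreal lam * (\<integral>\<^sup>+x. indicator (C k) x * ennreal (exp (- (lam * (\<integral>z. g k z \<partial>lborel)))) \<partial>lborel))"
  proof (rule suminf_cong)
    fix k
    have "emeasure lborel (C k) = ennreal (measure lborel (C k))"
      using emeasure_bounded_finite[of "C k"] bd[of k] by (intro emeasure_eq_ennreal_measure) (auto simp: C_def)
    then show "ennreal (lam * measure lborel (C k) * exp (- (lam * (\<integral>z. g k z \<partial>lborel)))) =
      ennreal lam * (\<integral>\<^sup>+x. indicator (C k) x * ennreal (exp (- (lam * (\<integral>z. g k z \<partial>lborel)))) \<partial>lborel)"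
      using lam_pos by (subst nn_integral_multc) (auto simp: ennreal_mult mult.assoc)
  qed
  also have "\<dots> = ennreal lam * (\<integral>\<^sup>+x. (\<Sum>k. indicator (C k) x * ennreal (exp (- (lam * (\<integral>z. g k z \<partial>lborel))))) \<partial>lborel)"
    by (subst nn_integral_suminf) auto
  also have "(\<lambda>x. (\<Sum>k. indicator (C k) x * ennreal (exp (- (lam * (\<integral>z. g k z \<partial>lborel)))))) =
      (\<lambda>x. ennreal (exp (- (lam * (\<integral>z. g (\<kappa> x) z \<partial>lborel)))))"
  proof
    fix x
    show "(\<Sum>k. indicator (C k) x * ennreal (exp (- (lam * (\<integral>z. g k z \<partial>lborel))))) =
        ennreal (exp (- (lam * (\<integral>z. g (\<kappa> x) z \<partial>lborel))))"
      by (subst suminf_eq_single[where k="\<kappa> x"]) (auto simp: C_def)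
  qed
  finally show ?thesis .
qed

definition nearest_sum :: "('a \<Rightarrow> 'a \<Rightarrow> real) \<Rightarrow> 'w \<Rightarrow> ennreal" where
  "nearest_sum w \<omega> = (\<Sum>i. iprod (\<lambda>j. if j = i then 1 else 1 - nearest_weight w (X i \<omega>) (X j \<omega>)))"

text \<open>Only finitely many points lie in the closed ball that reaches to \<open>X 0\<close>, and
  one of least norm among them is nearest overall.\<close>

lemma ex_nearest:
  assumes "\<forall>B. bounded B \<longrightarrow> finite {i. X i \<omega> \<in> B}"
  shows "\<exists>i. \<forall>j. norm (X i \<omega>) \<le> norm (X j \<omega>)"
proof -
  let ?A = "{i. X i \<omega> \<in> cball 0 (norm (X 0 \<omega>))}"
  have A: "finite ?A" "?A \<noteq> {}"
    using assms[rule_format, OF bounded_cball, of 0 "norm (X 0 \<omega>)"] by auto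
  obtain i where i: "i \<in> ?A" "\<And>j. j \<in> ?A \<Longrightarrow> norm (X i \<omega>) \<le> norm (X j \<omega>)"
    using ex_min_if_finite[of "(\<lambda>i. norm (X i \<omega>)) ` ?A"] A by (force simp: not_less)
  have "norm (X i \<omega>) \<le> norm (X j \<omega>)" for j
  proof (cases "j \<in> ?A")
    case False
    then have "norm (X 0 \<omega>) \<le> norm (X j \<omega>)" by simp
    with i(1) show ?thesis by simp
  qed (rule i(2))
  then show ?thesis by auto
qed

lemma measurable_nearest_sum [measurable]:
  assumes [measurable]: "(\<lambda>(x, z). w x z) \<in> borel_measurable (borel \<Otimes>\<^sub>M borel)"
  shows "nearest_sum w \<in> borel_measurable M"
  unfolding nearest_sum_def[abs_def] by measurable

lemma measurable_integral_nearest_weight [measurable]: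
  fixes w :: "'a \<Rightarrow> 'a \<Rightarrow> real"
  assumes [measurable]: "(\<lambda>(x, z). w x z) \<in> borel_measurable (borel \<Otimes>\<^sub>M borel)"
  shows "(\<lambda>x. \<integral>z. nearest_weight w x z \<partial>lborel) \<in> borel_measurable borel"
proof -
  have "(\<lambda>(x, z). nearest_weight w x z) \<in> borel_measurable (borel \<Otimes>\<^sub>M lborel)"
    unfolding split_def by measurable
  then show ?thesis by (rule lborel.borel_measurable_lebesgue_integral)
qed

text \<open>The factor at \<open>j = k\<close> annihilates every other term. Any minimiser
  \<open>k\<close> will do: under a tie the remaining term vanishes as well, and both sides are
  0.\<close>

lemma nearest_sum_eq:
  assumes w: "\<And>x z. 0 \<le> w x z" "\<And>x z. w x z \<le> 1"
    and k: "\<forall>j. norm (X k \<omega>) \<le> norm (X j \<omega>)"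
  shows "nearest_sum w \<omega> = iprod (\<lambda>j. if j = k then 1 else 1 - nearest_weight w (X k \<omega>) (X j \<omega>))"
  unfolding nearest_sum_def
proof (rule suminf_eq_single)
  fix i assume "i \<noteq> k"
  with w k show "iprod (\<lambda>j. if j = i then 1 else 1 - nearest_weight w (X i \<omega>) (X j \<omega>)) = 0"
    by (intro iprod_eq_0[where k=k]) (auto simp: nearest_weight_def)
qed

text \<open>The disc of weight 1 alone bounds the exponent from below. This provides a majorant,
  free of the weight \<open>w\<close>, for dominated convergence over the position
  \<open>x\<close>.\<close>

lemma integral_nearest_weight_ge:
  fixes w :: "'a \<Rightarrow> 'a \<Rightarrow> real"
  assumes w: "integrable lborel (nearest_weight w x)" "\<And>z. 0 \<le> w x z"
  shows "measure lborel (cball (0::'a) (norm x)) \<le> (\<integral>z. nearest_weight w x z \<partial>lborel)"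
proof -
  have "(\<integral>z. indicator (cball (0::'a) (norm x)) z \<partial>lborel) \<le> (\<integral>z. nearest_weight w x z \<partial>lborel)"
    by (intro integral_mono integrable_indicator_cball w(1))
      (use w(2) in \<open>auto simp: nearest_weight_def indicator_def\<close>)
  then show ?thesis by simp
qed

text \<open>Discretising the position of the candidate point reduces this to \<open>mecke_partition\<close>. Rounding norms
  up keeps each cell inside the region of weight \<open>1\<close>, as required there, and the bounded support
  leaves finitely many factors, so that the limit may be taken factor by factor.\<close>

lemma nearest_sum_bounded_support:
  assumes wm [measurable]: "(\<lambda>(x, z). w x z) \<in> borel_measurable (borel \<Otimes>\<^sub>M borel)"
    and w: "\<And>x z. 0 \<le> w x z" "\<And>x z. w x z \<le> 1" and supp: "\<And>x z. R < norm z \<Longrightarrow> w x z = 0"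
    and cont: "\<And>x z. norm x < norm z \<Longrightarrow> isCont (\<lambda>x. w x z) x"
    and fin: "(\<integral>\<^sup>+x. ennreal (exp (- (lam * measure lborel (cball (0::'a) (norm (x::'a)))))) \<partial>lborel) < \<infinity>"
  shows "(\<integral>\<^sup>+\<omega>. nearest_sum w \<omega> \<partial>M) =
    ennreal lam * (\<integral>\<^sup>+x. ennreal (exp (- (lam * (\<integral>z. nearest_weight w x z \<partial>lborel)))) \<partial>lborel)"
proof -
  have w_pair: "(\<lambda>y. w (f y) (h y)) \<in> borel_measurable N" if "f \<in> borel_measurable N" "h \<in> borel_measurable N"
    for f h and N :: "'x measure"
    using measurable_compose[OF measurable_Pair[OF that] wm] by simp
  obtain s :: "nat \<Rightarrow> 'a \<Rightarrow> 'a" where s: "\<And>n. simple_function borel (s n)" "\<And>x. (\<lambda>n. s n x) \<longlonglongrightarrow> x"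
    using borel_measurable_implies_sequence_metric[of "\<lambda>x::'a. x" borel 0] by auto
  \<comment> \<open>Norms rounded up to the mesh \<open>1 / Suc n\<close>, recorded as natural
    numbers. The label of a cell consists of this number and the approximate position
    \<open>s n x\<close>.\<close>
  define \<rho> where "\<rho> n x = nat \<lceil>real (Suc n) * norm x\<rceil>" for n and x :: 'a
  have \<rho>_mono: "\<rho> n x \<le> \<rho> n y" if "norm x \<le> norm y" for n x y
    using that unfolding \<rho>_def by (intro nat_mono ceiling_mono mult_left_mono) auto
  have \<rho>_less: "\<rho> n x < \<rho> n y" if "1 \<le> real (Suc n) * (norm y - norm x)" for n x y
  proof -
    have "\<lceil>real (Suc n) * norm x\<rceil> + 1 = \<lceil>real (Suc n) * norm x + 1\<rceil>" by simp
    also have "\<dots> \<le> \<lceil>real (Suc n) * norm y\<rceil>"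
      using that by (intro ceiling_mono) (simp add: algebra_simps)
    finally have "\<lceil>real (Suc n) * norm x\<rceil> < \<lceil>real (Suc n) * norm y\<rceil>" by linarith
    moreover have "0 \<le> \<lceil>real (Suc n) * norm x\<rceil>" by (simp add: ceiling_le_iff le_ceiling_iff less_le_trans[of _ 0])
    ultimately show ?thesis unfolding \<rho>_def by linarith
  qed
  have \<rho>_bound: "norm x \<le> real (\<rho> n x)" for n x
  proof -
    have "norm x \<le> real (Suc n) * norm x" by (simp add: mult_le_cancel_right1)
    also have "\<dots> \<le> real (\<rho> n x)" unfolding \<rho>_def by linarith
    finally show ?thesis .
  qed
  have \<rho>_meas [measurable]: "\<rho> n \<in> borel \<rightarrow>\<^sub>M count_space UNIV" for n
    unfolding \<rho>_def by measurable
  have s_meas [measurable]: "s n \<in> borel_measurable borel" for n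
    by (rule borel_measurable_simple_function[OF s(1)])
  \<comment> \<open>The range of \<open>s n\<close> is finite but that of \<open>\<rho> n\<close> is
    not, so there are countably many labels; numbering them gives the cell index
    \<open>\<kappa> n\<close>.\<close>
  define D where "D n = range (\<lambda>x. (\<rho> n x, s n x))" for n
  have D: "countable (D n)" for n
  proof (rule countable_subset)
    show "D n \<subseteq> UNIV \<times> range (s n)" by (auto simp: D_def)
    show "countable (UNIV \<times> range (s n) :: (nat \<times> 'a) set)"
      using simple_functionD(1)[OF s(1)[of n]] by (intro countable_SIGMA) (auto intro: countable_finite)
  qed
  define \<kappa> where "\<kappa> n x = to_nat_on (D n) (\<rho> n x, s n x)" for n x
  have \<kappa>: "from_nat_into (D n) (\<kappa> n x) = (\<rho> n x, s n x)" for n x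
    unfolding \<kappa>_def using D by (intro from_nat_into_to_nat_on) (auto simp: D_def)
  have \<kappa>_meas [measurable]: "\<kappa> n \<in> borel \<rightarrow>\<^sub>M count_space UNIV" for n
  proof -
    have "\<kappa> n -` {k} \<inter> space borel \<in> sets borel" for k
    proof (cases "\<exists>y. \<kappa> n y = k")
      case True
      then obtain y where y: "\<kappa> n y = k" by auto
      obtain m v where mv: "from_nat_into (D n) k = (m, v)" by fastforce
      have "\<kappa> n x = k \<longleftrightarrow> \<rho> n x = m \<and> s n x = v" for x
      proof
        assume "\<kappa> n x = k"
        then show "\<rho> n x = m \<and> s n x = v" using \<kappa>[of n x] mv by simp
      next
        assume "\<rho> n x = m \<and> s n x = v"
        moreover have "\<rho> n y = m \<and> s n y = v" using \<kappa>[of n y] mv y by simp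
        ultimately have "\<kappa> n x = \<kappa> n y" unfolding \<kappa>_def by simp
        then show "\<kappa> n x = k" using y by simp
      qed
      then have "\<kappa> n -` {k} \<inter> space borel = {x\<in>space borel. \<rho> n x = m \<and> s n x = v}"
        by auto
      also have "\<dots> \<in> sets borel" by measurable
      finally show ?thesis .
    next
      case False
      then have "\<kappa> n -` {k} \<inter> space borel = {}" by auto
      then show ?thesis by (simp only: sets.empty_sets)
    qed
    then show ?thesis
      by (subst measurable_count_space_eq2_countable) auto
  qed
  \<comment> \<open>The weight is rebuilt from the label alone: the candidate point enters through
    its rounded norm \<open>m\<close> and its approximate position \<open>v\<close>, so it is the
    same for all points of a cell.\<close>
  define g where "g n k z = (case from_nat_into (D n) k of (m, v) \<Rightarrow> if \<rho> n z \<le> m then 1 else w v z)" for n k z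
  have g_\<kappa>: "g n (\<kappa> n x) z = (if \<rho> n z \<le> \<rho> n x then 1 else w (s n x) z)" for n x z
    by (simp add: g_def \<kappa>)
  have g01: "0 \<le> g n k z" "g n k z \<le> 1" for n k z
    using w by (auto simp: g_def split: prod.split)
  have g_meas [measurable]: "g n k \<in> borel_measurable borel" for n k
  proof -
    obtain m v where "from_nat_into (D n) k = (m, v)" by fastforce
    then have "g n k = (\<lambda>z. if \<rho> n z \<le> m then 1 else w v z)"
      by (simp add: g_def fun_eq_iff)
    also have "\<dots> \<in> borel_measurable borel"
      by (intro measurable_If w_pair) measurable
    finally show ?thesis .
  qed
  have g_supp: "g n k z \<le> indicator (cball 0 (max R (real (fst (from_nat_into (D n) k))))) z" for n k z
    using w \<rho>_bound[of z n] supp[of z] by (auto simp: g_def indicator_def split: prod.split)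
  have g_int: "integrable lborel (g n k)" for n k
    by (rule Bochner_Integration.integrable_bound
        [of lborel "indicator (cball 0 (max R (real (fst (from_nat_into (D n) k))))) :: 'a \<Rightarrow> real"])
      (auto simp del: real_norm_def simp add: real_norm_def[abs_def] g01 g_supp abs_of_nonneg)
  have part: "(\<integral>\<^sup>+\<omega>. (\<Sum>i. iprod (\<lambda>j. if j = i then 1 else 1 - g n (\<kappa> n (X i \<omega>)) (X j \<omega>))) \<partial>M) =
      ennreal lam * (\<integral>\<^sup>+x. ennreal (exp (- (lam * (\<integral>z. g n (\<kappa> n x) z \<partial>lborel)))) \<partial>lborel)" for n
  proof (rule mecke_partition)
    \<comment> \<open>The label fixes the rounded norm, which bounds the norm of every point in the
      cell.\<close>
    show "bounded {x. \<kappa> n x = k}" for k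
    proof (rule bounded_subset[OF bounded_cball], rule subsetI)
      fix x assume "x \<in> {x. \<kappa> n x = k}"
      then have "from_nat_into (D n) k = (\<rho> n x, s n x)"
        using \<kappa>[of n x] by simp
      then show "x \<in> cball 0 (real (fst (from_nat_into (D n) k)))"
        using \<rho>_bound[of x n] by simp
    qed
    show "g n (\<kappa> n x) x = 1" for x by (simp add: g_\<kappa>)
  qed (rule \<kappa>_meas g_int g01)+
  \<comment> \<open>Inside the closed ball the value is 1 from the start. Outside, the rounded norms
    differ as soon as the mesh is no larger than the gap, and continuity of \<open>w\<close> in its
    first argument does the rest.\<close>
  have g_lim: "(\<lambda>n. g n (\<kappa> n x) z) \<longlonglongrightarrow> nearest_weight w x z" for x z
  proof (cases "norm z \<le> norm x")
    case True
    then show ?thesis by (simp add: nearest_weight_def g_\<kappa> \<rho>_mono)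
  next
    case False
    have "eventually (\<lambda>n. 1 \<le> real (Suc n) * (norm z - norm x)) sequentially"
    proof (rule eventually_sequentiallyI[of "nat \<lceil>1 / (norm z - norm x)\<rceil>"])
      fix n assume "nat \<lceil>1 / (norm z - norm x)\<rceil> \<le> n"
      then have "1 / (norm z - norm x) \<le> real (Suc n)" by linarith
      with False show "1 \<le> real (Suc n) * (norm z - norm x)" by (simp add: field_simps)
    qed
    then have "eventually (\<lambda>n. w (s n x) z = g n (\<kappa> n x) z) sequentially"
    proof eventually_elim
      case (elim n)
      from \<rho>_less[OF this] show ?case by (simp add: g_\<kappa>)
    qed
    moreover have "(\<lambda>n. w (s n x) z) \<longlonglongrightarrow> w x z"
      using isCont_tendsto_compose[OF cont s(2)] False by (simp add: not_le)
    ultimately show ?thesis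
      using False by (auto simp: nearest_weight_def intro: Lim_transform_eventually)
  qed
  \<comment> \<open>The mesh never exceeds 1, whence the summand 1: for fixed \<open>x\<close> one
    ball contains the supports for all \<open>n\<close>. It yields both the finite index set
    \<open>?J\<close> and the majorant in \<open>z\<close> below.\<close>
  have g_far: "g n (\<kappa> n x) z = 0" if "max R (norm x + 1) < norm z" for n x z
  proof -
    have "1 * 1 \<le> real (Suc n) * (norm z - norm x)"
      using that by (intro mult_mono) auto
    then show ?thesis using \<rho>_less[of n z x] \<rho>_less[of n x z] that supp[of z] by (simp add: g_\<kappa>)
  qed
  have "(\<lambda>n. \<integral>\<^sup>+\<omega>. (\<Sum>i. iprod (\<lambda>j. if j = i then 1 else 1 - g n (\<kappa> n (X i \<omega>)) (X j \<omega>))) \<partial>M)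
      \<longlonglongrightarrow> (\<integral>\<^sup>+\<omega>. nearest_sum w \<omega> \<partial>M)"
  proof (rule nn_integral_dominated_convergence[where w="\<lambda>_. 1"])
    have path: "(\<forall>n. (\<Sum>i. iprod (\<lambda>j. if j = i then 1 else 1 - g n (\<kappa> n (X i \<omega>)) (X j \<omega>))) \<le> 1) \<and>
      (\<lambda>n. \<Sum>i. iprod (\<lambda>j. if j = i then 1 else 1 - g n (\<kappa> n (X i \<omega>)) (X j \<omega>))) \<longlonglongrightarrow> nearest_sum w \<omega>"
      if lf: "\<forall>B. bounded B \<longrightarrow> finite {i. X i \<omega> \<in> B}" for \<omega>
    proof -
      obtain k where k: "\<And>j. norm (X k \<omega>) \<le> norm (X j \<omega>)"
        using ex_nearest[OF lf] by auto
      let ?e = "\<lambda>n. iprod (\<lambda>j. if j = k then 1 else 1 - g n (\<kappa> n (X k \<omega>)) (X j \<omega>))"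
      have eq: "(\<Sum>i. iprod (\<lambda>j. if j = i then 1 else 1 - g n (\<kappa> n (X i \<omega>)) (X j \<omega>))) = ?e n" for n
      proof (rule suminf_eq_single)
        fix i assume "i \<noteq> k"
        then show "iprod (\<lambda>j. if j = i then 1 else 1 - g n (\<kappa> n (X i \<omega>)) (X j \<omega>)) = 0"
          using g01 w by (intro iprod_eq_0[where k=k]) (auto simp: g_\<kappa> \<rho>_mono k)
      qed
      let ?J = "{j. X j \<omega> \<in> cball 0 (max R (norm (X k \<omega>) + 1))}"
      have J: "finite ?J" by (rule lf[rule_format, OF bounded_cball])
      have e: "?e n = ennreal (\<Prod>j\<in>?J. if j = k then 1 else 1 - g n (\<kappa> n (X k \<omega>)) (X j \<omega>))" for n
        using J by (intro iprod_finite_support) (auto simp: g01 g_far not_le)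
      have e': "iprod (\<lambda>j. if j = k then 1 else 1 - nearest_weight w (X k \<omega>) (X j \<omega>)) =
          ennreal (\<Prod>j\<in>?J. if j = k then 1 else 1 - nearest_weight w (X k \<omega>) (X j \<omega>))"
        using J w by (intro iprod_finite_support) (auto simp: nearest_weight_def not_le supp)
      have "?e \<longlonglongrightarrow> iprod (\<lambda>j. if j = k then 1 else 1 - nearest_weight w (X k \<omega>) (X j \<omega>))"
        unfolding e e' by (intro tendsto_ennrealI tendsto_prod) (auto intro!: tendsto_intros g_lim)
      then show ?thesis
        using k w by (simp add: eq iprod_le_1 nearest_sum_eq[where k=k])
    qed
    show "AE \<omega> in M. (\<Sum>i. iprod (\<lambda>j. if j = i then 1 else 1 - g n (\<kappa> n (X i \<omega>)) (X j \<omega>))) \<le> 1" for n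
      using AE_locally_finite by eventually_elim (use path in blast)
    show "AE \<omega> in M. (\<lambda>n. \<Sum>i. iprod (\<lambda>j. if j = i then 1 else 1 - g n (\<kappa> n (X i \<omega>)) (X j \<omega>))) \<longlonglongrightarrow> nearest_sum w \<omega>"
      using AE_locally_finite by eventually_elim (use path in blast)
    show "(\<lambda>\<omega>. \<Sum>i. iprod (\<lambda>j. if j = i then 1 else 1 - g n (\<kappa> n (X i \<omega>)) (X j \<omega>))) \<in> borel_measurable M" for n
    proof -
      have [measurable]: "(\<lambda>\<omega>. g n (\<kappa> n (X i \<omega>)) (X j \<omega>)) \<in> borel_measurable M" for i j
      proof -
        have [measurable]: "(\<lambda>\<omega>. w (s n (X i \<omega>)) (X j \<omega>)) \<in> borel_measurable M"
          by (rule w_pair) measurable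
        have [measurable]: "(\<lambda>\<omega>. real (\<rho> n (X i \<omega>))) \<in> borel_measurable M" for i
          by measurable
        have "(\<lambda>\<omega>. if real (\<rho> n (X j \<omega>)) \<le> real (\<rho> n (X i \<omega>)) then 1 else w (s n (X i \<omega>)) (X j \<omega>)) \<in> borel_measurable M"
          by (intro measurable_If borel_measurable_const) measurable
        then show ?thesis by (simp add: g_\<kappa>)
      qed
      show ?thesis by measurable
    qed
  qed (auto simp: emeasure_space_1)
  moreover have "(\<lambda>n. ennreal lam * (\<integral>\<^sup>+x. ennreal (exp (- (lam * (\<integral>z. g n (\<kappa> n x) z \<partial>lborel)))) \<partial>lborel))
      \<longlonglongrightarrow> ennreal lam * (\<integral>\<^sup>+x. ennreal (exp (- (lam * (\<integral>z. nearest_weight w x z \<partial>lborel)))) \<partial>lborel)"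
  proof (rule ennreal_tendsto_cmult)
    show "(\<lambda>n. \<integral>\<^sup>+x. ennreal (exp (- (lam * (\<integral>z. g n (\<kappa> n x) z \<partial>lborel)))) \<partial>lborel)
      \<longlonglongrightarrow> (\<integral>\<^sup>+x. ennreal (exp (- (lam * (\<integral>z. nearest_weight w x z \<partial>lborel)))) \<partial>lborel)"
    proof (rule nn_integral_dominated_convergence[where
          w="\<lambda>x. ennreal (exp (- (lam * measure lborel (cball (0::'a) (norm x)))))"])
      show "(\<lambda>x. ennreal (exp (- (lam * measure lborel (cball (0::'a) (norm x)))))) \<in> borel_measurable lborel"
        by (simp add: content_cball)
      show "AE x in lborel. ennreal (exp (- (lam * (\<integral>z. g n (\<kappa> n x) z \<partial>lborel)))) \<le>
          ennreal (exp (- (lam * measure lborel (cball (0::'a) (norm x)))))" for n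
      proof (intro AE_I2 ennreal_leI)
        fix x
        \<comment> \<open>Rounding is monotone in the norm, so the discretised weight is still 1 on
          the whole closed ball of radius \<open>norm x\<close>.\<close>
        have "(\<integral>z. indicator (cball (0::'a) (norm x)) z \<partial>lborel) \<le> (\<integral>z. g n (\<kappa> n x) z \<partial>lborel)"
          by (intro integral_mono g_int integrable_indicator_cball) (auto simp: g_\<kappa> indicator_def \<rho>_mono w)
        then show "exp (- (lam * (\<integral>z. g n (\<kappa> n x) z \<partial>lborel))) \<le> exp (- (lam * measure lborel (cball (0::'a) (norm x))))"
          using lam_pos by simp
      qed
      show "AE x in lborel. (\<lambda>n. ennreal (exp (- (lam * (\<integral>z. g n (\<kappa> n x) z \<partial>lborel))))) \<longlonglongrightarrow>
          ennreal (exp (- (lam * (\<integral>z. nearest_weight w x z \<partial>lborel))))"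
      proof (intro AE_I2 tendsto_intros)
        fix x
        show "(\<lambda>n. \<integral>z. g n (\<kappa> n x) z \<partial>lborel) \<longlonglongrightarrow> (\<integral>z. nearest_weight w x z \<partial>lborel)"
        proof (rule integral_dominated_convergence[where w="indicator (cball 0 (max R (norm x + 1)))"])
          show "AE z in lborel. norm (g n (\<kappa> n x) z) \<le> indicator (cball 0 (max R (norm x + 1))) z" for n
            using g01 g_far[of x _ n] by (auto simp: indicator_def not_le)
          have "nearest_weight w x \<in> borel_measurable borel"
            by (rule measurable_nearest_weight[OF wm]) (rule borel_measurable_const measurable_ident_sets[OF refl])+
          then show "nearest_weight w x \<in> borel_measurable lborel" by simp
        qed (auto simp: g_lim)
      qed
    qed (use fin in auto)
  qed simp
  ultimately show ?thesis
    unfolding part by (rule LIMSEQ_unique)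
qed

text \<open>Cutting \<open>w\<close> off outside growing balls in \<open>z\<close> reduces this to
  bounded support. The cut-off weights increase to \<open>w\<close>, so the infinite products
  decrease and converge, and \<open>fin\<close> again supplies the majorant over
  \<open>x\<close>.\<close>

theorem nn_integral_nearest_sum:
  assumes wm [measurable]: "(\<lambda>(x, z). w x z) \<in> borel_measurable (borel \<Otimes>\<^sub>M borel)"
    and w: "\<And>x z. 0 \<le> w x z" "\<And>x z. w x z \<le> 1" and int: "\<And>x. integrable lborel (w x)"
    and cont: "\<And>x z. norm x < norm z \<Longrightarrow> isCont (\<lambda>x. w x z) x"
    and fin: "(\<integral>\<^sup>+x. ennreal (exp (- (lam * measure lborel (cball (0::'a) (norm (x::'a)))))) \<partial>lborel) < \<infinity>"
  shows "(\<integral>\<^sup>+\<omega>. nearest_sum w \<omega> \<partial>M) =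
    ennreal lam * (\<integral>\<^sup>+x. ennreal (exp (- (lam * (\<integral>z. nearest_weight w x z \<partial>lborel)))) \<partial>lborel)"
proof -
  define v where "v n x z = w x z * indicator (cball 0 (real n)) z" for n x z
  have v_meas [measurable]: "(\<lambda>(x, z). v n x z) \<in> borel_measurable (borel \<Otimes>\<^sub>M borel)" for n
  proof -
    have "(\<lambda>y. w (fst y) (snd y) * indicator (cball 0 (real n)) (snd y)) \<in> borel_measurable (borel \<Otimes>\<^sub>M borel)"
      by (intro borel_measurable_times measurable_compose[OF measurable_snd borel_measurable_indicator])
        (use wm in \<open>auto simp: split_def\<close>)
    then show ?thesis by (simp add: v_def split_def)
  qed
  have v01: "0 \<le> v n x z" "v n x z \<le> 1" "v n x z \<le> w x z" for n x z
    using w[of x z] by (auto simp: v_def indicator_def)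
  have nw_meas: "nearest_weight u x \<in> borel_measurable borel"
    if "(\<lambda>(x, z). u x z) \<in> borel_measurable (borel \<Otimes>\<^sub>M borel)" for u :: "'a \<Rightarrow> 'a \<Rightarrow> real" and x
    by (rule measurable_nearest_weight[OF that]) (rule borel_measurable_const measurable_ident_sets[OF refl])+
  have nw_int: "integrable lborel (nearest_weight w x)" for x
  proof (rule Bochner_Integration.integrable_bound)
    show "integrable lborel (\<lambda>z. w x z + indicator (cball 0 (norm x)) z)"
      by (intro Bochner_Integration.integrable_add int integrable_indicator_cball)
  qed (use w nw_meas[OF wm] in \<open>auto simp: nearest_weight_def indicator_def\<close>)
  have nv_le: "0 \<le> nearest_weight (v n) x z" "nearest_weight (v n) x z \<le> nearest_weight w x z"
      "nearest_weight (v n) x z \<le> 1" for n x z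
    using v01 by (auto simp: nearest_weight_def)
  have nv_int: "integrable lborel (nearest_weight (v n) x)" for n x
    by (rule Bochner_Integration.integrable_bound[OF nw_int])
      (use nv_le nw_meas[OF v_meas] in \<open>auto intro!: AE_I2 abs_ge_self order_trans[OF nv_le(2)]\<close>)
  have v_lim: "(\<lambda>n. nearest_weight (v n) x z) \<longlonglongrightarrow> nearest_weight w x z" for x z
  proof (rule tendsto_eventually, rule eventually_sequentiallyI)
    fix n assume "nat \<lceil>norm z\<rceil> \<le> n"
    then have "norm z \<le> real n" by linarith
    then show "nearest_weight (v n) x z = nearest_weight w x z"
      by (simp add: nearest_weight_def v_def)
  qed
  have v_mono: "nearest_weight (v n) x z \<le> nearest_weight (v m) x z" if "n \<le> m" for n m x z
    using that w by (auto simp: nearest_weight_def v_def indicator_def)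
  have eq: "(\<integral>\<^sup>+\<omega>. nearest_sum (v n) \<omega> \<partial>M) =
    ennreal lam * (\<integral>\<^sup>+x. ennreal (exp (- (lam * (\<integral>z. nearest_weight (v n) x z \<partial>lborel)))) \<partial>lborel)" for n
  proof (rule nearest_sum_bounded_support[OF v_meas v01(1,2) _ _ fin])
    show "v n x z = 0" if "real n < norm z" for x z
      using that by (simp add: v_def)
    show "isCont (\<lambda>x. v n x z) x" if "norm x < norm z" for x z
      unfolding v_def by (intro continuous_intros cont that)
  qed
  have "(\<lambda>n. \<integral>\<^sup>+\<omega>. nearest_sum (v n) \<omega> \<partial>M) \<longlonglongrightarrow> (\<integral>\<^sup>+\<omega>. nearest_sum w \<omega> \<partial>M)"
  proof (rule nn_integral_dominated_convergence[where w="\<lambda>_. 1"])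
    have path: "(\<forall>n. nearest_sum (v n) \<omega> \<le> 1) \<and> (\<lambda>n. nearest_sum (v n) \<omega>) \<longlonglongrightarrow> nearest_sum w \<omega>"
      if lf: "\<forall>B. bounded B \<longrightarrow> finite {i. X i \<omega> \<in> B}" for \<omega>
    proof -
      obtain k where k: "\<forall>j. norm (X k \<omega>) \<le> norm (X j \<omega>)"
        using ex_nearest[OF lf] by auto
      have nw1: "nearest_weight w x z \<le> 1" for x z using w by (auto simp: nearest_weight_def)
      show ?thesis
        unfolding nearest_sum_eq[OF w k] nearest_sum_eq[OF v01(1,2) k]
        using nv_le v_mono v_lim
        by (auto intro!: iprod_le_1 iprod_LIMSEQ_decseq tendsto_intros simp: decseq_def)
    qed
    show "AE \<omega> in M. nearest_sum (v n) \<omega> \<le> 1" for n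
      using AE_locally_finite by eventually_elim (use path in blast)
    show "AE \<omega> in M. (\<lambda>n. nearest_sum (v n) \<omega>) \<longlonglongrightarrow> nearest_sum w \<omega>"
      using AE_locally_finite by eventually_elim (use path in blast)
  qed (auto simp: emeasure_space_1)
  moreover have "(\<lambda>n. ennreal lam * (\<integral>\<^sup>+x. ennreal (exp (- (lam * (\<integral>z. nearest_weight (v n) x z \<partial>lborel)))) \<partial>lborel))
      \<longlonglongrightarrow> ennreal lam * (\<integral>\<^sup>+x. ennreal (exp (- (lam * (\<integral>z. nearest_weight w x z \<partial>lborel)))) \<partial>lborel)"
  proof (rule ennreal_tendsto_cmult)
    show "(\<lambda>n. \<integral>\<^sup>+x. ennreal (exp (- (lam * (\<integral>z. nearest_weight (v n) x z \<partial>lborel)))) \<partial>lborel)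
      \<longlonglongrightarrow> (\<integral>\<^sup>+x. ennreal (exp (- (lam * (\<integral>z. nearest_weight w x z \<partial>lborel)))) \<partial>lborel)"
    proof (rule nn_integral_dominated_convergence[where
          w="\<lambda>x. ennreal (exp (- (lam * measure lborel (cball (0::'a) (norm x)))))"])
      show "(\<lambda>x. ennreal (exp (- (lam * measure lborel (cball (0::'a) (norm x)))))) \<in> borel_measurable lborel"
        by (simp add: content_cball)
      show "AE x in lborel. ennreal (exp (- (lam * (\<integral>z. nearest_weight (v n) x z \<partial>lborel)))) \<le>
          ennreal (exp (- (lam * measure lborel (cball (0::'a) (norm x)))))" for n
        using lam_pos by (intro AE_I2 ennreal_leI) (simp add: integral_nearest_weight_ge nv_int v01)
      show "AE x in lborel. (\<lambda>n. ennreal (exp (- (lam * (\<integral>z. nearest_weight (v n) x z \<partial>lborel))))) \<longlonglongrightarrow>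
          ennreal (exp (- (lam * (\<integral>z. nearest_weight w x z \<partial>lborel))))"
      proof (intro AE_I2 tendsto_intros)
        fix x
        show "(\<lambda>n. \<integral>z. nearest_weight (v n) x z \<partial>lborel) \<longlonglongrightarrow> (\<integral>z. nearest_weight w x z \<partial>lborel)"
          by (rule integral_dominated_convergence[OF _ _ nw_int[of x]])
            (use nw_meas wm v_meas v_lim nv_le in \<open>auto intro: order_trans[OF nv_le(2)]\<close>)
      qed
    qed (use fin in auto)
  qed simp
  ultimately show ?thesis
    unfolding eq by (rule LIMSEQ_unique)
qed

end

subsection \<open>Timers and fading given the positions\<close>

text \<open>Fubini for the joint law. The law of \<open>V\<close> is expressed through a second copy
  of \<open>M\<close>, so that after freezing \<open>U\<close> the inner integral is again an
  expectation on the original space. It separates a timer from the other marks, the marks from the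
  positions, and the two point processes from each other.\<close>

lemma (in prob_space) nn_integral_indep_pair:
  assumes U [measurable]: "U \<in> M \<rightarrow>\<^sub>M N1" and V [measurable]: "V \<in> M \<rightarrow>\<^sub>M N2"
    and eq: "distr M N1 U \<Otimes>\<^sub>M distr M N2 V = distr M (N1 \<Otimes>\<^sub>M N2) (\<lambda>x. (U x, V x))"
    and f [measurable]: "f \<in> borel_measurable (N1 \<Otimes>\<^sub>M N2)"
  shows "(\<integral>\<^sup>+\<omega>. f (U \<omega>, V \<omega>) \<partial>M) = (\<integral>\<^sup>+\<omega>. \<integral>\<^sup>+\<omega>'. f (U \<omega>, V \<omega>') \<partial>M \<partial>M)"
proof -
  interpret V: prob_space "distr M N2 V" by (rule prob_space_distr) measurable
  have "(\<integral>\<^sup>+\<omega>. f (U \<omega>, V \<omega>) \<partial>M) = (\<integral>\<^sup>+z. f z \<partial>(distr M N1 U \<Otimes>\<^sub>M distr M N2 V))"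
    by (simp add: eq nn_integral_distr)
  also have "\<dots> = (\<integral>\<^sup>+u. \<integral>\<^sup>+v. f (u, v) \<partial>distr M N2 V \<partial>distr M N1 U)"
    by (subst V.nn_integral_fst[symmetric]) auto
  also have "\<dots> = (\<integral>\<^sup>+\<omega>. \<integral>\<^sup>+v. f (U \<omega>, v) \<partial>distr M N2 V \<partial>M)"
    by (subst nn_integral_distr) auto
  also have "\<dots> = (\<integral>\<^sup>+\<omega>. \<integral>\<^sup>+\<omega>'. f (U \<omega>, V \<omega>') \<partial>M \<partial>M)"
    by (intro nn_integral_cong nn_integral_distr) (auto intro: measurable_compose[OF _ f] simp: measurable_space[OF U])
  finally show ?thesis .
qed

lemma (in prob_space) prob_uniform_less:
  assumes [measurable]: "T \<in> borel_measurable M" and unif: "distr M borel T = uniform_measure lborel {0..1}"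
    and t: "0 \<le> t" "t \<le> 1"
  shows "prob {\<omega>\<in>space M. T \<omega> < t} = t"
proof -
  have "prob {\<omega>\<in>space M. T \<omega> < t} = measure (distr M borel T) {..<t}"
    by (subst measure_distr) (auto intro!: arg_cong[where f=prob])
  also have "\<dots> = measure lborel ({0..1} \<inter> {..<t}) / measure lborel {0..1::real}"
    unfolding unif by (rule measure_uniform_measure) auto
  also have "{0..1} \<inter> {..<t} = {0..<t}" using t by auto
  finally show ?thesis using t by simp
qed

text \<open>The real-valued sources; the two removed ones carry whole point configurations.\<close>

abbreviation marks :: "source set" where
  "marks \<equiv> - {APs, ENBs}"

text \<open>AP \<open>j\<close> blocks access exactly when its timer lies below \<open>t\<close> and
  its fading is outside \<open>A j\<close>, which has probability \<open>t * h j\<close>. For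
  different \<open>j\<close> these events involve disjoint sets of marks, as do the eNB conditions,
  so the probabilities multiply.\<close>

lemma (in prob_space) mark_probability_given_timer:
  fixes V :: "source \<Rightarrow> 'a \<Rightarrow> real"
  assumes ind: "indep_vars (\<lambda>_. borel) V marks"
    and unif: "\<And>j. distr M borel (V (Timer j)) = uniform_measure lborel {0..1}"
    and AB [measurable]: "\<And>j. A j \<in> sets borel" "\<And>k. B k \<in> sets borel"
    and h: "\<And>j. prob {\<omega>\<in>space M. V (Fading_W j i) \<omega> \<in> A j} = 1 - h j"
    and q: "\<And>k. prob {\<omega>\<in>space M. V (Fading_LW k i) \<omega> \<in> B k} = 1 - q k"
    and t: "0 \<le> t" "t \<le> 1"
  shows "emeasure M {\<omega>\<in>space M. (\<forall>k. V (Fading_LW k i) \<omega> \<in> B k) \<and>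
      (\<forall>j. j \<noteq> i \<longrightarrow> t \<le> V (Timer j) \<omega> \<or> V (Fading_W j i) \<omega> \<in> A j)} =
    iprod (\<lambda>j. if j = i then 1 else 1 - t * h j) * iprod (\<lambda>k. 1 - q k)"
proof -
  have V_meas: "V s \<in> borel_measurable M" if "s \<in> marks" for s
    using ind that by (auto simp: indep_vars_def)
  have [measurable]: "V (Timer j) \<in> borel_measurable M" "V (Fading_W j i) \<in> borel_measurable M"
    "V (Fading_LW k i) \<in> borel_measurable M" for j k by (auto intro!: V_meas)
  have h01: "0 \<le> h j" "h j \<le> 1" for j
    using h[of j] prob_le_1[of "{\<omega>\<in>space M. V (Fading_W j i) \<omega> \<in> A j}"]
      measure_nonneg[of M "{\<omega>\<in>space M. V (Fading_W j i) \<omega> \<in> A j}"] by linarith+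
  have q01: "0 \<le> q k" "q k \<le> 1" for k
    using q[of k] prob_le_1[of "{\<omega>\<in>space M. V (Fading_LW k i) \<omega> \<in> B k}"]
      measure_nonneg[of M "{\<omega>\<in>space M. V (Fading_LW k i) \<omega> \<in> B k}"] by linarith+
  have th: "0 \<le> 1 - t * h j" "1 - t * h j \<le> 1" for j
    using t h01[of j] mult_mono[of t 1 "h j" 1] by auto
  have pair: "prob {\<omega>\<in>space M. t \<le> V (Timer j) \<omega> \<or> V (Fading_W j i) \<omega> \<in> A j} = 1 - t * h j" for j
  proof -
    have "prob (\<Inter>s\<in>{Timer j, Fading_W j i}. V s -` (case s of Timer _ \<Rightarrow> {..<t} | _ \<Rightarrow> - A j) \<inter> space M) =
      (\<Prod>s\<in>{Timer j, Fading_W j i}. prob (V s -` (case s of Timer _ \<Rightarrow> {..<t} | _ \<Rightarrow> - A j) \<inter> space M))"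
      by (rule indep_varsD[OF ind]) auto
    also have "\<dots> = prob {\<omega>\<in>space M. V (Timer j) \<omega> < t} * prob {\<omega>\<in>space M. V (Fading_W j i) \<omega> \<notin> A j}"
      by (auto intro!: arg_cong2[where f="(*)"] arg_cong[where f=prob])
    also have "prob {\<omega>\<in>space M. V (Timer j) \<omega> < t} = t"
      by (rule prob_uniform_less) (auto simp: unif t)
    also have "prob {\<omega>\<in>space M. V (Fading_W j i) \<omega> \<notin> A j} = h j"
      using prob_neg[of "\<lambda>\<omega>. V (Fading_W j i) \<omega> \<in> A j"] h[of j] by simp
    also have "(\<Inter>s\<in>{Timer j, Fading_W j i}. V s -` (case s of Timer _ \<Rightarrow> {..<t} | _ \<Rightarrow> - A j) \<inter> space M) =
      {\<omega>\<in>space M. \<not> (t \<le> V (Timer j) \<omega> \<or> V (Fading_W j i) \<omega> \<in> A j)}"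
      by auto
    finally show ?thesis
      using prob_neg[of "\<lambda>\<omega>. t \<le> V (Timer j) \<omega> \<or> V (Fading_W j i) \<omega> \<in> A j"] by simp
  qed
  \<comment> \<open>\<open>Timer j\<close> and \<open>Fading_W j i\<close> occur in one disjunction
    and form one block, while each eNB fading is a block of its own. The blocks are disjoint, hence
    independent.\<close>
  define K where "K g = (case g of Inl j \<Rightarrow> {Timer j, Fading_W j i} | Inr k \<Rightarrow> {Fading_LW k i})" for g :: "nat + nat"
  define L :: "(nat + nat) set" where "L = Inl ` (- {i}) \<union> range Inr"
  define e :: "nat + nat \<Rightarrow> (source \<Rightarrow> real) \<Rightarrow> ennreal" where "e g z = (case g of
      Inl j \<Rightarrow> indicator {z. t \<le> z (Timer j) \<or> z (Fading_W j i) \<in> A j} z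
    | Inr k \<Rightarrow> indicator {z. z (Fading_LW k i) \<in> B k} z)" for g z
  have "indep_vars (\<lambda>g. PiM (K g) (\<lambda>_. borel)) (\<lambda>g \<omega>. restrict (\<lambda>s. V s \<omega>) (K g)) L"
    by (rule indep_vars_restrict[OF ind]) (auto simp: K_def L_def disjoint_family_on_def split: sum.splits)
  moreover have "e g \<in> borel_measurable (PiM (K g) (\<lambda>_. borel))" for g
  proof (cases g)
    case (Inl j)
    then have [measurable]: "(\<lambda>z. z (Timer j)) \<in> PiM (K g) (\<lambda>_. borel :: real measure) \<rightarrow>\<^sub>M borel"
      "(\<lambda>z. z (Fading_W j i)) \<in> PiM (K g) (\<lambda>_. borel :: real measure) \<rightarrow>\<^sub>M borel"
      by (auto simp: K_def intro!: measurable_component_singleton)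
    have "(\<lambda>z. indicator {z. t \<le> z (Timer j) \<or> z (Fading_W j i) \<in> A j} z :: ennreal) \<in> borel_measurable (PiM (K g) (\<lambda>_. borel))"
      by measurable
    then show ?thesis unfolding e_def Inl by simp
  next
    case (Inr k)
    then have [measurable]: "(\<lambda>z. z (Fading_LW k i)) \<in> PiM (K g) (\<lambda>_. borel :: real measure) \<rightarrow>\<^sub>M borel"
      by (auto simp: K_def intro!: measurable_component_singleton)
    have "(\<lambda>z. indicator {z. z (Fading_LW k i) \<in> B k} z :: ennreal) \<in> borel_measurable (PiM (K g) (\<lambda>_. borel))"
      by measurable
    then show ?thesis unfolding e_def Inr by simp
  qed
  ultimately have ind_e: "indep_vars (\<lambda>_. borel) (\<lambda>g \<omega>. e g (restrict (\<lambda>s. V s \<omega>) (K g))) L"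
    by (rule indep_vars_compose2)
  \<comment> \<open>Truncation to the first \<open>n\<close> indices gives finite products of
    expectations; the events decrease to the full one.\<close>
  define E where "E n = {\<omega>\<in>space M. (\<forall>k<n. V (Fading_LW k i) \<omega> \<in> B k) \<and>
      (\<forall>j<n. j \<noteq> i \<longrightarrow> t \<le> V (Timer j) \<omega> \<or> V (Fading_W j i) \<omega> \<in> A j)}" for n
  have [measurable]: "E n \<in> sets M" for n unfolding E_def by measurable
  define h' where "h' j = (if j = i then 1 else 1 - t * h j)" for j
  have h'01: "0 \<le> h' j" "h' j \<le> 1" for j using th[of j] by (auto simp: h'_def)
  have emeasure_E: "emeasure M (E n) = ennreal (\<Prod>j<n. h' j) * ennreal (\<Prod>k<n. 1 - q k)" for n
  proof -
    let ?G1 = "Inl ` ({..<n} - {i}) :: (nat + nat) set" and ?G2 = "Inr ` {..<n} :: (nat + nat) set"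
    have split: "(\<Prod>g\<in>?G1 \<union> ?G2. F g) = (\<Prod>j\<in>{..<n} - {i}. F (Inl j)) * (\<Prod>k<n. F (Inr k))"
      for F :: "nat + nat \<Rightarrow> ennreal"
      by (subst prod.union_disjoint) (auto simp: prod.reindex)
    have "emeasure M (E n) = (\<integral>\<^sup>+\<omega>. indicator (E n) \<omega> \<partial>M)" by simp
    also have "\<dots> = (\<integral>\<^sup>+\<omega>. (\<Prod>g\<in>?G1 \<union> ?G2. e g (restrict (\<lambda>s. V s \<omega>) (K g))) \<partial>M)"
    proof (rule nn_integral_cong)
      fix \<omega> assume \<omega>: "\<omega> \<in> space M"
      have "(\<Prod>j\<in>{..<n} - {i}. e (Inl j) (restrict (\<lambda>s. V s \<omega>) (K (Inl j)))) =
          of_bool (\<forall>j<n. j \<noteq> i \<longrightarrow> t \<le> V (Timer j) \<omega> \<or> V (Fading_W j i) \<omega> \<in> A j)"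
        by (auto simp: e_def K_def indicator_def prod_zero_iff intro!: prod.neutral)
      moreover have "(\<Prod>k<n. e (Inr k) (restrict (\<lambda>s. V s \<omega>) (K (Inr k)))) =
          of_bool (\<forall>k<n. V (Fading_LW k i) \<omega> \<in> B k)"
        by (auto simp: e_def K_def indicator_def prod_zero_iff intro!: prod.neutral)
      ultimately show "indicator (E n) \<omega> = (\<Prod>g\<in>?G1 \<union> ?G2. e g (restrict (\<lambda>s. V s \<omega>) (K g)))"
        unfolding split using \<omega> by (simp add: E_def indicator_def)
    qed
    also have "\<dots> = (\<Prod>g\<in>?G1 \<union> ?G2. \<integral>\<^sup>+\<omega>. e g (restrict (\<lambda>s. V s \<omega>) (K g)) \<partial>M)"
      by (intro indep_vars_nn_integral indep_vars_subset[OF ind_e]) (auto simp: L_def)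
    also have "\<dots> = (\<Prod>j\<in>{..<n} - {i}. ennreal (1 - t * h j)) * (\<Prod>k<n. ennreal (1 - q k))"
      unfolding split
    proof (intro arg_cong2[where f="(*)"] prod.cong refl)
      fix j
      have "(\<integral>\<^sup>+\<omega>. e (Inl j) (restrict (\<lambda>s. V s \<omega>) (K (Inl j))) \<partial>M) =
          (\<integral>\<^sup>+\<omega>. indicator {\<omega>\<in>space M. t \<le> V (Timer j) \<omega> \<or> V (Fading_W j i) \<omega> \<in> A j} \<omega> \<partial>M)"
        by (rule nn_integral_cong) (auto simp: e_def K_def indicator_def)
      then show "(\<integral>\<^sup>+\<omega>. e (Inl j) (restrict (\<lambda>s. V s \<omega>) (K (Inl j))) \<partial>M) = ennreal (1 - t * h j)"
        by (simp add: emeasure_eq_measure pair)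
    next
      fix k
      have "(\<integral>\<^sup>+\<omega>. e (Inr k) (restrict (\<lambda>s. V s \<omega>) (K (Inr k))) \<partial>M) =
          (\<integral>\<^sup>+\<omega>. indicator {\<omega>\<in>space M. V (Fading_LW k i) \<omega> \<in> B k} \<omega> \<partial>M)"
        by (rule nn_integral_cong) (auto simp: e_def K_def indicator_def)
      then show "(\<integral>\<^sup>+\<omega>. e (Inr k) (restrict (\<lambda>s. V s \<omega>) (K (Inr k))) \<partial>M) = ennreal (1 - q k)"
        by (simp add: emeasure_eq_measure q)
    qed
    also have "\<dots> = ennreal (\<Prod>j\<in>{..<n} - {i}. 1 - t * h j) * ennreal (\<Prod>k<n. 1 - q k)"
      using th q01 by (simp add: prod_ennreal)
    also have "(\<Prod>j\<in>{..<n} - {i}. 1 - t * h j) = (\<Prod>j<n. h' j)"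
      by (rule prod.mono_neutral_cong_left) (auto simp: h'_def)
    finally show ?thesis .
  qed
  have lim: "(\<lambda>n. emeasure M (E n)) \<longlonglongrightarrow> emeasure M (\<Inter>n. E n)"
  proof (rule Lim_emeasure_decseq)
    show "decseq E"
      by (rule decseq_SucI) (unfold E_def, blast intro: less_SucI)
  qed auto
  have "(\<lambda>n. emeasure M (E n)) \<longlonglongrightarrow> iprod h' * iprod (\<lambda>k. 1 - q k)"
    unfolding emeasure_E
    using iprod_le_1[of h'] iprod_le_1[of "\<lambda>k. 1 - q k"] h'01 q01
    by (intro tendsto_mult_ennreal iprod_LIMSEQ) (auto simp: top_unique)
  with lim have "emeasure M (\<Inter>n. E n) = iprod h' * iprod (\<lambda>k. 1 - q k)"
    by (rule LIMSEQ_unique)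
  moreover have "(\<Inter>n. E n) = {\<omega>\<in>space M. (\<forall>k. V (Fading_LW k i) \<omega> \<in> B k) \<and>
      (\<forall>j. j \<noteq> i \<longrightarrow> t \<le> V (Timer j) \<omega> \<or> V (Fading_W j i) \<omega> \<in> A j)}"
    unfolding E_def by auto
  ultimately show ?thesis
    by (simp add: h'_def[abs_def])
qed

text \<open>The timer of \<open>i\<close> is shared by all contention conditions, so the probability
  is a mixture of products and not a product. \<open>Timer i\<close> is independent of the remaining
  marks, which allows its value to be frozen and then averaged.\<close>

lemma (in prob_space) mark_probability:
  fixes V :: "source \<Rightarrow> 'a \<Rightarrow> real"
  assumes ind: "indep_vars (\<lambda>_. borel) V marks"
    and unif: "\<And>j. distr M borel (V (Timer j)) = uniform_measure lborel {0..1}"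
    and AB [measurable]: "\<And>j. A j \<in> sets borel" "\<And>k. B k \<in> sets borel"
    and h: "\<And>j. prob {\<omega>\<in>space M. V (Fading_W j i) \<omega> \<in> A j} = 1 - h j"
    and q: "\<And>k. prob {\<omega>\<in>space M. V (Fading_LW k i) \<omega> \<in> B k} = 1 - q k"
  shows "emeasure M {\<omega>\<in>space M. (\<forall>k. V (Fading_LW k i) \<omega> \<in> B k) \<and>
      (\<forall>j. j \<noteq> i \<longrightarrow> V (Timer i) \<omega> \<le> V (Timer j) \<omega> \<or> V (Fading_W j i) \<omega> \<in> A j)} =
    (\<integral>\<^sup>+t. iprod (\<lambda>j. if j = i then 1 else 1 - t * h j) * indicator {0..1} t \<partial>lborel) * iprod (\<lambda>k. 1 - q k)"
proof -
  have [measurable]: "V (Timer j) \<in> borel_measurable M" "V (Fading_W j i) \<in> borel_measurable M"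
    "V (Fading_LW k i) \<in> borel_measurable M" for j k
    using ind by (auto simp: indep_vars_def)
  let ?R = "marks - {Timer i}"
  define f :: "real \<times> (source \<Rightarrow> real) \<Rightarrow> ennreal" where
    "f = indicator {(t, z). (\<forall>k. z (Fading_LW k i) \<in> B k) \<and>
      (\<forall>j. j \<noteq> i \<longrightarrow> t \<le> z (Timer j) \<or> z (Fading_W j i) \<in> A j)}"
  have comp: "(\<lambda>z. snd z s) \<in> borel \<Otimes>\<^sub>M PiM ?R (\<lambda>_. borel :: real measure) \<rightarrow>\<^sub>M borel" if "s \<in> ?R" for s
    by (rule measurable_compose[OF measurable_snd measurable_component_singleton[OF that]])
  have [measurable]: "f \<in> borel_measurable (borel \<Otimes>\<^sub>M PiM ?R (\<lambda>_. borel))"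
  proof -
    have [measurable]: "(\<lambda>z. snd z (Fading_LW k i)) \<in> borel \<Otimes>\<^sub>M PiM ?R (\<lambda>_. borel :: real measure) \<rightarrow>\<^sub>M borel"
      "(\<lambda>z. snd z (Fading_W k i)) \<in> borel \<Otimes>\<^sub>M PiM ?R (\<lambda>_. borel :: real measure) \<rightarrow>\<^sub>M borel" for k
      by (auto intro!: comp)
    \<comment> \<open>For \<open>j = i\<close> the timer is not a coordinate of the space over
      \<open>?R\<close>, so measurability is checked separately for this index, where the condition
      is void.\<close>
    define p where "p j z \<longleftrightarrow> j \<noteq> i \<longrightarrow> fst z \<le> snd z (Timer j) \<or> snd z (Fading_W j i) \<in> A j"
      for j and z :: "real \<times> (source \<Rightarrow> real)"
    have [measurable]: "Measurable.pred (borel \<Otimes>\<^sub>M PiM ?R (\<lambda>_. borel)) (p j)" for j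
    proof (cases "j = i")
      case False
      then have [measurable]: "(\<lambda>z. snd z (Timer j)) \<in> borel \<Otimes>\<^sub>M PiM ?R (\<lambda>_. borel :: real measure) \<rightarrow>\<^sub>M borel"
        by (auto intro!: comp)
      have "Measurable.pred (borel \<Otimes>\<^sub>M PiM ?R (\<lambda>_. borel :: real measure))
        (\<lambda>z. fst z \<le> snd z (Timer j) \<or> snd z (Fading_W j i) \<in> A j)"
        by measurable
      then show ?thesis using False by (simp add: p_def[abs_def])
    qed (simp add: p_def[abs_def])
    have "Measurable.pred (borel \<Otimes>\<^sub>M PiM ?R (\<lambda>_. borel :: real measure))
        (\<lambda>z. (\<forall>k. snd z (Fading_LW k i) \<in> B k) \<and> (\<forall>j. p j z))"
      by measurable
    then have "(\<lambda>z. if (\<forall>k. snd z (Fading_LW k i) \<in> B k) \<and> (\<forall>j. p j z) then 1 else 0 :: ennreal)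
        \<in> borel_measurable (borel \<Otimes>\<^sub>M PiM ?R (\<lambda>_. borel :: real measure))"
      by (intro measurable_If borel_measurable_const) (simp add: pred_def)
    moreover have "f = (\<lambda>z. if (\<forall>k. snd z (Fading_LW k i) \<in> B k) \<and> (\<forall>j. p j z) then 1 else 0)"
      unfolding f_def p_def by (simp add: fun_eq_iff indicator_def split_def)
    ultimately show ?thesis by simp
  qed
  let ?T = "\<lambda>\<omega>. restrict (\<lambda>s. V s \<omega>) {Timer i}" and ?rest = "\<lambda>\<omega>. restrict (\<lambda>s. V s \<omega>) ?R"
  have T: "?T \<in> M \<rightarrow>\<^sub>M PiM {Timer i} (\<lambda>_. borel)" and rest: "?rest \<in> M \<rightarrow>\<^sub>M PiM ?R (\<lambda>_. borel)"
    and joint: "distr M (PiM {Timer i} (\<lambda>_. borel)) ?T \<Otimes>\<^sub>M distr M (PiM ?R (\<lambda>_. borel)) ?rest =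
      distr M (PiM {Timer i} (\<lambda>_. borel) \<Otimes>\<^sub>M PiM ?R (\<lambda>_. borel)) (\<lambda>\<omega>. (?T \<omega>, ?rest \<omega>))"
    using indep_var_restrict[OF ind, of "{Timer i}" ?R] by (auto simp: indep_var_distribution_eq)
  let ?P = "\<lambda>t. emeasure M {\<omega>\<in>space M. (\<forall>k. V (Fading_LW k i) \<omega> \<in> B k) \<and>
      (\<forall>j. j \<noteq> i \<longrightarrow> t \<le> V (Timer j) \<omega> \<or> V (Fading_W j i) \<omega> \<in> A j)}"
  have f_eq: "f (t, restrict (\<lambda>s. V s \<omega>) ?R) = indicator {\<omega>\<in>space M. (\<forall>k. V (Fading_LW k i) \<omega> \<in> B k) \<and>
      (\<forall>j. j \<noteq> i \<longrightarrow> t \<le> V (Timer j) \<omega> \<or> V (Fading_W j i) \<omega> \<in> A j)} \<omega>" if "\<omega> \<in> space M" for t \<omega>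
    using that by (auto simp: f_def indicator_def)
  have "emeasure M {\<omega>\<in>space M. (\<forall>k. V (Fading_LW k i) \<omega> \<in> B k) \<and>
      (\<forall>j. j \<noteq> i \<longrightarrow> V (Timer i) \<omega> \<le> V (Timer j) \<omega> \<or> V (Fading_W j i) \<omega> \<in> A j)} =
      (\<integral>\<^sup>+\<omega>. f (V (Timer i) \<omega>, restrict (\<lambda>s. V s \<omega>) ?R) \<partial>M)"
    (is "emeasure M ?E = _")
  proof -
    have "emeasure M ?E = (\<integral>\<^sup>+\<omega>. indicator ?E \<omega> \<partial>M)"
      by (rule nn_integral_indicator[symmetric]) measurable
    also have "\<dots> = (\<integral>\<^sup>+\<omega>. f (V (Timer i) \<omega>, restrict (\<lambda>s. V s \<omega>) ?R) \<partial>M)"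
      by (rule nn_integral_cong) (simp add: f_eq indicator_def)
    finally show ?thesis .
  qed
  also have "\<dots> = (\<integral>\<^sup>+\<omega>. \<integral>\<^sup>+\<omega>'. f (V (Timer i) \<omega>, restrict (\<lambda>s. V s \<omega>') ?R) \<partial>M \<partial>M)"
  proof -
    have "(\<lambda>(a, z). f (a (Timer i), z)) \<in> borel_measurable (PiM {Timer i} (\<lambda>_. borel) \<Otimes>\<^sub>M PiM ?R (\<lambda>_. borel))"
      unfolding split_def
      by (rule measurable_compose[OF measurable_Pair[OF measurable_compose[OF measurable_fst
          measurable_component_singleton] measurable_snd]]) auto
    from nn_integral_indep_pair[OF T rest joint this] show ?thesis by simp
  qed
  also have "\<dots> = (\<integral>\<^sup>+\<omega>. ?P (V (Timer i) \<omega>) \<partial>M)"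
    by (intro nn_integral_cong) (simp add: f_eq cong: nn_integral_cong)
  also have "\<dots> = (\<integral>\<^sup>+t. ?P t \<partial>uniform_measure lborel {0..1})"
    unfolding unif[of i, symmetric]
  proof (rule nn_integral_distr[symmetric])
    \<comment> \<open>As a partial integral of the jointly measurable \<open>f\<close>, the
      conditional probability is measurable in \<open>t\<close>.\<close>
    have "(\<lambda>t. \<integral>\<^sup>+z. f (t, z) \<partial>distr M (PiM ?R (\<lambda>_. borel)) (\<lambda>\<omega>. restrict (\<lambda>s. V s \<omega>) ?R)) \<in> borel_measurable borel"
    proof -
      interpret R: prob_space "distr M (PiM ?R (\<lambda>_. borel)) (\<lambda>\<omega>. restrict (\<lambda>s. V s \<omega>) ?R)"
        using rest by (rule prob_space_distr)
      show ?thesis by (rule R.borel_measurable_nn_integral_fst) simp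
    qed
    also have "(\<lambda>t. \<integral>\<^sup>+z. f (t, z) \<partial>distr M (PiM ?R (\<lambda>_. borel)) (\<lambda>\<omega>. restrict (\<lambda>s. V s \<omega>) ?R)) = ?P"
    proof
      fix t
      have "(\<integral>\<^sup>+z. f (t, z) \<partial>distr M (PiM ?R (\<lambda>_. borel)) (\<lambda>\<omega>. restrict (\<lambda>s. V s \<omega>) ?R)) =
          (\<integral>\<^sup>+\<omega>. f (t, restrict (\<lambda>s. V s \<omega>) ?R) \<partial>M)"
        using rest by (rule nn_integral_distr) measurable
      also have "\<dots> = ?P t" by (simp add: f_eq cong: nn_integral_cong)
      finally show "(\<integral>\<^sup>+z. f (t, z) \<partial>distr M (PiM ?R (\<lambda>_. borel)) (\<lambda>\<omega>. restrict (\<lambda>s. V s \<omega>) ?R)) = ?P t" .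
    qed
    finally show "?P \<in> borel_measurable (distr M borel (V (Timer i)))" by simp
  qed measurable
  \<comment> \<open>The product formula is available for \<open>t\<close> between 0 and 1, which
    carries the whole uniform law.\<close>
  also have "\<dots> = (\<integral>\<^sup>+t. iprod (\<lambda>j. if j = i then 1 else 1 - t * h j) * iprod (\<lambda>k. 1 - q k) \<partial>uniform_measure lborel {0..1})"
  proof (rule nn_integral_cong_AE, rule AE_uniform_measureI)
    show "AE t in lborel. t \<in> {0..1} \<longrightarrow> ?P t = iprod (\<lambda>j. if j = i then 1 else 1 - t * h j) * iprod (\<lambda>k. 1 - q k)"
      by (intro AE_I2 impI mark_probability_given_timer[OF ind unif AB h q]) auto
  qed simp
  also have "\<dots> = (\<integral>\<^sup>+t. iprod (\<lambda>j. if j = i then 1 else 1 - t * h j) \<partial>uniform_measure lborel {0..1}) * iprod (\<lambda>k. 1 - q k)"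
    by (rule nn_integral_multc) measurable
  also have "(\<integral>\<^sup>+t. iprod (\<lambda>j. if j = i then 1 else 1 - t * h j) \<partial>uniform_measure lborel {0..1}) =
      (\<integral>\<^sup>+t. iprod (\<lambda>j. if j = i then 1 else 1 - t * h j) * indicator {0..1} t \<partial>lborel)"
    by (subst nn_integral_uniform_measure) (auto simp: divide_ennreal_def)
  finally show ?thesis .
qed

subsection \<open>Radial integrals in the plane\<close>

text \<open>Polar coordinates by comparison of measures: both sides give \<open>{..a}\<close> the
  disc area \<open>pi * a^2\<close>, and these rays are an intersection-stable generator on which
  the measures are finite.\<close>

lemma distr_norm_lborel:
  "distr (lborel :: (real^2) measure) borel norm = density lborel (\<lambda>r. ennreal (2 * pi * r) * indicator {0..} r)"
proof (rule measure_eqI_generator_eq[where E="range (\<lambda>a::real. {..a})" and \<Omega>=UNIV and A="\<lambda>n. {..real n}"])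
  show "Int_stable (range (\<lambda>a::real. {..a}))"
    by (auto simp: Int_stable_def)
  have norm_le: "emeasure (distr (lborel :: (real^2) measure) borel norm) {..a} = ennreal (if 0 \<le> a then pi * a\<^sup>2 else 0)" for a
  proof (cases "0 \<le> a")
    case True
    have "norm -` {..a} = cball (0 :: real^2) a" by auto
    moreover have "emeasure lborel (cball (0 :: real^2) a) = ennreal (pi * a\<^sup>2)"
      using True by (simp add: emeasure_cball unit_ball_vol_2)
    ultimately show ?thesis using True by (simp add: emeasure_distr)
  next
    case False
    then have "norm -` {..a} = ({} :: (real^2) set)"
      by (auto dest: order_trans[OF norm_ge_zero])
    then show ?thesis using False by (simp add: emeasure_distr)
  qed
  have dens: "emeasure (density lborel (\<lambda>r. ennreal (2 * pi * r) * indicator {0..} r)) {..a} =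
      ennreal (if 0 \<le> a then pi * a\<^sup>2 else 0)" for a
  proof -
    have "emeasure (density lborel (\<lambda>r. ennreal (2 * pi * r) * indicator {0..} r)) {..a} =
        (\<integral>\<^sup>+r. ennreal (2 * pi * r) * indicator {0..a} r \<partial>lborel)"
      by (subst emeasure_density) (auto intro!: nn_integral_cong split: split_indicator)
    also have "\<dots> = ennreal (if 0 \<le> a then pi * a\<^sup>2 else 0)"
    proof (cases "0 \<le> a")
      case True
      then have "(\<integral>\<^sup>+r. ennreal (2 * pi * r) * indicator {0..a} r \<partial>lborel) = ennreal (pi * a\<^sup>2 - pi * 0\<^sup>2)"
        by (intro nn_integral_FTC_Icc) (auto intro!: derivative_eq_intros)
      then show ?thesis using True by simp
    qed simp
    finally show ?thesis .
  qed
  show "emeasure (distr (lborel :: (real^2) measure) borel norm) S =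
      emeasure (density lborel (\<lambda>r. ennreal (2 * pi * r) * indicator {0..} r)) S"
    if "S \<in> range (\<lambda>a::real. {..a})" for S
    using that by (auto simp: norm_le dens)
  show "emeasure (distr (lborel :: (real^2) measure) borel norm) {..real n} \<noteq> \<infinity>" for n
    by (simp add: norm_le)
  show "(\<Union>n. {..real n}) = UNIV"
    by (auto intro: real_arch_simple)
qed (auto simp: borel_eq_atMost)

theorem nn_integral_radial:
  fixes f :: "real \<Rightarrow> ennreal"
  assumes [measurable]: "f \<in> borel_measurable borel"
  shows "(\<integral>\<^sup>+x. f (norm (x :: real^2)) \<partial>lborel) =
    (\<integral>\<^sup>+r. ennreal (2 * pi * r) * indicator {0..} r * f r \<partial>lborel)"
proof -
  have "(\<integral>\<^sup>+x. f (norm (x :: real^2)) \<partial>lborel) = (\<integral>\<^sup>+r. f r \<partial>distr (lborel :: (real^2) measure) borel norm)"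
    by (subst nn_integral_distr) auto
  then show ?thesis
    by (simp add: distr_norm_lborel nn_integral_density)
qed

text \<open>Lebesgue measure is determined by the volumes of boxes, and the preimage of a box is its
  image under the inverse map, which is orthogonal too.\<close>

lemma distr_orthogonal_lborel:
  fixes f :: "real^'n::{finite,wellorder} \<Rightarrow> real^'n::_"
  assumes f: "orthogonal_transformation f"
  shows "distr lborel borel f = lborel"
proof (rule lborel_eqI[symmetric])
  have lin: "linear f" using f by (rule orthogonal_transformation_linear)
  have [measurable]: "f \<in> borel_measurable borel"
    by (intro borel_measurable_continuous_onI linear_continuous_on) (simp add: linear_conv_bounded_linear[symmetric] lin)
  fix l u :: "real^'n::_" assume lu: "\<And>b. b \<in> Basis \<Longrightarrow> l \<bullet> b \<le> u \<bullet> b"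
  have bij: "bij f" by (rule orthogonal_transformation_bij[OF f])
  have "measure lebesgue (f -` box l u) = measure lebesgue (inv f ` box l u)"
    using bij by (simp add: bij_vimage_eq_inv_image)
  also have "\<dots> = measure lebesgue (box l u)"
    by (rule measure_orthogonal_image) (auto intro: orthogonal_transformation_inv[OF f])
  finally have m: "measure lebesgue (f -` box l u) = measure lebesgue (box l u)" .
  have meas: "f -` box l u \<in> sets borel"
    using measurable_sets[OF \<open>f \<in> borel_measurable borel\<close>, of "box l u"] by simp
  \<comment> \<open>The invariance used above concerns the real-valued \<open>measure\<close>, for
    which an infinite volume would read 0; boundedness permits the return to
    \<open>emeasure\<close>.\<close>
  have "bounded (f -` box l u)"
  proof -
    have "f -` box l u = inv f ` box l u" using bij by (simp add: bij_vimage_eq_inv_image)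
    moreover have "bounded_linear (inv f)"
      using orthogonal_transformation_linear[OF orthogonal_transformation_inv[OF f]]
      by (simp add: linear_conv_bounded_linear)
    ultimately show ?thesis by (simp add: bounded_linear_image)
  qed
  from emeasure_bounded_finite[OF this]
  have "emeasure lborel (f -` box l u) = ennreal (measure lborel (f -` box l u))"
    by (intro emeasure_eq_ennreal_measure) simp
  also have "measure lborel (f -` box l u) = measure lborel (box l u)"
    using m meas by (simp add: measure_completion)
  also have "ennreal (measure lborel (box l u)) = (\<Prod>b\<in>Basis. (u - l) \<bullet> b)"
    using emeasure_lborel_box[OF lu] emeasure_eq_ennreal_measure[of lborel "box l u"] by simp
  finally show "emeasure (distr lborel borel f) (box l u) = (\<Prod>b\<in>Basis. (u - l) \<bullet> b)"
    by (simp add: emeasure_distr)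
qed simp

text \<open>An orthogonal map taking \<open>x\<close> to \<open>y\<close> preserves volume, norms
  and distances. In this way an integral around \<open>x\<close> can be evaluated at the point
  \<open>(norm x, 0)\<close> on the axis.\<close>

lemma integral_rotate:
  fixes f :: "real \<Rightarrow> real \<Rightarrow> real" and x y :: "real^2"
  assumes [measurable]: "(\<lambda>(a, b). f a b) \<in> borel_measurable (borel \<Otimes>\<^sub>M borel)"
    and "norm x = norm y"
  shows "(\<integral>z. f (norm z) (norm (z - x)) \<partial>lborel) = (\<integral>z. f (norm z) (norm (z - y)) \<partial>lborel)"
proof -
  obtain T where T: "orthogonal_transformation T" "T x = y"
    using orthogonal_transformation_exists[OF assms(2)] by auto
  have lin: "linear T" using T(1) by (rule orthogonal_transformation_linear)
  have [measurable]: "T \<in> borel_measurable borel"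
    by (intro borel_measurable_continuous_onI linear_continuous_on) (simp add: linear_conv_bounded_linear[symmetric] lin)
  have m: "(\<lambda>z::real^2. f (norm z) (norm (z - y))) \<in> borel_measurable borel"
    using measurable_compose[OF measurable_Pair assms(1), of norm borel "\<lambda>z. norm (z - y)"] by simp
  have "(\<integral>z. f (norm z) (norm (z - y)) \<partial>lborel) = (\<integral>z. f (norm z) (norm (z - y)) \<partial>distr lborel borel T)"
    by (simp add: distr_orthogonal_lborel T(1))
  also have "\<dots> = (\<integral>z. f (norm (T z)) (norm (T z - y)) \<partial>lborel)"
    by (subst integral_distr) (auto simp: m)
  also have "(\<lambda>z. f (norm (T z)) (norm (T z - y))) = (\<lambda>z. f (norm z) (norm (z - x)))"
    using T orthogonal_transformation_norm[OF T(1)] linear_diff[OF lin, of _ x] by metis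
  finally show ?thesis by simp
qed

text \<open>Any positive exponent \<open>\<alpha>\<close> is admissible, however small, because the
  exponential decays faster than every power of the norm.\<close>

lemma integrable_exp_norm_powr:
  assumes c: "0 < c" and \<alpha>: "0 < \<alpha>"
  shows "integrable lborel (\<lambda>z::real^2. exp (- (c * norm z powr \<alpha>)))"
proof (rule integrableI_bounded)
  \<comment> \<open>Chosen so that \<open>\<alpha> * k > 4\<close>: decay of order 4 leaves order 3
    after the Jacobian factor \<open>r\<close>, which is integrable at infinity.\<close>
  obtain k :: nat where k: "4 / \<alpha> < real k" using reals_Archimedean2 by blast
  then have k0: "0 < k" using \<alpha> by (cases k) (auto simp: field_simps)
  \<comment> \<open>Comes from \<open>exp y \<ge> (1 + y / k) ^ k \<ge> (y / k) ^ k\<close> with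
    \<open>y = c * r powr \<alpha>\<close>.\<close>
  define K where "K = (real k / c) ^ k"
  have K: "0 \<le> K" using c by (simp add: K_def)
  have bound: "exp (- (c * r powr \<alpha>)) \<le> K * r powr (-4)" if "1 \<le> r" for r
  proof -
    let ?y = "c * r powr \<alpha>"
    have y: "0 < ?y" using c that by simp
    have "(?y / real k) ^ k \<le> (1 + ?y / real k) ^ k"
      using y by (intro power_mono) auto
    also have "\<dots> \<le> exp ?y"
      using y k0 by (intro exp_ge_one_plus_x_over_n_power_n) auto
    finally have "exp (- ?y) \<le> inverse ((?y / real k) ^ k)"
      using y k0 by (simp add: exp_minus le_imp_inverse_le)
    also have "\<dots> = K * inverse (r powr (\<alpha> * real k))"
      using c that by (simp add: K_def power_mult_distrib power_divide field_simps powr_realpow[symmetric] powr_powr)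
    also have "\<dots> \<le> K * inverse (r powr 4)"
      using k \<alpha> that by (intro mult_left_mono K le_imp_inverse_le powr_mono) (auto simp: field_simps)
    finally show ?thesis by (simp add: powr_minus)
  qed
  let ?f = "\<lambda>r. ennreal (exp (- (c * r powr \<alpha>)))"
  have "(\<integral>\<^sup>+z. norm (exp (- (c * norm (z :: real^2) powr \<alpha>))) \<partial>lborel) = (\<integral>\<^sup>+z. ?f (norm (z :: real^2)) \<partial>lborel)"
    by simp
  also have "\<dots> = (\<integral>\<^sup>+r. ennreal (2 * pi * r) * indicator {0..} r * ?f r \<partial>lborel)"
    by (rule nn_integral_radial) measurable
  \<comment> \<open>The power bound is singular at 0 and serves only for \<open>r \<ge> 1\<close>;
    below 1 the integrand is at most \<open>2 * pi\<close>.\<close>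
  also have "\<dots> \<le> (\<integral>\<^sup>+r. ennreal (2 * pi) * indicator {0..1} r + ennreal (2 * pi * K * r powr (-3)) * indicator {1..} r \<partial>lborel)"
  proof (rule nn_integral_mono)
    fix r :: real
    consider "r < 0" | "0 \<le> r" "r < 1" | "1 \<le> r" by linarith
    then show "ennreal (2 * pi * r) * indicator {0..} r * ?f r \<le>
      ennreal (2 * pi) * indicator {0..1} r + ennreal (2 * pi * K * r powr (-3)) * indicator {1..} r"
    proof cases
      case 2
      have "2 * pi * r * exp (- (c * r powr \<alpha>)) \<le> 2 * pi * 1 * 1"
        using 2 c by (intro mult_mono) auto
      then show ?thesis using 2 by (simp add: ennreal_mult[symmetric] ennreal_leI)
    next
      case 3
      have "2 * pi * r * exp (- (c * r powr \<alpha>)) \<le> 2 * pi * r * (K * r powr (-4))"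
        using 3 bound by (intro mult_left_mono) auto
      also have "\<dots> = 2 * pi * K * (r powr 1 * r powr (-4))" using 3 by simp
      also have "r powr 1 * r powr (-4) = r powr (-3)" unfolding powr_add[symmetric] by simp
      finally have "ennreal (2 * pi * r * exp (- (c * r powr \<alpha>))) \<le> ennreal (2 * pi * K * r powr (-3))"
        by (rule ennreal_leI)
      then show ?thesis using 3 by (simp add: ennreal_mult[symmetric] add_increasing)
    qed simp
  qed
  also have "\<dots> = ennreal (2 * pi) * emeasure lborel {0..1::real} +
      (\<integral>\<^sup>+r. ennreal (2 * pi * K * r powr (-3)) * indicator {1..} r \<partial>lborel)"
    by (subst nn_integral_add) (auto simp: nn_integral_cmult_indicator)
  also have "(\<integral>\<^sup>+r. ennreal (2 * pi * K * r powr (-3)) * indicator {1..} r \<partial>lborel) =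
      ennreal (0 - (- pi * K * 1 powr (-2)))"
  proof (rule nn_integral_FTC_atLeast)
    show "((\<lambda>r. - pi * K * r powr (-2)) has_real_derivative 2 * pi * K * r powr (-3)) (at r)" if "1 \<le> r" for r
      using that by (auto intro!: derivative_eq_intros)
    have "((\<lambda>r::real. r powr (-2)) \<longlongrightarrow> 0) at_top"
      by (rule tendsto_neg_powr) (auto intro: filterlim_ident)
    from tendsto_mult_left[OF this, of "- pi * K"] show "((\<lambda>r. - pi * K * r powr (-2)) \<longlongrightarrow> 0) at_top"
      by simp
  qed (auto simp: K)
  also have "ennreal (2 * pi) * emeasure lborel {0..1::real} + ennreal (0 - (- pi * K * 1 powr (-2))) < \<infinity>"
    by (simp add: ennreal_mult_less_top)
  finally show "(\<integral>\<^sup>+z. norm (exp (- (c * norm (z :: real^2) powr \<alpha>))) \<partial>lborel) < \<infinity>" .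
qed simp

section \<open>Translation invariance, and the density of the closest point\<close>

lemma lborel_translate: "distr lborel borel (\<lambda>z. z - x :: 'a::euclidean_space) = lborel"
  using lborel_distr_plus[of "- x"] by (simp add: add.commute[of "- x"] cong: distr_cong)

lemma integrable_translate:
  fixes f :: "'a::euclidean_space \<Rightarrow> real"
  assumes "integrable lborel f"
  shows "integrable lborel (\<lambda>z. f (z - x))"
proof -
  have [measurable]: "f \<in> borel_measurable borel"
    using borel_measurable_integrable[OF assms] by simp
  have "integrable (distr lborel borel (\<lambda>z. z - x)) f" using assms by (simp add: lborel_translate)
  then show ?thesis by (subst (asm) integrable_distr_eq) auto
qed

lemma integral_translate:
  fixes f :: "'a::euclidean_space \<Rightarrow> real"
  assumes [measurable]: "f \<in> borel_measurable borel"
  shows "(\<integral>z. f (z - x) \<partial>lborel) = (\<integral>z. f z \<partial>lborel)"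
proof -
  have "(\<integral>z. f z \<partial>lborel) = (\<integral>z. f z \<partial>distr lborel borel (\<lambda>z. z - x))" by (simp add: lborel_translate)
  also have "\<dots> = (\<integral>z. f (z - x) \<partial>lborel)" by (subst integral_distr) auto
  finally show ?thesis by simp
qed

text \<open>Multiplied by \<open>lam\<close>, the integrand is the density of the position of the
  closest point, hence the value \<open>1 / lam\<close>. Its finiteness is the majorant condition
  \<open>fin\<close>, and its exact value excludes ties.\<close>

lemma nn_integral_nearest_density:
  assumes "0 < lam"
  shows "(\<integral>\<^sup>+x. ennreal (exp (- (lam * measure lborel (cball (0::real^2) (norm (x::real^2)))))) \<partial>lborel) = ennreal (1 / lam)"
proof -
  have "(\<integral>\<^sup>+x. ennreal (exp (- (lam * measure lborel (cball (0::real^2) (norm (x::real^2)))))) \<partial>lborel) =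
      (\<integral>\<^sup>+x. ennreal (exp (- (lam * (pi * (norm (x::real^2))\<^sup>2)))) \<partial>lborel)"
    by (simp add: content_cball unit_ball_vol_2)
  also have "\<dots> = (\<integral>\<^sup>+r. ennreal (2 * pi * r) * indicator {0..} r * ennreal (exp (- (lam * (pi * r\<^sup>2)))) \<partial>lborel)"
    by (rule nn_integral_radial) measurable
  also have "\<dots> = (\<integral>\<^sup>+r. ennreal (2 * pi * r * exp (- (lam * (pi * r\<^sup>2)))) * indicator {0..} r \<partial>lborel)"
    by (auto intro!: nn_integral_cong simp: ennreal_mult' split: split_indicator)
  also have "\<dots> = ennreal (0 - (- (1 / lam) * exp (- (lam * (pi * 0\<^sup>2)))))"
  proof (rule nn_integral_FTC_atLeast)
    show "((\<lambda>r. - (1 / lam) * exp (- (lam * (pi * r\<^sup>2)))) has_real_derivative 2 * pi * r * exp (- (lam * (pi * r\<^sup>2)))) (at r)" for r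
      using assms by (auto intro!: derivative_eq_intros simp: field_simps)
    have "filterlim (\<lambda>r::real. (lam * pi) * r\<^sup>2) at_top at_top"
      using assms by (intro filterlim_tendsto_pos_mult_at_top[OF tendsto_const] filterlim_pow_at_top filterlim_ident) auto
    then have "((\<lambda>r::real. exp (- (lam * (pi * r\<^sup>2)))) \<longlongrightarrow> 0) at_top"
      by (intro filterlim_compose[OF exp_at_bot]) (simp add: filterlim_uminus_at_top mult.assoc)
    from tendsto_mult_left[OF this, of "- (1 / lam)"]
    show "((\<lambda>r. - (1 / lam) * exp (- (lam * (pi * r\<^sup>2)))) \<longlongrightarrow> 0) at_top" by simp
  qed auto
  finally show ?thesis by simp
qed

subsection \<open>The tagged access point\<close>

text \<open>This is \<open>N2_W\<close> with all constants in the exponent gathered into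
  \<open>c\<close>.\<close>

definition neighbourhood_load :: "real \<Rightarrow> real \<Rightarrow> real \<Rightarrow> real \<Rightarrow> real" where
  "neighbourhood_load lam c \<alpha> r =
     lam * (\<integral>z. (if r < norm z then exp (- (c * norm (z - vector [r, 0] :: real^2) powr \<alpha>)) else 0) \<partial>lborel)"

text \<open>A form visibly linear in \<open>r\<close>, from which measurability in \<open>r\<close>
  is automatic.\<close>

lemma vector_as_scaleR: "(vector [r, 0] :: real^2) = r *\<^sub>R axis 1 1"
  by (simp add: vec_eq_iff forall_2 axis_def)

lemma norm_vector_2 [simp]: "norm (vector [r, 0] :: real^2) = \<bar>r\<bar>"
  by (simp add: norm_vec_def L2_set_def sum_2)

lemma integrable_load:
  assumes "0 < c" "0 < \<alpha>"
  shows "integrable lborel (\<lambda>z. if r < norm z then exp (- (c * norm (z - x :: real^2) powr \<alpha>)) else 0)"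
proof (rule Bochner_Integration.integrable_bound)
  show "integrable lborel (\<lambda>z. exp (- (c * norm (z - x :: real^2) powr \<alpha>)))"
    by (rule integrable_translate[OF integrable_exp_norm_powr[OF assms]])
qed auto

text \<open>The load will stand in a denominator. If it vanished, the integrand would be 0 almost
  everywhere, and the plane would be a disc up to a null set.\<close>

lemma neighbourhood_load_pos:
  assumes "0 < lam" "0 < c" "0 < \<alpha>"
  shows "0 < neighbourhood_load lam c \<alpha> r"
proof -
  let ?f = "\<lambda>z. if r < norm z then exp (- (c * norm (z - vector [r, 0] :: real^2) powr \<alpha>)) else 0"
  have "integral\<^sup>L lborel ?f \<noteq> 0"
  proof
    assume "integral\<^sup>L lborel ?f = 0"
    then have "AE z in lborel. ?f z = 0"
      using integral_nonneg_eq_0_iff_AE[OF integrable_load[OF assms(2,3)], of r "vector [r, 0]"] by auto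
    then have "AE z in lborel. z \<in> cball (0::real^2) r"
      by eventually_elim (auto split: if_splits)
    then have "emeasure lborel (UNIV :: (real^2) set) \<le> emeasure lborel (cball (0::real^2) r)"
      by (intro emeasure_mono_AE) auto
    with emeasure_bounded_finite[OF bounded_cball, of "0::real^2" r] show False
      by (simp add: emeasure_lborel_UNIV)
  qed
  moreover have "0 \<le> integral\<^sup>L lborel ?f" by (intro integral_nonneg_AE) auto
  ultimately have "0 < integral\<^sup>L lborel ?f" by linarith
  with assms(1) show ?thesis unfolding neighbourhood_load_def by (rule mult_pos_pos)
qed

lemma borel_measurable_neighbourhood_load [measurable]:
  "neighbourhood_load lam c \<alpha> \<in> borel_measurable borel"
proof -
  have "(\<lambda>(r, z). if r < norm z then exp (- (c * norm (z - vector [r, 0] :: real^2) powr \<alpha>)) else 0)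
      \<in> borel_measurable (borel \<Otimes>\<^sub>M lborel)"
    unfolding split_def vector_as_scaleR by measurable
  from lborel.borel_measurable_lebesgue_integral[OF this] show ?thesis
    unfolding neighbourhood_load_def[abs_def] by simp
qed

lemma neighbourhood_load_norm:
  "neighbourhood_load lam c \<alpha> (norm x) =
     lam * (\<integral>z. (if norm x < norm z then exp (- (c * norm (z - x :: real^2) powr \<alpha>)) else 0) \<partial>lborel)"
proof -
  have "(\<lambda>(a, b). if norm x < a then exp (- (c * b powr \<alpha>)) else (0::real)) \<in> borel_measurable (borel \<Otimes>\<^sub>M borel)"
    unfolding split_def by measurable
  from integral_rotate[OF this, of "vector [norm x, 0]" x] show ?thesis
    by (simp add: neighbourhood_load_def)
qed

text \<open>The disc, where the weight is 1, produces the exponent of \<open>f_W\<close>; the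
  exterior produces \<open>t\<close> times the load.\<close>

lemma integral_nearest_weight_exp:
  fixes x :: "real^2"
  assumes c: "0 < c" "0 < \<alpha>"
  shows "lam * (\<integral>z. nearest_weight (\<lambda>x z. t * exp (- (c * norm (z - x) powr \<alpha>))) x z \<partial>lborel) =
    lam * pi * (norm x)\<^sup>2 + t * neighbourhood_load lam c \<alpha> (norm x)"
proof -
  have "nearest_weight (\<lambda>x z. t * exp (- (c * norm (z - x) powr \<alpha>))) x z = indicator (cball 0 (norm x)) z +
      t * (if norm x < norm z then exp (- (c * norm (z - x) powr \<alpha>)) else 0)" for z
    by (auto simp: nearest_weight_def indicator_def)
  then have "(\<integral>z. nearest_weight (\<lambda>x z. t * exp (- (c * norm (z - x) powr \<alpha>))) x z \<partial>lborel) =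
      measure lborel (cball (0::real^2) (norm x)) +
      t * (\<integral>z. (if norm x < norm z then exp (- (c * norm (z - x) powr \<alpha>)) else 0) \<partial>lborel)"
    using integrable_load[OF c, of "norm x" x] by simp
  then show ?thesis
    by (simp add: neighbourhood_load_norm content_cball unit_ball_vol_2 power2_eq_square algebra_simps)
qed

text \<open>With weight 0 all factors are 0 or 1, and \<open>nearest_sum\<close> vanishes under a
  tie. The Mecke formula gives it the expectation \<open>lam * (1 / lam) = 1\<close>; being at most
  1, it must equal 1 almost surely.\<close>

lemma AE_strictly_nearest:
  fixes X :: "nat \<Rightarrow> 'w \<Rightarrow> real^2"
  assumes "poisson_process M lam X"
  shows "AE \<omega> in M. \<exists>k. \<forall>j. j \<noteq> k \<longrightarrow> norm (X k \<omega>) < norm (X j \<omega>)"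
proof -
  interpret poisson_process M lam X by fact
  let ?w = "\<lambda>(x::real^2) (z::real^2). 0 :: real"
  have fin: "(\<integral>\<^sup>+x. ennreal (exp (- (lam * measure lborel (cball (0::real^2) (norm (x::real^2)))))) \<partial>lborel) < \<infinity>"
    using lam_pos by (simp add: nn_integral_nearest_density)
  have [measurable]: "nearest_sum ?w \<in> borel_measurable M"
    by (rule measurable_nearest_sum) simp
  have weight: "(\<integral>z. nearest_weight ?w x z \<partial>lborel) = measure lborel (cball (0::real^2) (norm x))" for x
  proof -
    have "nearest_weight ?w x = indicator (cball 0 (norm x))"
      by (auto simp: nearest_weight_def fun_eq_iff indicator_def)
    then show ?thesis by simp
  qed
  have "(\<integral>\<^sup>+\<omega>. nearest_sum ?w \<omega> \<partial>M) = ennreal lam * ennreal (1 / lam)"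
    using nn_integral_nearest_sum[of ?w, OF _ _ _ _ _ fin] nn_integral_nearest_density[OF lam_pos]
    by (simp add: weight)
  then have one: "(\<integral>\<^sup>+\<omega>. nearest_sum ?w \<omega> \<partial>M) = 1"
    using lam_pos by (simp add: ennreal_mult[symmetric])
  have le_1: "AE \<omega> in M. nearest_sum ?w \<omega> \<le> 1"
    using AE_locally_finite
  proof eventually_elim
    case (elim \<omega>)
    obtain k where "\<forall>j. norm (X k \<omega>) \<le> norm (X j \<omega>)" using ex_nearest[OF elim] by auto
    then show ?case by (subst nearest_sum_eq[where k=k]) (auto simp: iprod_le_1)
  qed
  have "(\<integral>\<^sup>+\<omega>. 1 - nearest_sum ?w \<omega> \<partial>M) = (\<integral>\<^sup>+\<omega>. 1 \<partial>M) - (\<integral>\<^sup>+\<omega>. nearest_sum ?w \<omega> \<partial>M)"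
    using le_1 by (intro nn_integral_diff) (auto simp: one)
  then have "(\<integral>\<^sup>+\<omega>. 1 - nearest_sum ?w \<omega> \<partial>M) = 0"
    by (simp add: one emeasure_space_1)
  then have "AE \<omega> in M. 1 - nearest_sum ?w \<omega> = 0"
    by (subst (asm) nn_integral_0_iff_AE) auto
  with AE_locally_finite show ?thesis
  proof eventually_elim
    case (elim \<omega>)
    obtain k where k: "\<forall>j. norm (X k \<omega>) \<le> norm (X j \<omega>)" using ex_nearest[OF elim(1)] by auto
    have "norm (X k \<omega>) < norm (X j \<omega>)" if "j \<noteq> k" for j
    proof (rule ccontr)
      assume "\<not> norm (X k \<omega>) < norm (X j \<omega>)"
      with that have "nearest_sum ?w \<omega> = 0"
        by (subst nearest_sum_eq[OF _ _ k], simp, simp, intro iprod_eq_0[where k=j])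
          (auto simp: nearest_weight_def)
      with elim(2) show False by simp
    qed
    then show ?case by auto
  qed
qed

lemma tagged_eqI:
  assumes "\<And>j. j \<noteq> k \<Longrightarrow> norm (X k \<omega>) < norm (X j \<omega>)"
  shows "tagged X \<omega> = k"
  unfolding tagged_def
proof (rule Least_equality)
  show "\<forall>j. norm (X k \<omega>) \<le> norm (X j \<omega>)"
    using assms less_imp_le by (metis order_refl)
  fix i assume "\<forall>j. norm (X i \<omega>) \<le> norm (X j \<omega>)"
  then have "i = k" using assms[of i] by (metis not_le)
  then show "k \<le> i" by simp
qed

lemma measurable_tagged [measurable]:
  assumes [measurable]: "\<And>i. X i \<in> borel_measurable M"
  shows "tagged X \<in> M \<rightarrow>\<^sub>M count_space UNIV"
  unfolding tagged_def[abs_def] by measurable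

text \<open>The value \<open>0\<close> for coinciding points reflects \<open>l 0 = 0\<close> and \<open>G / 0 = 0\<close>: such an interferer is never heard.\<close>

definition exceedance :: "real \<Rightarrow> real \<Rightarrow> 'a::real_normed_vector \<Rightarrow> 'a \<Rightarrow> real" where
  "exceedance c \<alpha> x z = (if z = x then 0 else exp (- (c * norm (z - x) powr \<alpha>)))"

text \<open>Almost surely the tagged point is strictly closest, hence distinct from all others. For
  those \<open>exceedance\<close> is the plain exponential and \<open>nearest_weight\<close> is in
  its outer case, so the product is the surviving term of \<open>nearest_sum\<close>.\<close>

lemma nn_integral_tagged:
  fixes X :: "nat \<Rightarrow> 'w \<Rightarrow> real^2"
  assumes "poisson_process M lam X" and c: "0 < c" "0 < \<alpha>" and t: "0 \<le> t" "t \<le> 1"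
  shows "(\<integral>\<^sup>+\<omega>. iprod (\<lambda>j. if j = tagged X \<omega> then 1 else 1 - t * exceedance c \<alpha> (X (tagged X \<omega>) \<omega>) (X j \<omega>)) \<partial>M) =
    ennreal lam * (\<integral>\<^sup>+x. ennreal (exp (- (lam * pi * (norm (x::real^2))\<^sup>2 + t * neighbourhood_load lam c \<alpha> (norm x)))) \<partial>lborel)"
proof -
  interpret poisson_process M lam X by fact
  let ?w = "\<lambda>(x::real^2) (z::real^2). t * exp (- (c * norm (z - x) powr \<alpha>))"
  have w01: "0 \<le> ?w x z" "?w x z \<le> 1" for x z
    using t c mult_mono[of t 1 "exp (- (c * norm (z - x) powr \<alpha>))" 1] by auto
  have fin: "(\<integral>\<^sup>+x. ennreal (exp (- (lam * measure lborel (cball (0::real^2) (norm (x::real^2)))))) \<partial>lborel) < \<infinity>"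
    using lam_pos by (simp add: nn_integral_nearest_density)
  have "(\<integral>\<^sup>+\<omega>. iprod (\<lambda>j. if j = tagged X \<omega> then 1 else 1 - t * exceedance c \<alpha> (X (tagged X \<omega>) \<omega>) (X j \<omega>)) \<partial>M) =
      (\<integral>\<^sup>+\<omega>. nearest_sum ?w \<omega> \<partial>M)"
  proof (rule nn_integral_cong_AE)
    from AE_strictly_nearest[OF assms(1)]
    show "AE \<omega> in M. iprod (\<lambda>j. if j = tagged X \<omega> then 1
        else 1 - t * exceedance c \<alpha> (X (tagged X \<omega>) \<omega>) (X j \<omega>)) = nearest_sum ?w \<omega>"
    proof eventually_elim
      case (elim \<omega>)
      then obtain k where k: "\<And>j. j \<noteq> k \<Longrightarrow> norm (X k \<omega>) < norm (X j \<omega>)" by auto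
      have tagged_k: "tagged X \<omega> = k"
        by (rule tagged_eqI) (rule k)
      have nearest: "\<forall>j. norm (X k \<omega>) \<le> norm (X j \<omega>)"
        using k less_imp_le by (metis order_refl)
      have "1 - t * exceedance c \<alpha> (X k \<omega>) (X j \<omega>) = 1 - nearest_weight ?w (X k \<omega>) (X j \<omega>)" if "j \<noteq> k" for j
        using k[OF that] by (auto simp: nearest_weight_def exceedance_def)
      then show ?case
        unfolding nearest_sum_eq[OF w01 nearest] tagged_k by (intro arg_cong[where f=iprod]) auto
    qed
  qed
  also have "\<dots> = ennreal lam * (\<integral>\<^sup>+x. ennreal (exp (- (lam * (\<integral>z. nearest_weight ?w x z \<partial>lborel)))) \<partial>lborel)"
  proof (rule nn_integral_nearest_sum[OF _ w01 _ _ fin])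
    show "(\<lambda>(x, z). ?w x z) \<in> borel_measurable (borel \<Otimes>\<^sub>M borel)"
      unfolding split_def by measurable
    show "integrable lborel (?w x)" for x
      by (intro integrable_mult_right integrable_translate[OF integrable_exp_norm_powr[OF c]])
    show "isCont (\<lambda>x. ?w x z) x" if "norm x < norm z" for x z
      using that by (intro continuous_intros) auto
  qed
  finally show ?thesis
    by (simp only: integral_nearest_weight_exp[OF c])
qed

text \<open>Averaging over a uniform timer is the origin of the fraction in the final
  formula.\<close>

lemma nn_integral_exp_unit_interval:
  assumes "0 < N"
  shows "(\<integral>\<^sup>+t. ennreal (exp (- (t * N))) * indicator {0..1} t \<partial>lborel) = ennreal ((1 - exp (- N)) / N)"
proof -
  have "(\<integral>\<^sup>+t. ennreal (exp (- (t * N))) * indicator {0..1} t \<partial>lborel) =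
      ennreal (- exp (- (1 * N)) / N - - exp (- (0 * N)) / N)"
    using assms by (intro nn_integral_FTC_Icc) (auto intro!: derivative_eq_intros)
  then show ?thesis by (simp add: diff_divide_distrib)
qed

text \<open>The Mecke formula holds for one \<open>t\<close> at a time, so Fubini is used twice: to
  bring the expectation inside the timer integral, and afterwards to integrate out \<open>t\<close>
  at a fixed position. The Jacobian \<open>2 * pi * r\<close> completes
  \<open>lam * exp (- (lam * pi * r^2))\<close> to \<open>f_W\<close>.\<close>

theorem nn_integral_tagged_timer:
  fixes X :: "nat \<Rightarrow> 'w \<Rightarrow> real^2"
  assumes "poisson_process M lam X" and c: "0 < c" "0 < \<alpha>"
  shows "(\<integral>\<^sup>+\<omega>. \<integral>\<^sup>+t. iprod (\<lambda>j. if j = tagged X \<omega> then 1 else 1 - t * exceedance c \<alpha> (X (tagged X \<omega>) \<omega>) (X j \<omega>))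
      * indicator {0..1} t \<partial>lborel \<partial>M) =
    (\<integral>\<^sup>+r. ennreal ((1 - exp (- neighbourhood_load lam c \<alpha> r)) / neighbourhood_load lam c \<alpha> r * f_W lam r)
      * indicator {0..} r \<partial>lborel)"
proof -
  interpret poisson_process M lam X by fact
  interpret pair_sigma_finite M lborel ..
  let ?N = "neighbourhood_load lam c \<alpha>"
  \<comment> \<open>The value 0 at the tagged index absorbs the case distinction: every factor takes
    the form \<open>1 - t * e j \<omega>\<close>, which is jointly measurable.\<close>
  define e where "e j \<omega> = (if j = tagged X \<omega> then 0 else exceedance c \<alpha> (X (tagged X \<omega>) \<omega>) (X j \<omega>))" for j \<omega>
  \<comment> \<open>The tagged index is random but has countably many values, so it suffices to
    check each fixed index.\<close>
  have [measurable]: "e j \<in> borel_measurable M" for j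
    unfolding e_def
  proof (rule measurable_compose_countable[where g="tagged X" and
        f="\<lambda>i \<omega>. if j = i then 0 else exceedance c \<alpha> (X i \<omega>) (X j \<omega>)"])
    show "(\<lambda>\<omega>. if j = i then 0 else exceedance c \<alpha> (X i \<omega>) (X j \<omega>)) \<in> borel_measurable M" for i
      unfolding exceedance_def by measurable
    show "tagged X \<in> M \<rightarrow>\<^sub>M count_space UNIV"
      by (rule measurable_tagged) measurable
  qed
  let ?i = "\<lambda>\<omega> t. iprod (\<lambda>j. 1 - t * e j \<omega>)"
  have i_eq: "iprod (\<lambda>j. if j = tagged X \<omega> then 1 else 1 - t * exceedance c \<alpha> (X (tagged X \<omega>) \<omega>) (X j \<omega>)) = ?i \<omega> t"
    for \<omega> t by (rule arg_cong[where f=iprod]) (auto simp: e_def)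
  have "(\<integral>\<^sup>+\<omega>. \<integral>\<^sup>+t. ?i \<omega> t * indicator {0..1} t \<partial>lborel \<partial>M) = (\<integral>\<^sup>+t. \<integral>\<^sup>+\<omega>. ?i \<omega> t * indicator {0..1} t \<partial>M \<partial>lborel)"
    by (rule Fubini'[symmetric]) measurable
  also have "\<dots> = (\<integral>\<^sup>+t. ennreal lam * (\<integral>\<^sup>+x. ennreal (exp (- (lam * pi * (norm (x::real^2))\<^sup>2 + t * ?N (norm x))))
      * indicator {0..1} t \<partial>lborel) \<partial>lborel)"
  proof (rule nn_integral_cong)
    fix t :: real
    show "(\<integral>\<^sup>+\<omega>. ?i \<omega> t * indicator {0..1} t \<partial>M) =
      ennreal lam * (\<integral>\<^sup>+x. ennreal (exp (- (lam * pi * (norm (x::real^2))\<^sup>2 + t * ?N (norm x)))) * indicator {0..1} t \<partial>lborel)"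
      using nn_integral_tagged[OF assms(1) c, of t, unfolded i_eq] by (cases "t \<in> {0..1}") auto
  qed
  also have "\<dots> = (\<integral>\<^sup>+t. \<integral>\<^sup>+x. ennreal lam * (ennreal (exp (- (lam * pi * (norm (x::real^2))\<^sup>2 + t * ?N (norm x))))
      * indicator {0..1} t) \<partial>lborel \<partial>lborel)"
    by (intro nn_integral_cong nn_integral_cmult[symmetric]) measurable
  also have "\<dots> = (\<integral>\<^sup>+x. \<integral>\<^sup>+t. ennreal lam * (ennreal (exp (- (lam * pi * (norm (x::real^2))\<^sup>2 + t * ?N (norm x))))
      * indicator {0..1} t) \<partial>lborel \<partial>lborel)"
    by (rule lborel_pair.Fubini') measurable
  also have "\<dots> = (\<integral>\<^sup>+x. ennreal (lam * exp (- (lam * pi * (norm (x::real^2))\<^sup>2)) * ((1 - exp (- ?N (norm x))) / ?N (norm x))) \<partial>lborel)"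
  proof (rule nn_integral_cong)
    fix x :: "real^2"
    have "(\<integral>\<^sup>+t. ennreal lam * (ennreal (exp (- (lam * pi * (norm x)\<^sup>2 + t * ?N (norm x)))) * indicator {0..1} t) \<partial>lborel) =
        (\<integral>\<^sup>+t. ennreal (lam * exp (- (lam * pi * (norm x)\<^sup>2))) * (ennreal (exp (- (t * ?N (norm x)))) * indicator {0..1} t) \<partial>lborel)"
    proof (rule nn_integral_cong)
      fix t
      have e: "exp (- (lam * pi * (norm x)\<^sup>2 + t * ?N (norm x))) =
          exp (- (lam * pi * (norm x)\<^sup>2)) * exp (- (t * ?N (norm x)))"
        by (simp add: mult_exp_exp)
      show "ennreal lam * (ennreal (exp (- (lam * pi * (norm x)\<^sup>2 + t * ?N (norm x)))) * indicator {0..1} t) =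
          ennreal (lam * exp (- (lam * pi * (norm x)\<^sup>2))) * (ennreal (exp (- (t * ?N (norm x)))) * indicator {0..1} t)"
        unfolding e using lam_pos by (simp add: ennreal_mult mult.assoc)
    qed
    also have "\<dots> = ennreal (lam * exp (- (lam * pi * (norm x)\<^sup>2))) * ennreal ((1 - exp (- ?N (norm x))) / ?N (norm x))"
      using lam_pos c by (subst nn_integral_cmult) (auto simp: nn_integral_exp_unit_interval neighbourhood_load_pos)
    finally show "(\<integral>\<^sup>+t. ennreal lam * (ennreal (exp (- (lam * pi * (norm x)\<^sup>2 + t * ?N (norm x)))) * indicator {0..1} t) \<partial>lborel) =
        ennreal (lam * exp (- (lam * pi * (norm x)\<^sup>2)) * ((1 - exp (- ?N (norm x))) / ?N (norm x)))"
      using lam_pos by (simp add: ennreal_mult'[symmetric])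
  qed
  also have "\<dots> = (\<integral>\<^sup>+r. ennreal (2 * pi * r) * indicator {0..} r *
      ennreal (lam * exp (- (lam * pi * r\<^sup>2)) * ((1 - exp (- ?N r)) / ?N r)) \<partial>lborel)"
    by (rule nn_integral_radial) measurable
  also have "\<dots> = (\<integral>\<^sup>+r. ennreal ((1 - exp (- ?N r)) / ?N r * f_W lam r) * indicator {0..} r \<partial>lborel)"
  proof (rule nn_integral_cong)
    fix r :: real
    show "ennreal (2 * pi * r) * indicator {0..} r * ennreal (lam * exp (- (lam * pi * r\<^sup>2)) * ((1 - exp (- ?N r)) / ?N r)) =
        ennreal ((1 - exp (- ?N r)) / ?N r * f_W lam r) * indicator {0..} r"
      by (auto simp: f_W_def ennreal_mult'[symmetric] ac_simps split: split_indicator)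
  qed
  finally show ?thesis unfolding i_eq .
qed

subsection \<open>Consequences of mutual independence\<close>

lemma (in prob_space) distr_pair_indep:
  assumes U [measurable]: "U \<in> M \<rightarrow>\<^sub>M N1" and V [measurable]: "V \<in> M \<rightarrow>\<^sub>M N2"
    and ind: "\<And>A B. A \<in> sets N1 \<Longrightarrow> B \<in> sets N2 \<Longrightarrow>
      prob ((U -` A \<inter> space M) \<inter> (V -` B \<inter> space M)) = prob (U -` A \<inter> space M) * prob (V -` B \<inter> space M)"
  shows "distr M N1 U \<Otimes>\<^sub>M distr M N2 V = distr M (N1 \<Otimes>\<^sub>M N2) (\<lambda>x. (U x, V x))"
proof (rule pair_measure_eqI)
  show "sigma_finite_measure (distr M N1 U)" "sigma_finite_measure (distr M N2 V)"
    using prob_space_distr[OF U] prob_space_distr[OF V] by (auto intro: prob_space_imp_sigma_finite)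
  fix A B assume "A \<in> sets (distr M N1 U)" "B \<in> sets (distr M N2 V)"
  then have [measurable]: "A \<in> sets N1" "B \<in> sets N2" by auto
  have "(\<lambda>x. (U x, V x)) -` (A \<times> B) \<inter> space M = (U -` A \<inter> space M) \<inter> (V -` B \<inter> space M)" by auto
  then show "emeasure (distr M N1 U) A * emeasure (distr M N2 V) B =
      emeasure (distr M (N1 \<Otimes>\<^sub>M N2) (\<lambda>x. (U x, V x))) (A \<times> B)"
    by (simp add: emeasure_distr emeasure_eq_measure ind ennreal_mult)
qed simp

text \<open>A single family indexed by \<open>source\<close> lets one \<open>indep_vars\<close>
  statement cover timers and both kinds of fading. The constant 0 at the position sources is a
  filler that keeps every member measurable.\<close>

definition mark :: "(nat \<Rightarrow> 'w \<Rightarrow> real) \<Rightarrow> (nat \<Rightarrow> nat \<Rightarrow> 'w \<Rightarrow> real) \<Rightarrow> (nat \<Rightarrow> nat \<Rightarrow> 'w \<Rightarrow> real) \<Rightarrow>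
    source \<Rightarrow> 'w \<Rightarrow> real" where
  "mark T GW GLW s = (case s of Timer i \<Rightarrow> T i | Fading_W j i \<Rightarrow> GW j i | Fading_LW k i \<Rightarrow> GLW k i | _ \<Rightarrow> \<lambda>_. 0)"

lemma mark_simps [simp]:
  "mark T GW GLW (Timer i) = T i" "mark T GW GLW (Fading_W j i) = GW j i"
  "mark T GW GLW (Fading_LW k i) = GLW k i"
  by (simp_all add: mark_def)

locale marked_network = prob_space M for M :: "'w measure" +
  fixes X Y :: "nat \<Rightarrow> 'w \<Rightarrow> real^2" and T :: "nat \<Rightarrow> 'w \<Rightarrow> real" and GW GLW :: "nat \<Rightarrow> nat \<Rightarrow> 'w \<Rightarrow> real"
  assumes indep: "mutually_independent M X Y T GW GLW"
    and X_meas [measurable]: "\<And>i. X i \<in> borel_measurable M" and Y_meas [measurable]: "\<And>k. Y k \<in> borel_measurable M"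
    and T_meas [measurable]: "\<And>i. T i \<in> borel_measurable M" and GW_meas [measurable]: "\<And>j i. GW j i \<in> borel_measurable M"
    and GLW_meas [measurable]: "\<And>k i. GLW k i \<in> borel_measurable M"
begin

abbreviation "config \<equiv> (\<Pi>\<^sub>M i\<in>(UNIV :: nat set). (borel :: (real^2) measure))"
abbreviation "mark_space \<equiv> (\<Pi>\<^sub>M s\<in>marks. (borel :: real measure))"
abbreviation "XS \<equiv> \<lambda>\<omega> i. X i \<omega>"
abbreviation "YS \<equiv> \<lambda>\<omega> k. Y k \<omega>"
abbreviation "V \<equiv> mark T GW GLW"
abbreviation "VS \<equiv> \<lambda>\<omega>. restrict (\<lambda>s. V s \<omega>) marks"

text \<open>The sigma algebras of \<open>mutually_independent\<close> as explicit families of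
  preimages, for which stability under intersection is immediate.\<close>

definition source_events :: "source \<Rightarrow> 'w set set" where
  "source_events s = (case s of
      APs \<Rightarrow> {XS -` A \<inter> space M | A. A \<in> sets config}
    | ENBs \<Rightarrow> {YS -` A \<inter> space M | A. A \<in> sets config}
    | _ \<Rightarrow> {V s -` A \<inter> space M | A. A \<in> sets borel})"

lemma XS_meas [measurable]: "XS \<in> M \<rightarrow>\<^sub>M config" and YS_meas [measurable]: "YS \<in> M \<rightarrow>\<^sub>M config"
  by (auto intro!: measurable_PiM_single')

lemma V_meas [measurable]: "V s \<in> borel_measurable M"
  by (cases s) (auto simp: mark_def)

lemma VS_meas [measurable]: "VS \<in> M \<rightarrow>\<^sub>M mark_space"
  by (rule measurable_restrict) simp

lemma indep_source_events: "indep_sets source_events UNIV"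
proof -
  have "(\<lambda>s. case s of
          APs \<Rightarrow> sets (vimage_algebra (space M) (\<lambda>\<omega> i. X i \<omega>) (\<Pi>\<^sub>M i\<in>UNIV. borel))
        | ENBs \<Rightarrow> sets (vimage_algebra (space M) (\<lambda>\<omega> k. Y k \<omega>) (\<Pi>\<^sub>M k\<in>UNIV. borel))
        | Timer i \<Rightarrow> sets (vimage_algebra (space M) (T i) borel)
        | Fading_W j i \<Rightarrow> sets (vimage_algebra (space M) (GW j i) borel)
        | Fading_LW k i \<Rightarrow> sets (vimage_algebra (space M) (GLW k i) borel)) = source_events"
    by (rule ext) (auto simp: source_events_def sets_vimage_algebra2 space_PiM split: source.splits)
  with indep show ?thesis
    unfolding mutually_independent_def by simp
qed

lemma indep_marks: "indep_vars (\<lambda>_. borel) V marks"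
  unfolding indep_vars_def2
proof
  have "indep_sets source_events marks"
    by (rule indep_sets_mono_index[OF _ indep_source_events]) auto
  moreover have "source_events s = {V s -` A \<inter> space M | A. A \<in> sets borel}" if "s \<in> marks" for s
    using that by (cases s) (auto simp: source_events_def)
  ultimately show "indep_sets (\<lambda>s. {V s -` A \<inter> space M | A. A \<in> sets borel}) marks"
    by (subst (asm) indep_sets_cong[OF refl]) auto
qed simp

lemma distr_positions: "distr M config XS \<Otimes>\<^sub>M distr M config YS = distr M (config \<Otimes>\<^sub>M config) (\<lambda>\<omega>. (XS \<omega>, YS \<omega>))"
proof (rule distr_pair_indep[OF XS_meas YS_meas])
  fix A B assume "A \<in> sets config" "B \<in> sets config"
  then have "prob (\<Inter>s\<in>{APs, ENBs}. case s of APs \<Rightarrow> XS -` A \<inter> space M | _ \<Rightarrow> YS -` B \<inter> space M) =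
      (\<Prod>s\<in>{APs, ENBs}. prob (case s of APs \<Rightarrow> XS -` A \<inter> space M | _ \<Rightarrow> YS -` B \<inter> space M))"
    by (intro indep_setsD[OF indep_source_events]) (auto simp: source_events_def)
  then show "prob ((XS -` A \<inter> space M) \<inter> (YS -` B \<inter> space M)) = prob (XS -` A \<inter> space M) * prob (YS -` B \<inter> space M)"
    by simp
qed

text \<open>Independence of single sources is lifted to independence of two groups of sources: sigma
  algebras generated by disjoint groups of independent, intersection-stable families are
  independent.\<close>

lemma distr_positions_marks:
  "distr M (config \<Otimes>\<^sub>M config) (\<lambda>\<omega>. (XS \<omega>, YS \<omega>)) \<Otimes>\<^sub>M distr M mark_space VS =
    distr M ((config \<Otimes>\<^sub>M config) \<Otimes>\<^sub>M mark_space) (\<lambda>\<omega>. ((XS \<omega>, YS \<omega>), VS \<omega>))"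
proof (rule distr_pair_indep)
  define G where "G b = (if b then {APs, ENBs} else marks)" for b
  let ?\<sigma> = "\<lambda>b. sigma_sets (space M) (\<Union>s\<in>G b. source_events s)"
  have sub: "(\<Union>s\<in>S. source_events s) \<subseteq> Pow (space M)" for S
    by (auto simp: source_events_def split: source.splits)
  have ind: "indep_sets ?\<sigma> UNIV"
  proof (rule indep_sets_collect_sigma)
    show "indep_sets source_events (\<Union>b\<in>UNIV. G b)"
      by (rule indep_sets_mono_index[OF _ indep_source_events]) auto
    show "Int_stable (source_events s)" for s
    proof (rule Int_stableI)
      have *: "\<exists>C. (f -` A \<inter> space M) \<inter> (f -` B \<inter> space M) = f -` C \<inter> space M \<and> C \<in> sets N"
        if "A \<in> sets N" "B \<in> sets N" for A B and f :: "'w \<Rightarrow> 'c" and N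
        using that by (intro exI[of _ "A \<inter> B"]) auto
      fix a b assume "a \<in> source_events s" "b \<in> source_events s"
      then show "a \<inter> b \<in> source_events s"
        by (cases s) (auto simp: source_events_def intro!: *)
    qed
    show "disjoint_family_on G UNIV"
      by (auto simp: disjoint_family_on_def G_def)
  qed
  let ?S = "\<lambda>b. sigma (space M) (\<Union>s\<in>G b. source_events s)"
  have S: "sets (?S b) = ?\<sigma> b" "space (?S b) = space M" for b
    using sub by (auto simp: space_measure_of_conv)
  \<comment> \<open>Events about all marks jointly belong to no single source. Measurability with
    respect to the sigma algebra of the group, and not just of \<open>M\<close>, is what makes the
    grouped independence applicable.\<close>
  have gen: "f \<in> ?S b \<rightarrow>\<^sub>M N" if "f \<in> M \<rightarrow>\<^sub>M N" "{f -` A \<inter> space M | A. A \<in> sets N} = source_events s" "s \<in> G b"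
    for f :: "'w \<Rightarrow> 'c" and N s b
  proof (rule measurableI)
    show "f x \<in> space N" if "x \<in> space (?S b)" for x
      using that measurable_space[OF \<open>f \<in> M \<rightarrow>\<^sub>M N\<close>] by (simp add: S)
    fix A assume "A \<in> sets N"
    then have "f -` A \<inter> space M \<in> source_events s" using that(2) by auto
    then show "f -` A \<inter> space (?S b) \<in> sets (?S b)"
      using that(3) by (auto simp: S intro!: sigma_sets.Basic)
  qed
  have APs_G: "APs \<in> G True" and ENBs_G: "ENBs \<in> G True" by (auto simp: G_def)
  have pos: "(\<lambda>\<omega>. (XS \<omega>, YS \<omega>)) \<in> ?S True \<rightarrow>\<^sub>M config \<Otimes>\<^sub>M config"
    by (intro measurable_Pair gen[OF _ _ APs_G] gen[OF _ _ ENBs_G]) (auto simp: source_events_def G_def)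
  have mrk: "VS \<in> ?S False \<rightarrow>\<^sub>M mark_space"
  proof (rule measurable_restrict)
    fix s assume "s \<in> marks"
    then have s_G: "s \<in> G False" by (simp add: G_def)
    with \<open>s \<in> marks\<close> show "(\<lambda>\<omega>. V s \<omega>) \<in> ?S False \<rightarrow>\<^sub>M borel"
      by (intro gen[OF _ _ s_G]) (auto simp: source_events_def G_def split: source.splits)
  qed
  fix A B assume "A \<in> sets (config \<Otimes>\<^sub>M config)" "B \<in> sets mark_space"
  then have "(\<lambda>\<omega>. (XS \<omega>, YS \<omega>)) -` A \<inter> space M \<in> ?\<sigma> True" "VS -` B \<inter> space M \<in> ?\<sigma> False"
    using measurable_sets[OF pos] measurable_sets[OF mrk] by (auto simp only: S)
  then have "prob (\<Inter>b\<in>UNIV. if b then (\<lambda>\<omega>. (XS \<omega>, YS \<omega>)) -` A \<inter> space M else VS -` B \<inter> space M) =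
      (\<Prod>b\<in>UNIV. prob (if b then (\<lambda>\<omega>. (XS \<omega>, YS \<omega>)) -` A \<inter> space M else VS -` B \<inter> space M))"
    by (intro indep_setsD[OF ind]) auto
  then show "prob (((\<lambda>\<omega>. (XS \<omega>, YS \<omega>)) -` A \<inter> space M) \<inter> (VS -` B \<inter> space M)) =
      prob ((\<lambda>\<omega>. (XS \<omega>, YS \<omega>)) -` A \<inter> space M) * prob (VS -` B \<inter> space M)"
    by (simp add: UNIV_bool Int_commute mult.commute)
qed measurable

end

subsection \<open>The medium access probability\<close>

text \<open>The partial products are all 1, or they are 0 from the first failing index
  onwards.\<close>

lemma lim_prod_of_bool:
  "lim (\<lambda>n. \<Prod>j\<in>{..<n} - S. of_bool (P j) :: real) = of_bool (\<forall>j. j \<notin> S \<longrightarrow> P j)"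
proof (rule limI, cases "\<forall>j. j \<notin> S \<longrightarrow> P j")
  case True
  then show "(\<lambda>n. \<Prod>j\<in>{..<n} - S. of_bool (P j) :: real) \<longlonglongrightarrow> of_bool (\<forall>j. j \<notin> S \<longrightarrow> P j)"
    by simp
next
  case False
  then obtain j where j: "j \<notin> S" "\<not> P j" by auto
  have "(\<Prod>j\<in>{..<n} - S. of_bool (P j) :: real) = of_bool (\<forall>j. j \<notin> S \<longrightarrow> P j)" if "Suc j \<le> n" for n
    using j that by (subst prod_zero) auto
  then show "(\<lambda>n. \<Prod>j\<in>{..<n} - S. of_bool (P j) :: real) \<longlonglongrightarrow> of_bool (\<forall>j. j \<notin> S \<longrightarrow> P j)"
    by (intro tendsto_eventually eventually_sequentiallyI)
qed

lemma medium_access_eq_1_iff: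
  "medium_access l PW PL \<Gamma>cs \<Gamma>ed X Y T GW GLW i \<omega> = 1 \<longleftrightarrow>
    (\<forall>k. GLW k i \<omega> / l (norm (Y k \<omega> - X i \<omega>)) \<le> \<Gamma>ed / PL) \<and>
    (\<forall>j. j \<noteq> i \<longrightarrow> T i \<omega> \<le> T j \<omega> \<or> GW j i \<omega> / l (norm (X j \<omega> - X i \<omega>)) \<le> \<Gamma>cs / PW)"
proof -
  \<comment> \<open>The two timer cases exclude each other, so the sum is the indicator of a
    disjunction.\<close>
  have "of_bool (T j \<omega> \<ge> T i \<omega>) + of_bool (T j \<omega> < T i \<omega>) * of_bool (GW j i \<omega> / l (norm (X j \<omega> - X i \<omega>)) \<le> \<Gamma>cs / PW) =
      (of_bool (T i \<omega> \<le> T j \<omega> \<or> GW j i \<omega> / l (norm (X j \<omega> - X i \<omega>)) \<le> \<Gamma>cs / PW) :: real)" for j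
    by auto
  note eq = this
  have "lim (\<lambda>n. \<Prod>k<n. of_bool (GLW k i \<omega> / l (norm (Y k \<omega> - X i \<omega>)) \<le> \<Gamma>ed / PL) :: real) =
      of_bool (\<forall>k. GLW k i \<omega> / l (norm (Y k \<omega> - X i \<omega>)) \<le> \<Gamma>ed / PL)"
    using lim_prod_of_bool[where S="{}" and P="\<lambda>k. GLW k i \<omega> / l (norm (Y k \<omega> - X i \<omega>)) \<le> \<Gamma>ed / PL"] by simp
  then show ?thesis
    unfolding medium_access_def eq lim_prod_of_bool by simp
qed

lemma (in prob_space) prob_fading_le:
  assumes G: "distributed M lborel G (exponential_density \<mu>)" and "0 < \<mu>" "0 \<le> s" "0 < K"
  shows "prob {\<omega>\<in>space M. G \<omega> / (K * norm (z - x) powr \<alpha>) \<le> s} = 1 - exceedance (\<mu> * s * K) \<alpha> x z"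
proof (cases "z = x")
  case True
  \<comment> \<open>Through division by 0 the condition reads \<open>0 \<le> s\<close> and holds
    surely.\<close>
  then show ?thesis using assms by (simp add: exceedance_def prob_space)
next
  case False
  then have pos: "0 < K * norm (z - x) powr \<alpha>" using assms by simp
  have "{\<omega>\<in>space M. G \<omega> / (K * norm (z - x) powr \<alpha>) \<le> s} = {\<omega>\<in>space M. G \<omega> \<le> s * (K * norm (z - x) powr \<alpha>)}"
    using pos by (simp add: pos_divide_le_eq)
  also have "prob \<dots> = 1 - exp (- (s * (K * norm (z - x) powr \<alpha>)) * \<mu>)"
    using assms pos by (intro exponential_distributedD_le[OF G]) auto
  finally show ?thesis
    using False by (simp add: exceedance_def mult_ac)
qed

lemma exceedance_bounds: "0 \<le> exceedance c \<alpha> x z" "0 \<le> c \<Longrightarrow> exceedance c \<alpha> x z \<le> 1"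
  by (auto simp: exceedance_def)

text \<open>The exceptional point \<open>z = x\<close> is a null set, and translation removes the
  centre. This is why the eNB factor does not depend on the position of the tagged AP.\<close>

lemma exceedance_integral:
  fixes x :: "real^2"
  assumes "0 < c" "0 < \<alpha>"
  shows "integrable lborel (exceedance c \<alpha> x)"
    and "(\<integral>z. exceedance c \<alpha> x z \<partial>lborel) = (\<integral>z. exp (- (c * norm (z :: real^2) powr \<alpha>)) \<partial>lborel)"
proof -
  have AE: "AE z in lborel. exp (- (c * norm (z - x) powr \<alpha>)) = exceedance c \<alpha> x z"
    using AE_lborel_singleton[of x] by eventually_elim (auto simp: exceedance_def)
  have [measurable]: "exceedance c \<alpha> x \<in> borel_measurable borel"
    unfolding exceedance_def[abs_def] by measurable
  show "integrable lborel (exceedance c \<alpha> x)"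
    by (rule Bochner_Integration.integrable_cong_AE[THEN iffD1, OF _ _ AE
        integrable_translate[OF integrable_exp_norm_powr[OF assms]]]) auto
  have "(\<integral>z. exceedance c \<alpha> x z \<partial>lborel) = (\<integral>z. exp (- (c * norm (z - x) powr \<alpha>)) \<partial>lborel)"
    using AE by (intro integral_cong_AE) auto
  then show "(\<integral>z. exceedance c \<alpha> x z \<partial>lborel) = (\<integral>z. exp (- (c * norm (z :: real^2) powr \<alpha>)) \<partial>lborel)"
    by (subst (asm) integral_translate[of "\<lambda>z::real^2. exp (- (c * norm z powr \<alpha>))" x]) auto
qed

theorem corollary1:
  fixes M :: "'w measure"
    and X Y :: "nat \<Rightarrow> 'w \<Rightarrow> real^2"
    and T :: "nat \<Rightarrow> 'w \<Rightarrow> real"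
    and GW GLW :: "nat \<Rightarrow> nat \<Rightarrow> 'w \<Rightarrow> real"
    and lamW lamL PW PL lamc \<alpha> \<Gamma>cs \<Gamma>ed \<mu> :: real
    and l :: "real \<Rightarrow> real"
  assumes "prob_space M"
    and "lamW > 0" and "lamL > 0" and "PW > 0" and "PL > 0"
    and "lamc > 0" and "\<alpha> > 0" and "\<Gamma>cs > 0" and "\<Gamma>ed > 0" and "\<mu> > 0"
    and "l = path_loss lamc \<alpha>"
    and "poisson_point_process M lamW X"
    and "poisson_point_process M lamL Y"
    and "\<And>i. T i \<in> borel_measurable M"
    and "\<And>i. distr M borel (T i) = uniform_measure lborel {0..1}"
    and "\<And>j i. distributed M lborel (GW j i) (exponential_density \<mu>)"
    and "\<And>k i. distributed M lborel (GLW k i) (exponential_density \<mu>)"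
    and "mutually_independent M X Y T GW GLW"
  shows "tagged_MAP M l PW PL \<Gamma>cs \<Gamma>ed X Y T GW GLW =
    (LINT r:{0..}|lborel.
       (1 - exp (- N2_W l lamW PW \<Gamma>cs \<mu> r)) / N2_W l lamW PW \<Gamma>cs \<mu> r *
       exp (- N_L l lamL PL \<Gamma>ed \<mu>) * f_W lamW r)"
proof -
  have W: "poisson_process M lamW X" and L: "poisson_process M lamL Y"
    using assms by (auto simp: poisson_process_def poisson_process_axioms_def)
  interpret prob_space M by fact
  have X_meas: "X i \<in> borel_measurable M" and Y_meas: "Y i \<in> borel_measurable M" for i
    using assms(12,13) by (auto simp: poisson_point_process_def)
  interpret marked_network M X Y T GW GLW
    using assms X_meas Y_meas distributed_measurable[OF assms(16)] distributed_measurable[OF assms(17)]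
    by unfold_locales auto
  interpret L: poisson_process M lamL Y by fact
  define K where "K = (4 * pi / lamc)\<^sup>2"
  have K: "0 < K" using assms(6) by (simp add: K_def)
  have l: "l d = K * d powr \<alpha>" for d by (simp add: assms(11) path_loss_def K_def)
  \<comment> \<open>With \<open>l d = K * d powr \<alpha>\<close>, the fading over a positive
    distance \<open>d\<close> exceeds its threshold with probability
    \<open>exp (- (c * d powr \<alpha>))\<close>, where \<open>c\<close> is \<open>cW\<close> for an
    AP and \<open>cL\<close> for an eNB.\<close>
  define cW where "cW = \<mu> * (\<Gamma>cs / PW) * K"
  define cL where "cL = \<mu> * (\<Gamma>ed / PL) * K"
  have c: "0 < cW" "0 < cL" "0 < \<alpha>" using assms K by (auto simp: cW_def cL_def)
  have pos: "0 \<le> \<Gamma>cs / PW" "0 \<le> \<Gamma>ed / PL" using assms by auto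
  \<comment> \<open>The tagged index as a function of the configuration alone, so that it keeps its
    meaning when positions and marks are drawn on separate copies of the space.\<close>
  define near :: "(nat \<Rightarrow> real^2) \<Rightarrow> nat" where "near x = tagged (\<lambda>i x. x i) x" for x
  have near_XS: "near (XS \<omega>) = tagged X \<omega>" for \<omega> by (simp add: near_def tagged_def)
  have coord [measurable]: "(\<lambda>x. x i) \<in> borel_measurable config" for i
    by (rule measurable_component_singleton) simp
  have near_meas [measurable]: "near \<in> config \<rightarrow>\<^sub>M count_space UNIV"
    unfolding near_def[abs_def] by (rule measurable_tagged) measurable
  define access where "access x y v i \<longleftrightarrow> (\<forall>k. v (Fading_LW k i) / l (norm (y k - x i)) \<le> \<Gamma>ed / PL) \<and>
      (\<forall>j. j \<noteq> i \<longrightarrow> v (Timer i) \<le> v (Timer j) \<or> v (Fading_W j i) / l (norm (x j - x i)) \<le> \<Gamma>cs / PW)"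
    for x y :: "nat \<Rightarrow> real^2" and v i
  define f :: "((nat \<Rightarrow> real^2) \<times> (nat \<Rightarrow> real^2)) \<times> (source \<Rightarrow> real) \<Rightarrow> ennreal" where
    "f z = (if access (fst (fst z)) (snd (fst z)) (snd z) (near (fst (fst z))) then 1 else 0)" for z
  have f_meas: "f \<in> borel_measurable ((config \<Otimes>\<^sub>M config) \<Otimes>\<^sub>M mark_space)" (is "_ \<in> borel_measurable ?N")
  proof -
    have [measurable]: "(\<lambda>z. fst (fst z) i) \<in> borel_measurable ?N" "(\<lambda>z. snd (fst z) i) \<in> borel_measurable ?N" for i
      by (auto intro!: measurable_compose[OF _ coord])
    have [measurable]: "(\<lambda>z. snd z s) \<in> borel_measurable ?N" if "s \<in> marks" for s
      by (rule measurable_compose[OF measurable_snd measurable_component_singleton[OF that]])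
    have [measurable]: "(\<lambda>z. snd z (Timer i)) \<in> borel_measurable ?N"
      "(\<lambda>z. snd z (Fading_W j i)) \<in> borel_measurable ?N" "(\<lambda>z. snd z (Fading_LW j i)) \<in> borel_measurable ?N" for i j
      by auto
    have [measurable]: "Measurable.pred ?N (\<lambda>z. access (fst (fst z)) (snd (fst z)) (snd z) i)" for i
      unfolding access_def l by measurable
    show ?thesis
      unfolding f_def[abs_def]
      by (rule measurable_compose_countable[where g="\<lambda>z. near (fst (fst z))" and
            f="\<lambda>i z. if access (fst (fst z)) (snd (fst z)) (snd z) i then 1 else 0"]) measurable
  qed
  define timer_avg where "timer_avg x =
    (\<integral>\<^sup>+t. iprod (\<lambda>j. if j = near x then 1 else 1 - t * exceedance cW \<alpha> (x (near x)) (x j)) * indicator {0..1} t \<partial>lborel)"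
    for x
  define clear where "clear x y = iprod (\<lambda>k. 1 - exceedance cL \<alpha> (x (near x)) (y k))" for x y :: "nat \<Rightarrow> real^2"
  \<comment> \<open>With frozen positions the tagged index is a constant, and the fading conditions
    become membership in fixed Borel sets.\<close>
  have given_positions: "(\<integral>\<^sup>+\<omega>'. f ((x, y), VS \<omega>') \<partial>M) = timer_avg x * clear x y" for x y
  proof -
    let ?i = "near x"
    have "(\<integral>\<^sup>+\<omega>'. f ((x, y), VS \<omega>') \<partial>M) = (\<integral>\<^sup>+\<omega>. indicator {\<omega>\<in>space M.
      (\<forall>k. V (Fading_LW k ?i) \<omega> \<in> {g. g / l (norm (y k - x ?i)) \<le> \<Gamma>ed / PL}) \<and>
      (\<forall>j. j \<noteq> ?i \<longrightarrow> V (Timer ?i) \<omega> \<le> V (Timer j) \<omega> \<or>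
        V (Fading_W j ?i) \<omega> \<in> {g. g / l (norm (x j - x ?i)) \<le> \<Gamma>cs / PW})} \<omega> \<partial>M)"
      by (rule nn_integral_cong) (auto simp: f_def access_def indicator_def)
    also have "\<dots> = emeasure M {\<omega>\<in>space M.
      (\<forall>k. V (Fading_LW k ?i) \<omega> \<in> {g. g / l (norm (y k - x ?i)) \<le> \<Gamma>ed / PL}) \<and>
      (\<forall>j. j \<noteq> ?i \<longrightarrow> V (Timer ?i) \<omega> \<le> V (Timer j) \<omega> \<or>
        V (Fading_W j ?i) \<omega> \<in> {g. g / l (norm (x j - x ?i)) \<le> \<Gamma>cs / PW})}"
      by (rule nn_integral_indicator) measurable
    also have "\<dots> = (\<integral>\<^sup>+t. iprod (\<lambda>j. if j = ?i then 1 else 1 - t * exceedance cW \<alpha> (x ?i) (x j)) * indicator {0..1} t \<partial>lborel) *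
        iprod (\<lambda>k. 1 - exceedance cL \<alpha> (x ?i) (y k))"
    proof (rule mark_probability[OF indep_marks])
      show "distr M borel (V (Timer j)) = uniform_measure lborel {0..1}" for j
        using assms(15) by simp
      show "prob {\<omega>\<in>space M. V (Fading_W j ?i) \<omega> \<in> {g. g / l (norm (x j - x ?i)) \<le> \<Gamma>cs / PW}} =
          1 - exceedance cW \<alpha> (x ?i) (x j)" for j
        using prob_fading_le[OF assms(16)[of j ?i] assms(10) pos(1) K] by (simp add: l cW_def)
      show "prob {\<omega>\<in>space M. V (Fading_LW k ?i) \<omega> \<in> {g. g / l (norm (y k - x ?i)) \<le> \<Gamma>ed / PL}} =
          1 - exceedance cL \<alpha> (x ?i) (y k)" for k
        using prob_fading_le[OF assms(17)[of k ?i] assms(10) pos(2) K] by (simp add: l cL_def)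
    qed measurable
    finally show ?thesis by (simp add: timer_avg_def clear_def)
  qed
  have exc_x [measurable]: "(\<lambda>x. exceedance cW \<alpha> (x (near x)) (x j)) \<in> borel_measurable config" for j
  proof (rule measurable_compose_countable[where g=near and f="\<lambda>i x. exceedance cW \<alpha> (x i) (x j)"])
    show "(\<lambda>x. exceedance cW \<alpha> (x i) (x j)) \<in> borel_measurable config" for i
      unfolding exceedance_def by measurable
  qed measurable
  have timer_avg_meas [measurable]: "timer_avg \<in> borel_measurable config"
  proof -
    define e where "e j x = (if j = near x then 0 else exceedance cW \<alpha> (x (near x)) (x j))" for j x
    have [measurable]: "e j \<in> borel_measurable config" for j
      unfolding e_def[abs_def] by measurable
    have "timer_avg = (\<lambda>x. \<integral>\<^sup>+t. iprod (\<lambda>j. 1 - t * e j x) * indicator {0..1} t \<partial>lborel)"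
      unfolding timer_avg_def by (intro ext nn_integral_cong arg_cong2[where f="(*)"] arg_cong[where f=iprod]) (auto simp: e_def)
    also have "\<dots> \<in> borel_measurable config"
      by measurable
    finally show ?thesis .
  qed
  have clear_meas [measurable]: "(\<lambda>(x, y). clear x y) \<in> borel_measurable (config \<Otimes>\<^sub>M config)"
  proof -
    have [measurable]: "(\<lambda>z. fst z i) \<in> borel_measurable (config \<Otimes>\<^sub>M config)"
      "(\<lambda>z. snd z i) \<in> borel_measurable (config \<Otimes>\<^sub>M config)" for i
      by (auto intro!: measurable_compose[OF _ coord])
    have [measurable]: "(\<lambda>z. exceedance cL \<alpha> (fst z (near (fst z))) (snd z k)) \<in> borel_measurable (config \<Otimes>\<^sub>M config)" for k
    proof (rule measurable_compose_countable[where g="\<lambda>z. near (fst z)" and f="\<lambda>i z. exceedance cL \<alpha> (fst z i) (snd z k)"])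
      show "(\<lambda>z. exceedance cL \<alpha> (fst z i) (snd z k)) \<in> borel_measurable (config \<Otimes>\<^sub>M config)" for i
        unfolding exceedance_def by measurable
    qed measurable
    show ?thesis unfolding clear_def split_def by measurable
  qed
  \<comment> \<open>Stated for every centre \<open>x\<close>, to be used at the random position of
    the tagged AP.\<close>
  have N_L: "N_L l lamL PL \<Gamma>ed \<mu> = lamL * (\<integral>z. exceedance cL \<alpha> x z \<partial>lborel)" for x :: "real^2"
    unfolding exceedance_integral(2)[OF c(2,3)] by (simp add: N_L_def cL_def l mult.assoc)
  have N2_W: "N2_W l lamW PW \<Gamma>cs \<mu> r = neighbourhood_load lamW cW \<alpha> r" for r
    unfolding N2_W_def neighbourhood_load_def set_lebesgue_integral_def
    by (intro arg_cong2[where f="(*)"] refl Bochner_Integration.integral_cong)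
      (auto simp: indicator_def cW_def l mult.assoc)
  have meas_event: "emeasure M {\<omega>\<in>space M. medium_access l PW PL \<Gamma>cs \<Gamma>ed X Y T GW GLW (tagged X \<omega>) \<omega> = 1} =
      (\<integral>\<^sup>+\<omega>. f ((XS \<omega>, YS \<omega>), VS \<omega>) \<partial>M)"
  proof -
    have iff: "medium_access l PW PL \<Gamma>cs \<Gamma>ed X Y T GW GLW (tagged X \<omega>) \<omega> = 1 \<longleftrightarrow> f ((XS \<omega>, YS \<omega>), VS \<omega>) = 1" for \<omega>
      unfolding medium_access_eq_1_iff f_def access_def fst_conv snd_conv near_XS by simp
    have fm: "(\<lambda>\<omega>. f ((XS \<omega>, YS \<omega>), VS \<omega>)) \<in> borel_measurable M"
      by (rule measurable_compose[OF _ f_meas]) measurable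
    then have "{\<omega>\<in>space M. f ((XS \<omega>, YS \<omega>), VS \<omega>) = 1} \<in> sets M" by measurable
    then have "emeasure M {\<omega>\<in>space M. f ((XS \<omega>, YS \<omega>), VS \<omega>) = 1} =
        (\<integral>\<^sup>+\<omega>. indicator {\<omega>\<in>space M. f ((XS \<omega>, YS \<omega>), VS \<omega>) = 1} \<omega> \<partial>M)" by simp
    also have "\<dots> = (\<integral>\<^sup>+\<omega>. f ((XS \<omega>, YS \<omega>), VS \<omega>) \<partial>M)"
      by (rule nn_integral_cong) (simp add: f_def indicator_def)
    finally show ?thesis unfolding iff .
  qed
  also have "\<dots> = (\<integral>\<^sup>+\<omega>. \<integral>\<^sup>+\<omega>'. f ((XS \<omega>, YS \<omega>), VS \<omega>') \<partial>M \<partial>M)"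
    by (rule nn_integral_indep_pair[OF _ VS_meas distr_positions_marks f_meas]) measurable
  also have "\<dots> = (\<integral>\<^sup>+\<omega>. timer_avg (XS \<omega>) * clear (XS \<omega>) (YS \<omega>) \<partial>M)"
    by (simp only: given_positions)
  \<comment> \<open>The eNB positions move to their own copy, so that the Laplace functional can be
    taken around a frozen tagged point.\<close>
  also have "\<dots> = (\<integral>\<^sup>+\<omega>. \<integral>\<^sup>+\<omega>'. timer_avg (XS \<omega>) * clear (XS \<omega>) (YS \<omega>') \<partial>M \<partial>M)"
  proof -
    have "(\<lambda>(x, y). timer_avg x * clear x y) \<in> borel_measurable (config \<Otimes>\<^sub>M config)"
      using clear_meas unfolding split_def by measurable
    from nn_integral_indep_pair[OF XS_meas YS_meas distr_positions this] show ?thesis by simp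
  qed
  also have "\<dots> = (\<integral>\<^sup>+\<omega>. timer_avg (XS \<omega>) * ennreal (exp (- N_L l lamL PL \<Gamma>ed \<mu>)) \<partial>M)"
  proof (rule nn_integral_cong)
    fix \<omega>
    let ?x = "XS \<omega> (near (XS \<omega>))"
    have [measurable]: "exceedance cL \<alpha> ?x \<in> borel_measurable borel"
      unfolding exceedance_def[abs_def] by measurable
    have "(\<integral>\<^sup>+\<omega>'. timer_avg (XS \<omega>) * clear (XS \<omega>) (YS \<omega>') \<partial>M) = timer_avg (XS \<omega>) * (\<integral>\<^sup>+\<omega>'. clear (XS \<omega>) (YS \<omega>') \<partial>M)"
      unfolding clear_def by (rule nn_integral_cmult) measurable
    also have "(\<integral>\<^sup>+\<omega>'. clear (XS \<omega>) (YS \<omega>') \<partial>M) = ennreal (exp (- N_L l lamL PL \<Gamma>ed \<mu>))"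
      unfolding clear_def N_L[of ?x]
      using c by (intro L.laplace_functional exceedance_integral exceedance_bounds) auto
    finally show "(\<integral>\<^sup>+\<omega>'. timer_avg (XS \<omega>) * clear (XS \<omega>) (YS \<omega>') \<partial>M) =
        timer_avg (XS \<omega>) * ennreal (exp (- N_L l lamL PL \<Gamma>ed \<mu>))" .
  qed
  also have "\<dots> = (\<integral>\<^sup>+\<omega>. timer_avg (XS \<omega>) \<partial>M) * ennreal (exp (- N_L l lamL PL \<Gamma>ed \<mu>))"
    by (rule nn_integral_multc) measurable
  also have "(\<integral>\<^sup>+\<omega>. timer_avg (XS \<omega>) \<partial>M) =
    (\<integral>\<^sup>+r. ennreal ((1 - exp (- N2_W l lamW PW \<Gamma>cs \<mu> r)) / N2_W l lamW PW \<Gamma>cs \<mu> r * f_W lamW r) * indicator {0..} r \<partial>lborel)"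
    unfolding timer_avg_def near_XS N2_W by (rule nn_integral_tagged_timer[OF W c(1,3)])
  also have "\<dots> * ennreal (exp (- N_L l lamL PL \<Gamma>ed \<mu>)) =
    (\<integral>\<^sup>+r. ennreal ((1 - exp (- N2_W l lamW PW \<Gamma>cs \<mu> r)) / N2_W l lamW PW \<Gamma>cs \<mu> r * f_W lamW r) * indicator {0..} r *
      ennreal (exp (- N_L l lamL PL \<Gamma>ed \<mu>)) \<partial>lborel)"
    unfolding N2_W f_W_def by (rule nn_integral_multc[symmetric]) measurable
  finally have main: "emeasure M {\<omega>\<in>space M. medium_access l PW PL \<Gamma>cs \<Gamma>ed X Y T GW GLW (tagged X \<omega>) \<omega> = 1} = \<dots>" .
  \<comment> \<open>The computation so far took place in \<open>ennreal\<close>; the integrand is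
    nonnegative, so the Lebesgue integral is \<open>enn2real\<close> of the value found.\<close>
  have "(LINT r:{0..}|lborel. (1 - exp (- N2_W l lamW PW \<Gamma>cs \<mu> r)) / N2_W l lamW PW \<Gamma>cs \<mu> r *
       exp (- N_L l lamL PL \<Gamma>ed \<mu>) * f_W lamW r) =
    enn2real (\<integral>\<^sup>+r. ennreal (indicator {0..} r *\<^sub>R ((1 - exp (- N2_W l lamW PW \<Gamma>cs \<mu> r)) / N2_W l lamW PW \<Gamma>cs \<mu> r *
       exp (- N_L l lamL PL \<Gamma>ed \<mu>) * f_W lamW r)) \<partial>lborel)"
    unfolding set_lebesgue_integral_def
  proof (rule integral_eq_nn_integral)
    show "(\<lambda>r. indicator {0..} r *\<^sub>R ((1 - exp (- N2_W l lamW PW \<Gamma>cs \<mu> r)) / N2_W l lamW PW \<Gamma>cs \<mu> r *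
       exp (- N_L l lamL PL \<Gamma>ed \<mu>) * f_W lamW r)) \<in> borel_measurable lborel"
      unfolding N2_W f_W_def by measurable
    show "AE r in lborel. 0 \<le> indicator {0..} r *\<^sub>R ((1 - exp (- N2_W l lamW PW \<Gamma>cs \<mu> r)) / N2_W l lamW PW \<Gamma>cs \<mu> r *
       exp (- N_L l lamL PL \<Gamma>ed \<mu>) * f_W lamW r)"
      using neighbourhood_load_pos[OF assms(2) c(1,3)] neighbourhood_load_pos[OF assms(2) c(1,3), THEN less_imp_le] assms(2)
      by (intro AE_I2) (auto simp: N2_W f_W_def indicator_def intro!: mult_nonneg_nonneg divide_nonneg_pos)
  qed
  also have "(\<integral>\<^sup>+r. ennreal (indicator {0..} r *\<^sub>R ((1 - exp (- N2_W l lamW PW \<Gamma>cs \<mu> r)) / N2_W l lamW PW \<Gamma>cs \<mu> r *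
       exp (- N_L l lamL PL \<Gamma>ed \<mu>) * f_W lamW r)) \<partial>lborel) =
    (\<integral>\<^sup>+r. ennreal ((1 - exp (- N2_W l lamW PW \<Gamma>cs \<mu> r)) / N2_W l lamW PW \<Gamma>cs \<mu> r * f_W lamW r) * indicator {0..} r *
      ennreal (exp (- N_L l lamL PL \<Gamma>ed \<mu>)) \<partial>lborel)"
  proof (rule nn_integral_cong)
    fix r :: real
    show "ennreal (indicator {0..} r *\<^sub>R ((1 - exp (- N2_W l lamW PW \<Gamma>cs \<mu> r)) / N2_W l lamW PW \<Gamma>cs \<mu> r *
       exp (- N_L l lamL PL \<Gamma>ed \<mu>) * f_W lamW r)) =
      ennreal ((1 - exp (- N2_W l lamW PW \<Gamma>cs \<mu> r)) / N2_W l lamW PW \<Gamma>cs \<mu> r * f_W lamW r) * indicator {0..} r *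
      ennreal (exp (- N_L l lamL PL \<Gamma>ed \<mu>))"
      by (cases "0 \<le> r") (simp_all add: ennreal_mult'[symmetric] ennreal_mult''[symmetric] ac_simps)
  qed
  finally show ?thesis
    unfolding tagged_MAP_def measure_def main by simp
qed

end
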